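(* The metric space $(\mathcal{O}_{L_0}, d_{\mathcal{Q}})$ is complete, where $d_{\mathcal{Q}}$ is the geodesic distance of the quotient metric $\mathcal{Q}$ on $\mathcal{O}_{L_0}$.
   Context: Let $\mathcal{H}$ be an infinite-dimensional real Hilbert space, $\mathcal{B}(\mathcal{H})$ its bounded operators, $\mathcal{B}_2(\mathcal{H})$ the Hilbert–Schmidt operators with $\|a\|_2=\mathrm{Tr}(a^*a)^{1/2}$. For a closed subspace $W$, $\mathcal{B}(W)_s$ (resp. $\mathcal{B}_2(W)_s$) denotes the symmetric bounded (resp. symmetric Hilbert–Schmidt) operators on $W$, and $P_W$ the orthogonal projection onto $W$. Fix $J\in\mathcal{B}(\mathcal{H})$, a linear isometry with $J^2=-1$, $J^*=-J$. Let $\mathrm{Sp}(\mathcal{H})=\{g \text{ invertible in }\mathcal{B}(\mathcal{H}): g^*Jg=J\}$ and $\mathrm{Sp}_2(\mathcal{H})=\{g\in \mathrm{Sp}(\mathcal{H}): g-1\in\mathcal{B}_2(\mathcal{H})\}$, a Banach–Lie group with topology induced by $\|g_1-g_2\|_2$ and Lie algebra $\mathfrak{sp}_2(\mathcal{H})=\{x\in\mathcal{B}_2(\mathcal{H}): xJ=-Jx^*\}$. The Lagrangian Grassmannian $\Lambda(\mathcal{H})$ is the set of closed subspaces $L\subset\mathcal{H}$ with $J(L)=L^\perp$. Fix $L_0\in\Lambda(\mathcal{H})$ and put $\mathcal{O}_{L_0}=\{g(L_0): g\in \mathrm{Sp}_2(\mathcal{H})\}$. Manifold structure: for $L\in\Lambda(\mathcal{H})$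 let $\Omega(L^\perp)=\{W\in\Lambda(\mathcal{H}): \mathcal{H}=W\oplus L^\perp\}$. Each $W\in\Omega(L^\perp)$ is the graph $\{v+Tv: v\in L\}$ of a unique bounded $T:L\to L^\perp$, and $\phi_L(W):=J|_{L^\perp}T\in\mathcal{B}(L)_s$. For $L\in\mathcal{O}_{L_0}$, $\phi_L$ restricts to a bijection $\Omega(L^\perp)\cap\mathcal{O}_{L_0}\to\mathcal{B}_2(L)_s$; these restrictions are the charts giving $\mathcal{O}_{L_0}$ its topology and smooth Hilbert manifold structure. The tangent space $T_W\mathcal{O}_{L_0}$ is identified with $\mathcal{B}_2(W)_s$ through the differential at $W$ of the chart $\phi_W$. For $W\in\mathcal{O}_{L_0}$, $\pi_W:\mathrm{Sp}_2(\mathcal{H})\to\mathcal{O}_{L_0}$ is $\pi_W(g)=g(W)$; its differential at $1$ is $d_1\pi_W(x)=P_WJx|_W\in\mathcal{B}_2(W)_s$ for $x\in\mathfrak{sp}_2(\mathcal{H})$. Quotient metric: for $W\in\mathcal{O}_{L_0}$ and $v\in T_W\mathcal{O}_{L_0}$, $\mathcal{Q}(W,v)=\inf\{\|z\|_2: z\in\mathfrak{sp}_2(\mathcal{H}),\ d_1\pi_W(z)=v\}$. The length of a piecewise smooth curve $\gamma:[0,1]\to\mathcal{O}_{L_0}$ is $L_{\mathcal{Q}}(\gamma)=\int_0^1\mathcal{Q}(\gamma(t),\dot\gamma(t))\,dt$, and $d_{\mathcal{Q}}(S,T)=\inf\{L_{\mathcal{Q}}(\gamma): \gamma \text{ joins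 } S \text{ and } T \text{ in } \mathcal{O}_{L_0}\}$. *)

theory Defs
  imports "HOL-Analysis.Analysis"
begin

section \<open>Hilbert--Schmidt operators\<close>

definition orthonormal_basis :: "'a::real_inner set \<Rightarrow> bool" where
  "orthonormal_basis B \<longleftrightarrow>
     pairwise orthogonal B \<and> (\<forall>e\<in>B. norm e = 1) \<and> closure (span B) = UNIV"

(* Trace and Hilbert--Schmidt class do not depend on the orthonormal basis (which is not
   assumed to be countable), so one basis is chosen once and for all. *)
definition some_basis :: "'a::{real_inner,complete_space} set" where
  "some_basis = (SOME B. orthonormal_basis B)"

definition op_trace :: "('a::{real_inner,complete_space} \<Rightarrow> 'a) \<Rightarrow> real" where
  "op_trace a = (\<Sum>\<^sub>\<infinity>e\<in>some_basis. a e \<bullet> e)"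

definition hilbert_schmidt :: "('a::{real_inner,complete_space} \<Rightarrow>\<^sub>L 'a) \<Rightarrow> bool" where
  "hilbert_schmidt a \<longleftrightarrow>
     (\<lambda>e. adjoint (blinfun_apply a) (blinfun_apply a e) \<bullet> e) summable_on some_basis"

(* meaningful for Hilbert--Schmidt operators only *)
definition hs_norm :: "('a::{real_inner,complete_space} \<Rightarrow>\<^sub>L 'a) \<Rightarrow> real" where
  "hs_norm a = sqrt (op_trace (adjoint (blinfun_apply a) \<circ> blinfun_apply a))"

(* An operator on a closed subspace W is represented by its extension to the whole space
   that vanishes on the orthogonal complement of W; this preserves symmetry and the
   Hilbert--Schmidt norm. *)
definition sym_hs_on :: "'a::{real_inner,complete_space} set \<Rightarrow> ('a \<Rightarrow>\<^sub>L 'a) set" where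
  "sym_hs_on W =
     {a. hilbert_schmidt a \<and> (\<forall>v\<in>W. blinfun_apply a v \<in> W)
        \<and> (\<forall>u\<in>W\<^sup>\<bottom>. blinfun_apply a u = 0)
        \<and> (\<forall>v\<in>W. \<forall>w\<in>W. blinfun_apply a v \<bullet> w = v \<bullet> blinfun_apply a w)}"

definition ortho_proj :: "'a::{real_inner,complete_space} set \<Rightarrow> 'a \<Rightarrow>\<^sub>L 'a" where
  "ortho_proj W =
     (THE P. (\<forall>v\<in>W. blinfun_apply P v = v) \<and> (\<forall>u\<in>W\<^sup>\<bottom>. blinfun_apply P u = 0))"

section \<open>Differentiation with respect to the Hilbert--Schmidt norm\<close>

definition hs_has_derivative ::
    "(real \<Rightarrow> 'a::{real_inner,complete_space} \<Rightarrow>\<^sub>L 'a) \<Rightarrow> ('a \<Rightarrow>\<^sub>L 'a) \<Rightarrow> real \<Rightarrow> real set \<Rightarrow> bool" where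
  "hs_has_derivative f D t S \<longleftrightarrow>
     hilbert_schmidt D \<and> hilbert_schmidt (f t) \<and>
     (\<forall>\<^sub>F s in at t within S. hilbert_schmidt (f s)) \<and>
     ((\<lambda>s. hs_norm ((1 / (s - t)) *\<^sub>R (f s - f t) - D)) \<longlongrightarrow> 0) (at t within S)"

(* of class C-infinity; one-sided derivatives at boundary points of S *)
definition hs_smooth_on ::
    "real set \<Rightarrow> (real \<Rightarrow> 'a::{real_inner,complete_space} \<Rightarrow>\<^sub>L 'a) \<Rightarrow> bool" where
  "hs_smooth_on S f \<longleftrightarrow>
     (\<exists>D :: nat \<Rightarrow> real \<Rightarrow> 'a \<Rightarrow>\<^sub>L 'a.
        (\<forall>t\<in>S. D 0 t = f t) \<and>
        (\<forall>n. \<forall>t\<in>S. hs_has_derivative (D n) (D (Suc n) t) t S))"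

section \<open>Symplectic groups and the Lagrangian Grassmannian\<close>

definition Sp :: "('a::{real_inner,complete_space} \<Rightarrow>\<^sub>L 'a) \<Rightarrow> ('a \<Rightarrow>\<^sub>L 'a) set" where
  "Sp J =
     {g. (\<exists>h. g o\<^sub>L h = id_blinfun \<and> h o\<^sub>L g = id_blinfun) \<and>
         adjoint (blinfun_apply g) \<circ> blinfun_apply J \<circ> blinfun_apply g = blinfun_apply J}"

definition Sp2 :: "('a::{real_inner,complete_space} \<Rightarrow>\<^sub>L 'a) \<Rightarrow> ('a \<Rightarrow>\<^sub>L 'a) set" where
  "Sp2 J = {g \<in> Sp J. hilbert_schmidt (g - id_blinfun)}"

definition sp2_algebra :: "('a::{real_inner,complete_space} \<Rightarrow>\<^sub>L 'a) \<Rightarrow> ('a \<Rightarrow>\<^sub>L 'a) set" where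
  "sp2_algebra J =
     {x. hilbert_schmidt x \<and>
         (\<forall>v. blinfun_apply x (blinfun_apply J v) =
              - blinfun_apply J (adjoint (blinfun_apply x) v))}"

definition Lagrangian :: "('a::{real_inner,complete_space} \<Rightarrow>\<^sub>L 'a) \<Rightarrow> 'a set set" where
  "Lagrangian J = {L. subspace L \<and> closed L \<and> blinfun_apply J ` L = L\<^sup>\<bottom>}"

definition Sp2_orbit ::
    "('a::{real_inner,complete_space} \<Rightarrow>\<^sub>L 'a) \<Rightarrow> 'a set \<Rightarrow> 'a set set" where
  "Sp2_orbit J L0 = {blinfun_apply g ` L0 | g. g \<in> Sp2 J}"

section \<open>Charts and smooth curves\<close>

(* chart_dom J L is the set usually written as Omega of the orthogonal complement of L *)
definition chart_dom ::
    "('a::{real_inner,complete_space} \<Rightarrow>\<^sub>L 'a) \<Rightarrow> 'a set \<Rightarrow> 'a set set" where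
  "chart_dom J L =
     {W \<in> Lagrangian J. W \<inter> L\<^sup>\<bottom> = {0} \<and> (\<forall>x. \<exists>w\<in>W. \<exists>u\<in>L\<^sup>\<bottom>. x = w + u)}"

definition graph_op ::
    "'a::{real_inner,complete_space} set \<Rightarrow> 'a set \<Rightarrow> 'a \<Rightarrow>\<^sub>L 'a" where
  "graph_op L W =
     (THE T. (\<forall>v\<in>L. blinfun_apply T v \<in> L\<^sup>\<bottom>) \<and> (\<forall>u\<in>L\<^sup>\<bottom>. blinfun_apply T u = 0)
           \<and> W = {v + blinfun_apply T v | v. v \<in> L})"

definition chart ::
    "('a::{real_inner,complete_space} \<Rightarrow>\<^sub>L 'a) \<Rightarrow> 'a set \<Rightarrow> 'a set \<Rightarrow> 'a \<Rightarrow>\<^sub>L 'a" where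
  "chart J L W = J o\<^sub>L graph_op L W"

definition smooth_curve_on ::
    "('a::{real_inner,complete_space} \<Rightarrow>\<^sub>L 'a) \<Rightarrow> 'a set \<Rightarrow> real \<Rightarrow> real \<Rightarrow> (real \<Rightarrow> 'a set) \<Rightarrow> bool" where
  "smooth_curve_on J L0 a b \<gamma> \<longleftrightarrow>
     (\<forall>t\<in>{a..b}. \<exists>L\<in>Sp2_orbit J L0. \<exists>\<epsilon>>0.
        (\<forall>s\<in>{a..b} \<inter> {t-\<epsilon><..<t+\<epsilon>}. \<gamma> s \<in> chart_dom J L \<inter> Sp2_orbit J L0) \<and>
        hs_smooth_on ({a..b} \<inter> {t-\<epsilon><..<t+\<epsilon>}) (\<lambda>s. chart J L (\<gamma> s)))"

(* Continuity at the break points is implied: the pieces are smooth on closed intervals. *)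
definition piecewise_smooth_curve ::
    "('a::{real_inner,complete_space} \<Rightarrow>\<^sub>L 'a) \<Rightarrow> 'a set \<Rightarrow> (real \<Rightarrow> 'a set) \<Rightarrow> bool" where
  "piecewise_smooth_curve J L0 \<gamma> \<longleftrightarrow>
     (\<exists>(n::nat) (\<tau>::nat \<Rightarrow> real). \<tau> 0 = 0 \<and> \<tau> n = 1 \<and>
        (\<forall>i<n. \<tau> i < \<tau> (Suc i) \<and> smooth_curve_on J L0 (\<tau> i) (\<tau> (Suc i)) \<gamma>))"

(* The tangent space at W is identified with sym_hs_on W through the chart centred at W.
   At the finitely many break points of a piecewise smooth curve the value is irrelevant. *)
definition velocity ::
    "('a::{real_inner,complete_space} \<Rightarrow>\<^sub>L 'a) \<Rightarrow> (real \<Rightarrow> 'a set) \<Rightarrow> real \<Rightarrow> 'a \<Rightarrow>\<^sub>L 'a" where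
  "velocity J \<gamma> t =
     (THE v. v \<in> sym_hs_on (\<gamma> t) \<and>
            hs_has_derivative (\<lambda>s. chart J (\<gamma> t) (\<gamma> s)) v t {0..1})"

section \<open>The quotient metric and its geodesic distance\<close>

(* differential at 1 of the orbit map g \<mapsto> g(W), in the above identification *)
definition d_orbit_map ::
    "('a::{real_inner,complete_space} \<Rightarrow>\<^sub>L 'a) \<Rightarrow> 'a set \<Rightarrow> ('a \<Rightarrow>\<^sub>L 'a) \<Rightarrow> 'a \<Rightarrow>\<^sub>L 'a" where
  "d_orbit_map J W x = ortho_proj W o\<^sub>L J o\<^sub>L x o\<^sub>L ortho_proj W"

definition quotient_metric ::
    "('a::{real_inner,complete_space} \<Rightarrow>\<^sub>L 'a) \<Rightarrow> 'a set \<Rightarrow> ('a \<Rightarrow>\<^sub>L 'a) \<Rightarrow> real" where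
  "quotient_metric J W v = Inf {hs_norm z | z. z \<in> sp2_algebra J \<and> d_orbit_map J W z = v}"

definition curve_length ::
    "('a::{real_inner,complete_space} \<Rightarrow>\<^sub>L 'a) \<Rightarrow> (real \<Rightarrow> 'a set) \<Rightarrow> real" where
  "curve_length J \<gamma> = integral {0..1} (\<lambda>t. quotient_metric J (\<gamma> t) (velocity J \<gamma> t))"

(* The value 0 outside the orbit is a dummy: the locale Metric_space asks for nonnegativity
   and symmetry on the whole type. *)
definition geodesic_dist ::
    "('a::{real_inner,complete_space} \<Rightarrow>\<^sub>L 'a) \<Rightarrow> 'a set \<Rightarrow> 'a set \<Rightarrow> 'a set \<Rightarrow> real" where
  "geodesic_dist J L0 S T =
     (if S \<in> Sp2_orbit J L0 \<and> T \<in> Sp2_orbit J L0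
      then Inf {curve_length J \<gamma> | \<gamma>. piecewise_smooth_curve J L0 \<gamma> \<and> \<gamma> 0 = S \<and> \<gamma> 1 = T}
      else 0)"

end

theory Submission
  imports Defs
begin

text \<open>
  The distance is compared with the Hilbert--Schmidt distance of orthogonal projections, and
  completeness is inherited from there.

  The quotient metric is the Hilbert--Schmidt norm: \<open>z\<close> belongs to the Lie algebra if and only if
  \<open>J z\<close> is symmetric, the differential of the orbit map compresses \<open>J z\<close> to \<open>W\<close>, and compression
  does not increase the norm, so the infimum over the fibre of \<open>v\<close> is attained at \<open>- J v\<close>
  (\<open>quotient_metric_eq\<close>). If a curve in the orbit has velocity \<open>v\<close>, the orthogonal projections onto its
  points have the derivative \<open>v J - J v\<close>, whose norm is at most \<open>2 \<parallel>v\<parallel>\<^sub>2\<close>. Integration along the curve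
  gives \<open>\<parallel>P\<^sub>T - P\<^sub>S\<parallel>\<^sub>2 \<le> 2 l\<close> for every curve of length \<open>l\<close> from \<open>S\<close> to \<open>T\<close> (\<open>hs_norm_proj_diff_le\<close>). In
  particular distinct points have positive distance.

  In the opposite direction, if \<open>W\<close> is the graph of \<open>T\<close> over \<open>L\<close>, the graphs of the multiples \<open>s T\<close> form
  a curve from \<open>L\<close> to \<open>W\<close> of length at most \<open>\<parallel>T\<parallel>\<^sub>2\<close> (\<open>segment_path\<close>). When \<open>\<parallel>P\<^sub>W - P\<^sub>L\<parallel> \<le> 1/2\<close> there is such
  a graph operator (\<open>proj_close_graph\<close>), with \<open>\<parallel>T\<parallel>\<^sub>2 \<le> 2 \<parallel>P\<^sub>W - P\<^sub>L\<parallel>\<^sub>2\<close> (\<open>graph_op_hs_estimate\<close>).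

  So for a Cauchy sequence in the orbit the projections are Cauchy in the Hilbert--Schmidt norm. Their
  limit is the projection onto a Lagrangian subspace \<open>W\<close> (\<open>Lagrangian_limit\<close>), which is eventually a
  graph over the members of the sequence, of an operator \<open>T\<close> with small norm. The shear \<open>1 + T\<close> is an
  element of the restricted symplectic group, so \<open>W\<close> is in the orbit, and the segments show
  convergence in the geodesic distance.

  The distance is finite, and the triangle inequality meaningful, because the orbit is connected.
  For \<open>S\<close> and \<open>T\<close> in the orbit \<open>P\<^sub>T - P\<^sub>S\<close> is a Hilbert--Schmidt operator and therefore compact. This gives
  a finite-dimensional intersection \<open>T \<inter> S\<^sup>\<bottom>\<close> and a lower bound for \<open>P\<^sub>S\<close> on its complement in \<open>T\<close>
  (\<open>proj_below\<close>). Modifying \<open>T\<close> on that intersection produces a point of the orbit that is a graph over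
  \<open>S\<close> as well as over \<open>T\<close> (\<open>common_chart\<close>), and two segments join \<open>S\<close> to \<open>T\<close>.
\<close>

section \<open>Orthogonal projections and adjoints in a Hilbert space\<close>

lemma orthogonal_comp_iff: "x \<in> W\<^sup>\<bottom> \<longleftrightarrow> (\<forall>y\<in>W. x \<bullet> y = 0)"
  by (auto simp: orthogonal_comp_def orthogonal_def inner_commute)

lemma closed_orthogonal_comp: "closed (W\<^sup>\<bottom>)"
proof -
  have "W\<^sup>\<bottom> = (\<Inter>y\<in>W. {x. x \<bullet> y = 0})"
    by (auto simp: orthogonal_comp_iff)
  moreover have "closed (\<Inter>y\<in>W. {x. x \<bullet> y = 0})"
    by (intro closed_INT ballI closed_Collect_eq continuous_intros)
  ultimately show ?thesis by simp
qed

text \<open>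
  By the parallelogram law a minimizing sequence for the distance from \<open>x\<close> to \<open>W\<close> is a Cauchy
  sequence; its limit is a nearest point, and the first variation of the distance at a nearest
  point vanishes in every direction of \<open>W\<close>.
\<close>

lemma orthogonal_decomposition:
  fixes W :: "'a::{real_inner,complete_space} set"
  assumes W: "subspace W" "closed W"
  obtains y where "y \<in> W" "x - y \<in> W\<^sup>\<bottom>"
proof -
  define d where "d = Inf ((\<lambda>w. (norm (x - w))\<^sup>2) ` W)"
  have ne: "W \<noteq> {}" using W(1) subspace_0 by blast
  have bdd: "bdd_below ((\<lambda>w. (norm (x - w))\<^sup>2) ` W)"
    by (rule bdd_belowI[of _ 0]) auto
  have d_le: "d \<le> (norm (x - w))\<^sup>2" if "w \<in> W" for w
    unfolding d_def by (rule cInf_lower) (use that bdd in auto)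
  have "\<exists>w\<in>W. (norm (x - w))\<^sup>2 < d + 1 / real (Suc n)" for n
    using cInf_lessD[of "(\<lambda>w. (norm (x - w))\<^sup>2) ` W" "d + 1 / real (Suc n)"] ne
    by (auto simp: d_def[symmetric])
  then obtain u where uW: "\<And>n. u n \<in> W" and ud: "\<And>n. (norm (x - u n))\<^sup>2 < d + 1 / real (Suc n)"
    by metis
  have par: "(norm (u m - u n))\<^sup>2 \<le> 2 / real (Suc m) + 2 / real (Suc n)" for m n
  proof -
    have "(1/2) *\<^sub>R (u m + u n) \<in> W" using uW W(1) by (simp add: subspace_add subspace_scale)
    from d_le[OF this] have "d \<le> (norm (x - (1/2) *\<^sub>R (u m + u n)))\<^sup>2" .
    moreover have "(norm (u m - u n))\<^sup>2 = 2 * (norm (x - u m))\<^sup>2 + 2 * (norm (x - u n))\<^sup>2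
       - 4 * (norm (x - (1/2) *\<^sub>R (u m + u n)))\<^sup>2"
      by (simp add: power2_norm_eq_inner inner_diff inner_add inner_commute algebra_simps)
    moreover have "2 * (1 / real (Suc k)) = 2 / real (Suc k)" for k by simp
    ultimately show ?thesis using ud[of m] ud[of n] by smt
  qed
  have "Cauchy u"
  proof (rule metric_CauchyI)
    fix e :: real assume e: "e > 0"
    obtain N where N: "1 / real (Suc N) < e\<^sup>2 / 4"
      using nat_approx_posE[of "e\<^sup>2/4"] e by auto
    show "\<exists>M. \<forall>m\<ge>M. \<forall>n\<ge>M. dist (u m) (u n) < e"
    proof (intro exI allI impI)
      fix m n assume "m \<ge> N" "n \<ge> N"
      then have "1 / real (Suc m) \<le> 1 / real (Suc N)" "1 / real (Suc n) \<le> 1 / real (Suc N)"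
        by (simp_all add: frac_le)
      with par[of m n] N have "(norm (u m - u n))\<^sup>2 < e\<^sup>2" by simp
      then show "dist (u m) (u n) < e" using e by (simp add: dist_norm power_less_imp_less_base)
    qed
  qed
  then obtain y where y: "u \<longlonglongrightarrow> y" using Cauchy_convergent convergent_def by blast
  have yW: "y \<in> W" using closed_sequentially[OF W(2)] uW y by blast
  have "(\<lambda>n. (norm (x - u n))\<^sup>2) \<longlonglongrightarrow> (norm (x - y))\<^sup>2"
    by (intro tendsto_intros y)
  moreover have "(\<lambda>n. d + 1 / real (Suc n)) \<longlonglongrightarrow> d + 0"
    by (intro tendsto_intros LIMSEQ_Suc lim_1_over_n)
  ultimately have yd: "(norm (x - y))\<^sup>2 \<le> d"
    using LIMSEQ_le ud by (metis (no_types, lifting) add.right_neutral less_imp_le)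
  have "(x - y) \<bullet> w = 0" if w: "w \<in> W" for w
  proof (cases "w = 0")
    case False
    \<comment> \<open>the step along \<open>w\<close> that minimizes the distance\<close>
    define t where "t = ((x - y) \<bullet> w) / (w \<bullet> w)"
    have "y + t *\<^sub>R w \<in> W" using yW w W(1) by (simp add: subspace_add subspace_scale)
    from d_le[OF this] yd have "(norm (x - y))\<^sup>2 \<le> (norm ((x - y) - t *\<^sub>R w))\<^sup>2"
      unfolding diff_diff_eq by linarith
    also have "\<dots> = (norm (x - y))\<^sup>2 - 2 * t * ((x - y) \<bullet> w) + t\<^sup>2 * (w \<bullet> w)"
      unfolding power2_norm_eq_inner
      by (simp only: inner_diff_left inner_diff_right inner_scaleR_left inner_scaleR_right
          inner_commute power2_eq_square)
    also have "\<dots> = (norm (x - y))\<^sup>2 - ((x - y) \<bullet> w)\<^sup>2 / (w \<bullet> w)"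
      using False by (simp add: t_def power2_eq_square field_simps)
    finally have "((x - y) \<bullet> w)\<^sup>2 / (w \<bullet> w) \<le> 0" by simp
    moreover have "w \<bullet> w > 0" using False by simp
    ultimately show ?thesis by (simp add: divide_le_0_iff)
  qed simp
  then show ?thesis using that[OF yW] by (simp add: orthogonal_comp_iff)
qed

lemma orthogonal_decomposition_unique:
  assumes "subspace W" "y \<in> W" "y' \<in> W" "x - y \<in> W\<^sup>\<bottom>" "x - y' \<in> W\<^sup>\<bottom>"
  shows "y = y'"
proof -
  have "y - y' \<in> W" using assms by (simp add: subspace_diff)
  moreover have "(x - y') - (x - y) \<in> W\<^sup>\<bottom>"
    using assms subspace_orthogonal_comp subspace_diff by blast
  then have "y - y' \<in> W\<^sup>\<bottom>" by simp
  ultimately have "(y - y') \<bullet> (y - y') = 0" by (simp add: orthogonal_comp_iff)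
  then show ?thesis by simp
qed

lemma ortho_proj_exists:
  fixes W :: "'a::{real_inner,complete_space} set"
  assumes W: "subspace W" "closed W"
  obtains P :: "'a \<Rightarrow>\<^sub>L 'a" where "\<And>x. blinfun_apply P x \<in> W" "\<And>x. x - blinfun_apply P x \<in> W\<^sup>\<bottom>"
proof -
  have "\<forall>x. \<exists>y. y \<in> W \<and> x - y \<in> W\<^sup>\<bottom>"
    by (metis orthogonal_decomposition[OF W])
  then obtain p where p: "\<And>x. p x \<in> W" "\<And>x. x - p x \<in> W\<^sup>\<bottom>"
    by (auto dest!: choice)
  note uniq = orthogonal_decomposition_unique[OF W(1)]
  have so: "subspace (W\<^sup>\<bottom>)" by (rule subspace_orthogonal_comp)
  have "p (x + y) = p x + p y" for x y
  proof (rule uniq[OF p(1) _ p(2)])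
    show "p x + p y \<in> W" using p W by (simp add: subspace_add)
    have "(x - p x) + (y - p y) \<in> W\<^sup>\<bottom>" using p so by (simp add: subspace_add)
    then show "x + y - (p x + p y) \<in> W\<^sup>\<bottom>" by (simp add: algebra_simps)
  qed
  moreover have "p (c *\<^sub>R x) = c *\<^sub>R p x" for c x
  proof (rule uniq[OF p(1) _ p(2)])
    show "c *\<^sub>R p x \<in> W" using p W by (simp add: subspace_scale)
    have "c *\<^sub>R (x - p x) \<in> W\<^sup>\<bottom>" using p so by (simp add: subspace_scale)
    then show "c *\<^sub>R x - c *\<^sub>R p x \<in> W\<^sup>\<bottom>" by (simp add: algebra_simps)
  qed
  moreover have "norm (p x) \<le> norm x * 1" for x
  proof -
    have "p x \<bullet> (x - p x) = 0" using p by (simp add: orthogonal_comp_iff inner_commute)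
    then have "(norm (p x))\<^sup>2 = p x \<bullet> x" by (simp add: power2_norm_eq_inner inner_diff_right)
    also have "\<dots> \<le> norm (p x) * norm x" by (rule norm_cauchy_schwarz)
    finally have "norm (p x) * norm (p x) \<le> norm (p x) * norm x" by (simp add: power2_eq_square)
    then show ?thesis by (cases "norm (p x) = 0") auto
  qed
  ultimately have "bounded_linear p" by (rule bounded_linear_intro)
  then show ?thesis using that[of "Blinfun p"] p by (simp add: bounded_linear_Blinfun_apply)
qed

text \<open>
  This justifies the definite description in the definition of \<^const>\<open>ortho_proj\<close>: an operator is
  determined by its restrictions to \<open>W\<close> and to the orthogonal complement, because these two
  subspaces span the whole space.
\<close>

lemma ortho_proj_characterization:
  fixes W :: "'a::{real_inner,complete_space} set"
  assumes W: "subspace W" "closed W"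
  shows "ortho_proj W x \<in> W" "x - ortho_proj W x \<in> W\<^sup>\<bottom>"
proof -
  obtain P :: "'a \<Rightarrow>\<^sub>L 'a" where P: "\<And>x. P x \<in> W" "\<And>x. x - P x \<in> W\<^sup>\<bottom>"
    using ortho_proj_exists[OF W] by blast
  have "ortho_proj W = P"
    unfolding ortho_proj_def
  proof (rule the_equality)
    show "(\<forall>v\<in>W. P v = v) \<and> (\<forall>u\<in>W\<^sup>\<bottom>. P u = 0)"
    proof (intro conjI ballI)
      fix v assume "v \<in> W"
      then show "P v = v"
        using orthogonal_decomposition_unique[OF W(1) P(1) _ P(2), of v v]
          subspace_0[OF subspace_orthogonal_comp[of W]] by simp
    next
      fix v assume "v \<in> W\<^sup>\<bottom>"
      then show "P v = 0"
        using orthogonal_decomposition_unique[OF W(1) P(1) subspace_0 P(2), of v] W by simp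
    qed
    fix Q :: "'a \<Rightarrow>\<^sub>L 'a" assume Q: "(\<forall>v\<in>W. Q v = v) \<and> (\<forall>u\<in>W\<^sup>\<bottom>. Q u = 0)"
    show "Q = P"
    proof (rule blinfun_eqI)
      fix x
      have "Q (x - P x) = 0" "Q (P x) = P x" using Q P by auto
      then show "Q x = P x" by (simp add: blinfun.diff_right)
    qed
  qed
  then show "ortho_proj W x \<in> W" "x - ortho_proj W x \<in> W\<^sup>\<bottom>" using P by auto
qed

context
  fixes W :: "'a::{real_inner,complete_space} set"
  assumes W: "subspace W" "closed W"
begin

lemma ortho_proj_in: "ortho_proj W x \<in> W"
  and ortho_proj_diff: "x - ortho_proj W x \<in> W\<^sup>\<bottom>"
  using ortho_proj_characterization[OF W] .

lemma ortho_proj_id: "x \<in> W \<Longrightarrow> ortho_proj W x = x"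
  using orthogonal_decomposition_unique[OF W(1) ortho_proj_in _ ortho_proj_diff, of x x]
    subspace_0[OF subspace_orthogonal_comp[of W]] by simp

lemma ortho_proj_zero: "x \<in> W\<^sup>\<bottom> \<Longrightarrow> ortho_proj W x = 0"
  using orthogonal_decomposition_unique[OF W(1) ortho_proj_in subspace_0 ortho_proj_diff, of x] W
  by simp

lemma ortho_proj_idem: "ortho_proj W (ortho_proj W x) = ortho_proj W x"
  by (simp add: ortho_proj_id ortho_proj_in)

lemma ortho_proj_sym: "ortho_proj W x \<bullet> y = x \<bullet> blinfun_apply (ortho_proj W) y"
proof -
  let ?P = "blinfun_apply (ortho_proj W)"
  have "(x - ?P x) \<bullet> ?P y = 0" "(y - ?P y) \<bullet> ?P x = 0"
    using ortho_proj_in ortho_proj_diff by (auto simp: orthogonal_comp_iff)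
  then show ?thesis by (simp add: inner_diff inner_commute)
qed

lemma norm_ortho_proj_le: "norm (ortho_proj W x) \<le> norm x"
proof -
  let ?P = "blinfun_apply (ortho_proj W)"
  have "(norm (?P x))\<^sup>2 = ?P x \<bullet> x"
    by (metis ortho_proj_idem ortho_proj_sym power2_norm_eq_inner)
  also have "\<dots> \<le> norm (?P x) * norm x" by (rule norm_cauchy_schwarz)
  finally have "norm (?P x) * norm (?P x) \<le> norm (?P x) * norm x" by (simp add: power2_eq_square)
  then show ?thesis by (cases "norm (?P x) = 0") auto
qed

lemma norm_ortho_proj: "norm (ortho_proj W) \<le> 1"
  by (rule norm_blinfun_bound) (use norm_ortho_proj_le in auto)

lemma norm_id_minus_ortho_proj: "norm (id_blinfun - ortho_proj W) \<le> 1"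
proof (rule norm_blinfun_bound)
  fix x
  let ?P = "blinfun_apply (ortho_proj W)"
  have "(x - ?P x) \<bullet> ?P x = 0" using ortho_proj_in ortho_proj_diff by (auto simp: orthogonal_comp_iff)
  then have "(norm (x - ?P x))\<^sup>2 = (norm x)\<^sup>2 - (norm (?P x))\<^sup>2"
    by (simp add: power2_norm_eq_inner inner_diff inner_commute)
  then have "(norm (x - ?P x))\<^sup>2 \<le> (norm x)\<^sup>2" by simp
  then show "norm ((id_blinfun - ortho_proj W) x) \<le> 1 * norm x"
    using power2_le_imp_le[OF _ norm_ge_zero] by (simp add: blinfun.diff_left)
qed simp

lemma ortho_proj_orthogonal_comp: "ortho_proj W x = 0 \<longleftrightarrow> x \<in> W\<^sup>\<bottom>"
  using ortho_proj_zero ortho_proj_diff[of x] by auto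

lemma ortho_proj_fixed: "ortho_proj W x = x \<longleftrightarrow> x \<in> W"
  by (metis ortho_proj_id ortho_proj_in)

end

text \<open>
  The orthogonal complement of the kernel of a nonzero functional contains a vector \<open>u\<close> outside
  the kernel, and \<open>x - (f x / f u) u\<close> always lies in the kernel, hence is orthogonal to \<open>u\<close>.
\<close>

lemma riesz_representation:
  fixes f :: "'a::{real_inner,complete_space} \<Rightarrow> real"
  assumes f: "bounded_linear f"
  obtains y where "\<And>x. f x = x \<bullet> y"
proof (cases "\<forall>x. f x = 0")
  case True then show ?thesis using that[of 0] by simp
next
  case False
  interpret bounded_linear f by fact
  define K where "K = {x. f x = 0}"
  have K: "subspace K" by (simp add: K_def subspace_def add scale zero)
  have Kc: "closed K"
    unfolding K_def by (intro closed_Collect_eq continuous_on[OF continuous_on_id] continuous_on_const)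
  obtain z where z: "f z \<noteq> 0" using False by blast
  obtain k where k: "k \<in> K" "z - k \<in> K\<^sup>\<bottom>" using orthogonal_decomposition[OF K Kc] by blast
  define u where "u = z - k"
  have fu: "f u \<noteq> 0" using z k by (simp add: u_def diff K_def)
  then have "u \<noteq> 0" using zero by auto
  then have uu: "u \<bullet> u \<noteq> 0" by simp
  have "f x = x \<bullet> ((f u / (u \<bullet> u)) *\<^sub>R u)" for x
  proof -
    have "x - (f x / f u) *\<^sub>R u \<in> K" using fu by (simp add: K_def diff scale)
    then have "u \<bullet> (x - (f x / f u) *\<^sub>R u) = 0" using k(2) by (simp add: u_def orthogonal_comp_iff)
    then have "x \<bullet> u = (f x / f u) * (u \<bullet> u)" by (simp add: inner_diff inner_commute)
    then show ?thesis using fu uu by (simp add: field_simps)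
  qed
  then show ?thesis using that by blast
qed

text \<open>
  The constant \<^const>\<open>adjoint\<close> is a choice among the functions with this property; that there is one
  is the Riesz representation of \<open>x \<mapsto> \<langle>a x, y\<rangle>\<close>.
\<close>

lemma adjoint_inner:
  fixes a :: "'a::{real_inner,complete_space} \<Rightarrow>\<^sub>L 'a"
  shows "blinfun_apply a x \<bullet> y = x \<bullet> adjoint (blinfun_apply a) y"
proof -
  have "\<exists>z. \<forall>x. a x \<bullet> y = x \<bullet> z" for y
  proof -
    have "bounded_linear (\<lambda>x. a x \<bullet> y)"
      by (intro bounded_linear_intros blinfun.bounded_linear_right)
    from riesz_representation[OF this] show ?thesis by metis
  qed
  then have "\<exists>f'. \<forall>x y. a x \<bullet> y = x \<bullet> f' y" by metis
  from someI_ex[OF this] show ?thesis unfolding adjoint_def by blast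
qed

text \<open>
  The adjoint as a bounded operator, so that it can be composed with others and has a
  Hilbert--Schmidt norm.
\<close>

definition adj :: "('a::{real_inner,complete_space} \<Rightarrow>\<^sub>L 'a) \<Rightarrow> 'a \<Rightarrow>\<^sub>L 'a" where
  "adj a = Blinfun (adjoint (blinfun_apply a))"

text \<open>
  Boundedness comes from \<open>\<parallel>a\<^sup>* x\<parallel>\<^sup>2 = \<langle>a a\<^sup>* x, x\<rangle> \<le> \<parallel>a\<parallel> \<parallel>a\<^sup>* x\<parallel> \<parallel>x\<parallel>\<close>.
\<close>

lemma adj_apply: "blinfun_apply (adj a) = adjoint (blinfun_apply a)"
  for a :: "'a::{real_inner,complete_space} \<Rightarrow>\<^sub>L 'a"
proof -
  let ?b = "adjoint (blinfun_apply a)"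
  have ext: "u = v" if "\<And>x. x \<bullet> u = x \<bullet> v" for u v :: 'a
    using that[of "u - v"] by (metis inner_diff_right inner_eq_zero_iff right_minus_eq)
  have "?b (x + y) = ?b x + ?b y" for x y
    by (rule ext) (simp add: adjoint_inner[symmetric] inner_add_right)
  moreover have "?b (c *\<^sub>R x) = c *\<^sub>R ?b x" for c x
    by (rule ext) (simp add: adjoint_inner[symmetric])
  moreover have "norm (?b x) \<le> norm x * norm a" for x
  proof -
    have "norm (?b x) * norm (?b x) = a (?b x) \<bullet> x"
      by (simp add: adjoint_inner power2_norm_eq_inner[symmetric] power2_eq_square)
    also have "\<dots> \<le> norm (a (?b x)) * norm x" by (rule norm_cauchy_schwarz)
    also have "\<dots> \<le> (norm a * norm (?b x)) * norm x" by (intro mult_right_mono norm_blinfun) simp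
    finally have "norm (?b x) * norm (?b x) \<le> norm (?b x) * (norm x * norm a)" by (simp add: ac_simps)
    then show ?thesis by (cases "norm (?b x) = 0") (auto simp: mult_le_cancel_left)
  qed
  ultimately have "bounded_linear ?b" by (rule bounded_linear_intro)
  then show ?thesis by (simp add: adj_def bounded_linear_Blinfun_apply)
qed

lemma adj_inner: "blinfun_apply a x \<bullet> y = x \<bullet> adj a y"
  by (simp add: adj_apply adjoint_inner)

lemma adj_unique:
  assumes "\<And>x y. blinfun_apply a x \<bullet> y = x \<bullet> blinfun_apply b y"
  shows "adj a = b"
proof (rule blinfun_eqI)
  fix y
  have "(adj a y - b y) \<bullet> (adj a y - b y) = 0"
    by (subst inner_diff_right) (simp add: adj_inner[symmetric] assms[symmetric])
  then show "adj a y = b y" by simp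
qed

lemma adj_adj: "adj (adj a) = a"
  by (rule adj_unique) (metis adj_inner inner_commute)

lemma adj_compose: "adj (a o\<^sub>L b) = adj b o\<^sub>L adj a"
  by (rule adj_unique) (simp add: adj_inner)

lemma norm_adj_le: "norm (adj a) \<le> norm a"
proof (rule norm_blinfun_bound)
  fix x
  let ?y = "adj a x"
  have "norm ?y * norm ?y = a ?y \<bullet> x"
    by (simp add: adj_inner power2_norm_eq_inner[symmetric] power2_eq_square)
  also have "\<dots> \<le> norm (a ?y) * norm x" by (rule norm_cauchy_schwarz)
  also have "\<dots> \<le> (norm a * norm ?y) * norm x" by (intro mult_right_mono norm_blinfun) simp
  finally have "norm ?y * norm ?y \<le> norm ?y * (norm a * norm x)" by (simp add: ac_simps)
  then show "norm ?y \<le> norm a * norm x" by (cases "norm ?y = 0") (auto simp: mult_le_cancel_left)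
qed simp

section \<open>Orthonormal bases\<close>

definition orthonormal :: "'a::real_inner set \<Rightarrow> bool" where
  "orthonormal B \<longleftrightarrow> pairwise orthogonal B \<and> (\<forall>e\<in>B. norm e = 1)"

lemma orthonormal_inner:
  assumes "orthonormal B" "e \<in> B" "f \<in> B"
  shows "e \<bullet> f = (if e = f then 1 else 0)"
  using assms by (auto simp: orthonormal_def pairwise_def orthogonal_def power2_norm_eq_inner[symmetric])

lemma orthonormal_subset: "orthonormal B \<Longrightarrow> F \<subseteq> B \<Longrightarrow> orthonormal F"
  by (auto simp: orthonormal_def pairwise_def)

lemma subspace_closure:
  fixes S :: "'a::real_normed_vector set"
  assumes "subspace S"
  shows "subspace (closure S)"
proof (rule subspaceI)
  show "0 \<in> closure S" using assms closure_subset subspace_0 by blast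
next
  fix x y assume "x \<in> closure S" "y \<in> closure S"
  then obtain f g where "\<And>n. f n \<in> S" "f \<longlonglongrightarrow> x" "\<And>n. g n \<in> S" "g \<longlonglongrightarrow> y"
    by (auto simp: closure_sequential)
  then have "(\<lambda>n. f n + g n) \<longlonglongrightarrow> x + y" "\<And>n. f n + g n \<in> S"
    using assms by (auto intro: tendsto_add subspace_add)
  then show "x + y \<in> closure S"
    unfolding closure_sequential by (intro exI[of _ "\<lambda>n. f n + g n"]) auto
next
  fix c x assume "x \<in> closure S"
  then obtain f where "\<And>n. f n \<in> S" "f \<longlonglongrightarrow> x" by (auto simp: closure_sequential)
  then have "(\<lambda>n. c *\<^sub>R f n) \<longlonglongrightarrow> c *\<^sub>R x" "\<And>n. c *\<^sub>R f n \<in> S"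
    using assms by (auto intro: tendsto_intros subspace_scale)
  then show "c *\<^sub>R x \<in> closure S"
    unfolding closure_sequential by (intro exI[of _ "\<lambda>n. c *\<^sub>R f n"]) auto
qed

text \<open>
  Zorn's lemma yields a maximal orthonormal set. If its closed span were not the whole space, a
  normalized component orthogonal to that span would enlarge it.
\<close>

lemma some_basis_orthonormal_basis:
  "orthonormal_basis (some_basis :: 'a::{real_inner,complete_space} set)"
proof -
  have "\<exists>M\<in>Collect orthonormal. \<forall>X\<in>Collect orthonormal. M \<subseteq> X \<longrightarrow> X = (M :: 'a set)"
  proof (rule subset_Zorn')
    fix C :: "'a set set"
    assume C: "subset.chain (Collect orthonormal) C"
    then have tot: "X \<subseteq> Y \<or> Y \<subseteq> X" if "X \<in> C" "Y \<in> C" for X Y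
      using that by (auto simp: subset_chain_def)
    have on: "orthonormal X" if "X \<in> C" for X using C that by (auto simp: subset_chain_def)
    have "orthogonal x y" if "x \<in> \<Union>C" "y \<in> \<Union>C" "x \<noteq> y" for x y
    proof -
      obtain X Y where XY: "X \<in> C" "Y \<in> C" "x \<in> X" "y \<in> Y" using \<open>x \<in> \<Union>C\<close> \<open>y \<in> \<Union>C\<close> by blast
      with tot[OF XY(1,2)] obtain Z where "Z \<in> C" "x \<in> Z" "y \<in> Z" by blast
      with on[of Z] \<open>x \<noteq> y\<close> show ?thesis by (auto simp: orthonormal_def pairwise_def)
    qed
    moreover have "norm e = 1" if "e \<in> \<Union>C" for e using on that by (auto simp: orthonormal_def)
    ultimately show "\<Union>C \<in> Collect orthonormal" by (auto simp: orthonormal_def pairwise_def)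
  qed
  then obtain B :: "'a set" where B: "orthonormal B" and max: "\<And>X. orthonormal X \<Longrightarrow> B \<subseteq> X \<Longrightarrow> X = B"
    by auto
  have W: "subspace (closure (span B))" "closed (closure (span B))"
    by (simp_all add: subspace_closure)
  have "closure (span B) = UNIV"
  proof (rule ccontr)
    assume "closure (span B) \<noteq> UNIV"
    then obtain x where x: "x \<notin> closure (span B)" by blast
    obtain y where y: "y \<in> closure (span B)" "x - y \<in> (closure (span B))\<^sup>\<bottom>"
      using orthogonal_decomposition[OF W] by blast
    with x have nz: "x - y \<noteq> 0" by auto
    define u where "u = (1 / norm (x - y)) *\<^sub>R (x - y)"
    have u1: "norm u = 1" using nz by (simp add: u_def)
    have uperp: "u \<bullet> w = 0" if "w \<in> closure (span B)" for w
      using y(2) that by (simp add: u_def orthogonal_comp_iff)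
    have sub: "B \<subseteq> closure (span B)" using span_superset closure_subset by blast
    have "orthonormal (insert u B)"
      using B u1 uperp sub by (auto simp: orthonormal_def pairwise_def orthogonal_def inner_commute)
    then have "insert u B = B" by (rule max) blast
    then have "u \<bullet> u = 0" using uperp sub by blast
    then show False using u1 by auto
  qed
  with B have "orthonormal_basis B" by (simp add: orthonormal_basis_def orthonormal_def)
  then show ?thesis unfolding some_basis_def by (rule someI)
qed

lemma orthonormal_some_basis: "orthonormal (some_basis :: 'a::{real_inner,complete_space} set)"
  using some_basis_orthonormal_basis[where 'a='a] by (simp add: orthonormal_basis_def orthonormal_def)

lemma orthonormal_sum_inner:
  assumes "orthonormal F" "finite F" "f \<in> F"
  shows "(\<Sum>e\<in>F. c e *\<^sub>R e) \<bullet> f = c f"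
proof -
  have "(\<Sum>e\<in>F. c e *\<^sub>R e) \<bullet> f = (\<Sum>e\<in>F. if e = f then c e else 0)"
    unfolding inner_sum_left by (rule sum.cong) (use assms in \<open>auto simp: orthonormal_inner[OF assms(1)]\<close>)
  then show ?thesis using assms by simp
qed

lemma norm_orthonormal_remainder:
  assumes "orthonormal F" "finite F"
  shows "(norm (x - (\<Sum>e\<in>F. (x \<bullet> e) *\<^sub>R e)))\<^sup>2 = (norm x)\<^sup>2 - (\<Sum>e\<in>F. (x \<bullet> e)\<^sup>2)"
proof -
  let ?p = "\<Sum>e\<in>F. (x \<bullet> e) *\<^sub>R e"
  have xp: "x \<bullet> ?p = (\<Sum>e\<in>F. (x \<bullet> e)\<^sup>2)" by (simp add: inner_sum_right power2_eq_square)
  have "?p \<bullet> ?p = (\<Sum>e\<in>F. (x \<bullet> e) * (?p \<bullet> e))" by (simp add: inner_sum_right)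
  also have "\<dots> = (\<Sum>e\<in>F. (x \<bullet> e)\<^sup>2)"
    by (rule sum.cong) (use assms orthonormal_sum_inner[OF assms] in \<open>auto simp: power2_eq_square\<close>)
  finally have pp: "?p \<bullet> ?p = (\<Sum>e\<in>F. (x \<bullet> e)\<^sup>2)" .
  have "(norm (x - ?p))\<^sup>2 = x \<bullet> x - 2 * (x \<bullet> ?p) + ?p \<bullet> ?p"
    unfolding power2_norm_eq_inner inner_diff_left inner_diff_right inner_commute[of ?p x] by simp
  then show ?thesis by (simp only: xp pp power2_norm_eq_inner)
qed

lemma bessel_inequality:
  assumes "orthonormal F" "finite F"
  shows "(\<Sum>e\<in>F. (x \<bullet> e)\<^sup>2) \<le> (norm x)\<^sup>2"
  using norm_orthonormal_remainder[OF assms, of x] by (smt (verit) zero_le_power2)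

text \<open>
  Parseval's identity in terms of finite partial sums: among the vectors in the span of \<open>F\<close> the
  Fourier sum is the closest to \<open>x\<close>, and some finite span comes arbitrarily close to \<open>x\<close>.
\<close>

lemma parseval_approx:
  fixes x :: "'a::{real_inner,complete_space}"
  assumes "\<epsilon> > 0"
  obtains F where "finite F" "F \<subseteq> some_basis" "(norm x)\<^sup>2 - \<epsilon> < (\<Sum>e\<in>F. (x \<bullet> e)\<^sup>2)"
proof -
  have "x \<in> closure (span some_basis)"
    using some_basis_orthonormal_basis by (auto simp: orthonormal_basis_def)
  moreover have "sqrt \<epsilon> > 0" using assms by simp
  ultimately obtain y where y: "y \<in> span some_basis" "dist y x < sqrt \<epsilon>"
    using closure_approachable by blast
  then obtain F c where F: "finite F" "F \<subseteq> some_basis" and yF: "y = (\<Sum>e\<in>F. c e *\<^sub>R e)"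
    by (auto simp: span_explicit)
  have oF: "orthonormal F" using orthonormal_subset[OF orthonormal_some_basis F(2)] .
  let ?r = "x - (\<Sum>e\<in>F. (x \<bullet> e) *\<^sub>R e)"
  let ?s = "\<Sum>e\<in>F. (x \<bullet> e - c e) *\<^sub>R e"
  have "?r \<bullet> f = 0" if "f \<in> F" for f
    using orthonormal_sum_inner[OF oF F(1) that, of "\<lambda>e. x \<bullet> e"] by (simp add: inner_diff_left)
  then have rs: "?r \<bullet> ?s = 0" unfolding inner_sum_right by simp
  have "x - y = ?r + ?s" by (simp add: yF scaleR_left_diff_distrib sum_subtractf)
  then have "(norm (x - y))\<^sup>2 = (norm ?r)\<^sup>2 + (norm ?s)\<^sup>2"
    using norm_add_Pythagorean[of ?r ?s] rs by (simp only: orthogonal_def)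
  then have "(norm ?r)\<^sup>2 \<le> (norm (x - y))\<^sup>2" by simp
  also have "\<dots> < (sqrt \<epsilon>)\<^sup>2"
    using y(2) by (intro power_strict_mono) (simp_all add: dist_norm norm_minus_commute)
  finally have "(norm ?r)\<^sup>2 < \<epsilon>" using assms by simp
  then show ?thesis using norm_orthonormal_remainder[OF oF F(1), of x] that[OF F] by linarith
qed

section \<open>The Hilbert--Schmidt norm\<close>

lemma adjoint_self_inner:
  fixes a :: "'a::{real_inner,complete_space} \<Rightarrow>\<^sub>L 'a"
  shows "adjoint (blinfun_apply a) (blinfun_apply a e) \<bullet> e = (norm (blinfun_apply a e))\<^sup>2"
  using adjoint_inner[of a e "a e"] by (simp add: inner_commute power2_norm_eq_inner)

lemma hilbert_schmidt_iff:
  "hilbert_schmidt a \<longleftrightarrow> (\<lambda>e. (norm (blinfun_apply a e))\<^sup>2) summable_on some_basis"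
  by (simp add: hilbert_schmidt_def adjoint_self_inner)

lemma hs_norm_eq: "hs_norm a = sqrt (\<Sum>\<^sub>\<infinity>e\<in>some_basis. (norm (blinfun_apply a e))\<^sup>2)"
  by (simp add: hs_norm_def op_trace_def adjoint_self_inner)

lemma hs_norm_ge_0 [simp]: "0 \<le> hs_norm a"
  by (simp add: hs_norm_eq infsum_nonneg)

lemma hs_norm_sq: "(hs_norm a)\<^sup>2 = (\<Sum>\<^sub>\<infinity>e\<in>some_basis. (norm (blinfun_apply a e))\<^sup>2)"
  by (simp add: hs_norm_eq infsum_nonneg)

lemma hs_sum_le:
  assumes "hilbert_schmidt a" "finite F" "F \<subseteq> some_basis"
  shows "(\<Sum>e\<in>F. (norm (blinfun_apply a e))\<^sup>2) \<le> (hs_norm a)\<^sup>2"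
  unfolding hs_norm_sq
  by (rule finite_sum_le_infsum[OF assms(1)[unfolded hilbert_schmidt_iff] assms(2,3)]) simp

lemma hs_L2_set_le:
  assumes "hilbert_schmidt a" "finite F" "F \<subseteq> some_basis"
  shows "L2_set (\<lambda>e. norm (blinfun_apply a e)) F \<le> hs_norm a"
  unfolding L2_set_def using hs_sum_le[OF assms] by (intro real_le_lsqrt) (simp_all add: sum_nonneg)

text \<open>
  The introduction rule behind all norm estimates below. It replaces the infinite sum by Euclidean
  norms over finite sets of basis vectors, for which Minkowski's inequality is available.
\<close>

lemma hs_boundI:
  assumes "0 \<le> c"
    and "\<And>F. finite F \<Longrightarrow> F \<subseteq> some_basis \<Longrightarrow> L2_set (\<lambda>e. norm (blinfun_apply a e)) F \<le> c"
  shows "hilbert_schmidt a" "hs_norm a \<le> c"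
proof -
  have le: "(\<Sum>e\<in>F. (norm (a e))\<^sup>2) \<le> c\<^sup>2" if "finite F" "F \<subseteq> some_basis" for F
    using assms(2)[OF that] unfolding L2_set_def by (rule sqrt_le_D)
  show "hilbert_schmidt a"
    unfolding hilbert_schmidt_iff
    by (rule nonneg_bdd_above_summable_on, simp, rule bdd_aboveI[of _ "c\<^sup>2"]) (use le in auto)
  then have "(hs_norm a)\<^sup>2 \<le> c\<^sup>2"
    unfolding hs_norm_sq hilbert_schmidt_iff by (rule infsum_le_finite_sums) (use le in auto)
  then show "hs_norm a \<le> c" using assms(1) power2_le_imp_le by blast
qed

lemma hs_zero [simp]: "hilbert_schmidt 0" "hs_norm 0 = 0"
  using hs_boundI[of 0 0] hs_norm_ge_0[of 0] by (auto simp: L2_set_def intro: antisym)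

lemma hs_add:
  assumes "hilbert_schmidt a" "hilbert_schmidt b"
  shows "hilbert_schmidt (a + b)" "hs_norm (a + b) \<le> hs_norm a + hs_norm b"
proof -
  have "L2_set (\<lambda>e. norm ((a + b) e)) F \<le> hs_norm a + hs_norm b"
    if F: "finite F" "F \<subseteq> some_basis" for F
  proof -
    have "L2_set (\<lambda>e. norm ((a + b) e)) F
        \<le> L2_set (\<lambda>e. norm (a e) + norm (b e)) F"
      by (rule L2_set_mono) (simp_all add: blinfun.add_left norm_triangle_ineq)
    also have "\<dots> \<le> L2_set (\<lambda>e. norm (a e)) F + L2_set (\<lambda>e. norm (b e)) F"
      by (rule L2_set_triangle_ineq)
    finally show ?thesis using hs_L2_set_le[OF assms(1) F] hs_L2_set_le[OF assms(2) F] by linarith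
  qed
  from hs_boundI[OF _ this] show "hilbert_schmidt (a + b)" "hs_norm (a + b) \<le> hs_norm a + hs_norm b"
    by simp_all
qed

lemma hs_compose_left:
  assumes "hilbert_schmidt a"
  shows "hilbert_schmidt (b o\<^sub>L a)" "hs_norm (b o\<^sub>L a) \<le> norm b * hs_norm a"
proof -
  have "L2_set (\<lambda>e. norm ((b o\<^sub>L a) e)) F \<le> norm b * hs_norm a"
    if F: "finite F" "F \<subseteq> some_basis" for F
  proof -
    have "L2_set (\<lambda>e. norm ((b o\<^sub>L a) e)) F
        \<le> L2_set (\<lambda>e. norm b * norm (a e)) F"
      by (rule L2_set_mono) (simp_all add: norm_blinfun)
    also have "\<dots> = norm b * L2_set (\<lambda>e. norm (a e)) F"
      by (simp add: L2_set_right_distrib)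
    finally show ?thesis using mult_left_mono[OF hs_L2_set_le[OF assms(1) F], of "norm b"] by simp
  qed
  from hs_boundI[OF _ this]
  show "hilbert_schmidt (b o\<^sub>L a)" "hs_norm (b o\<^sub>L a) \<le> norm b * hs_norm a" by simp_all
qed

lemma hs_scaleR:
  assumes "hilbert_schmidt a"
  shows "hilbert_schmidt (c *\<^sub>R a)" "hs_norm (c *\<^sub>R a) = \<bar>c\<bar> * hs_norm a"
proof -
  have eq: "(norm ((c *\<^sub>R a) e))\<^sup>2 = c\<^sup>2 * (norm (a e))\<^sup>2" for e
    by (simp add: blinfun.scaleR_left power_mult_distrib)
  show "hilbert_schmidt (c *\<^sub>R a)"
    unfolding hilbert_schmidt_iff eq using assms by (simp add: hilbert_schmidt_iff summable_on_cmult_right)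
  show "hs_norm (c *\<^sub>R a) = \<bar>c\<bar> * hs_norm a"
    unfolding hs_norm_eq eq by (simp add: infsum_cmult_right' real_sqrt_mult)
qed

lemma hs_minus:
  assumes "hilbert_schmidt a"
  shows "hilbert_schmidt (- a)" "hs_norm (- a) = hs_norm a"
  using hs_scaleR[OF assms, of "-1"] by simp_all

lemma hs_diff:
  assumes "hilbert_schmidt a" "hilbert_schmidt b"
  shows "hilbert_schmidt (a - b)" "hs_norm (a - b) \<le> hs_norm a + hs_norm b"
  using hs_add[OF assms(1) hs_minus(1)[OF assms(2)]] hs_minus(2)[OF assms(2)] by simp_all

lemma hs_norm_commute:
  assumes "hilbert_schmidt (a - b)"
  shows "hilbert_schmidt (b - a)" "hs_norm (b - a) = hs_norm (a - b)"
  using hs_minus[OF assms] by simp_all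

lemma hs_norm_diff_le:
  assumes "hilbert_schmidt a" "hilbert_schmidt b"
  shows "\<bar>hs_norm a - hs_norm b\<bar> \<le> hs_norm (a - b)"
proof -
  note ab = hs_diff(1)[OF assms]
  show ?thesis using hs_add(2)[OF ab assms(2)] hs_add(2)[OF hs_norm_commute(1)[OF ab] assms(1)]
      hs_norm_commute(2)[OF ab] by simp
qed

text \<open>
  The double sum of \<open>\<langle>a e, f\<rangle>\<^sup>2\<close> is evaluated in the two possible orders: Parseval's identity in \<open>e\<close>
  gives the left-hand side, Bessel's inequality in \<open>f\<close> the right-hand side. As \<open>F\<close> is an arbitrary
  orthonormal set, this bounds both the Hilbert--Schmidt norm of the adjoint and, for a singleton
  \<open>F\<close>, the operator norm.
\<close>

lemma hs_adj_orthonormal_sum: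
  assumes a: "hilbert_schmidt a" and F: "orthonormal F" "finite F"
  shows "(\<Sum>f\<in>F. (norm (adj a f))\<^sup>2) \<le> (hs_norm a)\<^sup>2"
proof (rule field_le_epsilon)
  fix \<epsilon> :: real assume \<epsilon>: "\<epsilon> > 0"
  \<comment> \<open>the Parseval error admitted for each element of \<open>F\<close>, so that all of them together contribute at most \<open>\<epsilon>\<close>\<close>
  define \<delta> where "\<delta> = \<epsilon> / (1 + real (card F))"
  have \<delta>: "\<delta> > 0" using \<epsilon> by (simp add: \<delta>_def add_pos_nonneg)
  have "real (card F) * \<delta> \<le> (1 + real (card F)) * \<delta>" using \<delta> by simp
  also have "\<dots> = \<epsilon>" by (simp add: \<delta>_def)
  finally have card\<delta>: "real (card F) * \<delta> \<le> \<epsilon>" .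
  have "\<forall>f. \<exists>G. finite G \<and> G \<subseteq> some_basis \<and>
      (norm (adj a f))\<^sup>2 - \<delta> < (\<Sum>e\<in>G. (adj a f \<bullet> e)\<^sup>2)"
    using parseval_approx[OF \<delta>] by metis
  then obtain G where G: "\<And>f. finite (G f)" "\<And>f. G f \<subseteq> some_basis"
      "\<And>f. (norm (adj a f))\<^sup>2 - \<delta> < (\<Sum>e\<in>G f. (adj a f \<bullet> e)\<^sup>2)"
    by metis
  define H where "H = (\<Union>f\<in>F. G f)"
  have H: "finite H" "H \<subseteq> some_basis" using G F by (auto simp: H_def)
  have "(\<Sum>f\<in>F. (norm (adj a f))\<^sup>2) \<le> (\<Sum>f\<in>F. (\<Sum>e\<in>H. (adj a f \<bullet> e)\<^sup>2) + \<delta>)"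
  proof (rule sum_mono)
    fix f assume "f \<in> F"
    then have "(\<Sum>e\<in>G f. (adj a f \<bullet> e)\<^sup>2) \<le> (\<Sum>e\<in>H. (adj a f \<bullet> e)\<^sup>2)"
      by (intro sum_mono2) (use H in \<open>auto simp: H_def\<close>)
    with G(3)[of f] show "(norm (adj a f))\<^sup>2 \<le> (\<Sum>e\<in>H. (adj a f \<bullet> e)\<^sup>2) + \<delta>"
      by linarith
  qed
  also have "\<dots> = (\<Sum>e\<in>H. \<Sum>f\<in>F. (a e \<bullet> f)\<^sup>2) + real (card F) * \<delta>"
  proof -
    have "adj a f \<bullet> e = a e \<bullet> f" for e f by (metis adj_inner inner_commute)
    then show ?thesis by (simp add: sum.distrib sum.swap[of _ F H])
  qed
  also have "\<dots> \<le> (\<Sum>e\<in>H. (norm (a e))\<^sup>2) + \<epsilon>"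
    by (intro add_mono sum_mono bessel_inequality F card\<delta>)
  also have "\<dots> \<le> (hs_norm a)\<^sup>2 + \<epsilon>" using hs_sum_le[OF a H] by simp
  finally show "(\<Sum>f\<in>F. (norm (adj a f))\<^sup>2) \<le> (hs_norm a)\<^sup>2 + \<epsilon>" .
qed

lemma hs_adj:
  assumes "hilbert_schmidt a"
  shows "hilbert_schmidt (adj a)" "hs_norm (adj a) \<le> hs_norm a"
proof -
  have "L2_set (\<lambda>e. norm (adj a e)) F \<le> hs_norm a" if "finite F" "F \<subseteq> some_basis" for F
    unfolding L2_set_def
    using hs_adj_orthonormal_sum[OF assms orthonormal_subset[OF orthonormal_some_basis that(2)] that(1)]
    by (intro real_le_lsqrt) (simp_all add: sum_nonneg)
  from hs_boundI[OF _ this] show "hilbert_schmidt (adj a)" "hs_norm (adj a) \<le> hs_norm a" by simp_all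
qed

text \<open>
  The preceding inequality for the adjoint and the orthonormal set consisting of the normalized
  vector \<open>x\<close>.
\<close>

lemma norm_le_hs_norm:
  assumes "hilbert_schmidt a"
  shows "norm a \<le> hs_norm a"
proof (rule norm_blinfun_bound)
  fix x
  show "norm (a x) \<le> hs_norm a * norm x"
  proof (cases "x = 0")
    case False
    define u where "u = (1 / norm x) *\<^sub>R x"
    have "orthonormal {u}" using False by (simp add: orthonormal_def u_def)
    from hs_adj_orthonormal_sum[OF hs_adj(1)[OF assms] this]
    have "(norm (a u))\<^sup>2 \<le> (hs_norm (adj a))\<^sup>2" by (simp add: adj_adj)
    then have "norm (a u) \<le> hs_norm (adj a)"
      by (rule power2_le_imp_le) simp
    also have "\<dots> \<le> hs_norm a" by (rule hs_adj(2)[OF assms])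
    finally show ?thesis using False by (simp add: u_def blinfun.scaleR_right field_simps)
  qed simp
qed simp

text \<open>
  The adjoint turns right composition into left composition.
\<close>

lemma hs_compose_right:
  assumes "hilbert_schmidt a"
  shows "hilbert_schmidt (a o\<^sub>L b)" "hs_norm (a o\<^sub>L b) \<le> hs_norm a * norm b"
proof -
  have eq: "a o\<^sub>L b = adj (adj b o\<^sub>L adj a)" by (simp add: adj_compose adj_adj)
  note h = hs_adj[OF assms]
  note h2 = hs_compose_left[OF h(1), of "adj b"]
  show "hilbert_schmidt (a o\<^sub>L b)" unfolding eq by (rule hs_adj(1)[OF h2(1)])
  have "hs_norm (a o\<^sub>L b) \<le> norm (adj b) * hs_norm (adj a)"
    unfolding eq using hs_adj(2)[OF h2(1)] h2(2) by linarith
  also have "\<dots> \<le> norm b * hs_norm a"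
    by (intro mult_mono norm_adj_le h(2)) simp_all
  finally show "hs_norm (a o\<^sub>L b) \<le> hs_norm a * norm b" by (simp add: mult.commute)
qed

text \<open>
  Lower semicontinuity under pointwise convergence, since every finite partial sum converges.
\<close>

lemma hs_closed:
  assumes ev: "\<forall>\<^sub>F n in F. hilbert_schmidt (a n) \<and> hs_norm (a n) \<le> c"
    and lim: "\<And>x. ((\<lambda>n. blinfun_apply (a n) x) \<longlongrightarrow> blinfun_apply l x) F"
    and F: "F \<noteq> bot" and c: "0 \<le> c"
  shows "hilbert_schmidt l" "hs_norm l \<le> c"
proof -
  have "L2_set (\<lambda>e. norm (l e)) G \<le> c" if G: "finite G" "G \<subseteq> some_basis" for G
  proof (rule tendsto_upperbound[OF _ _ F])
    show "((\<lambda>n. L2_set (\<lambda>e. norm ((a n) e)) G) \<longlongrightarrow> L2_set (\<lambda>e. norm (l e)) G) F"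
      unfolding L2_set_def by (intro tendsto_intros lim)
    show "\<forall>\<^sub>F n in F. L2_set (\<lambda>e. norm ((a n) e)) G \<le> c"
      using ev by eventually_elim (use hs_L2_set_le[OF _ G] order_trans in blast)
  qed
  from hs_boundI[OF c this] show "hilbert_schmidt l" "hs_norm l \<le> c" by simp_all
qed

section \<open>Convergence in the Hilbert--Schmidt norm\<close>

text \<open>
  The Hilbert--Schmidt operators do not form a type of their own, so membership in the class is
  part of the notion of convergence. For the approximating operators it is asked near the limit
  point only, in accordance with the notion of derivative with respect to this norm.
\<close>

definition hs_tendsto ::
    "('b \<Rightarrow> 'a::{real_inner,complete_space} \<Rightarrow>\<^sub>L 'a) \<Rightarrow> ('a \<Rightarrow>\<^sub>L 'a) \<Rightarrow> 'b filter \<Rightarrow> bool" where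
  "hs_tendsto f l F \<longleftrightarrow> hilbert_schmidt l \<and> (\<forall>\<^sub>F s in F. hilbert_schmidt (f s)) \<and>
     ((\<lambda>s. hs_norm (f s - l)) \<longlongrightarrow> 0) F"

lemma hs_tendstoI:
  assumes "hilbert_schmidt l" "\<forall>\<^sub>F s in F. hilbert_schmidt (f s) \<and> hs_norm (f s - l) \<le> g s"
    and "(g \<longlongrightarrow> 0) F"
  shows "hs_tendsto f l F"
  unfolding hs_tendsto_def
proof (intro conjI)
  show "((\<lambda>s. hs_norm (f s - l)) \<longlongrightarrow> 0) F"
    by (rule tendsto_sandwich[OF _ _ tendsto_const assms(3)])
       (use assms(2) in \<open>auto elim: eventually_mono\<close>)
qed (use assms in \<open>auto elim: eventually_mono\<close>)

lemma hs_tendsto_imp_tendsto: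
  assumes "hs_tendsto f l F"
  shows "(f \<longlongrightarrow> l) F"
proof (rule LIM_zero_cancel, rule tendsto_norm_zero_cancel, rule tendsto_sandwich[OF _ _ tendsto_const])
  show "((\<lambda>s. hs_norm (f s - l)) \<longlongrightarrow> 0) F" using assms by (simp add: hs_tendsto_def)
  have "\<forall>\<^sub>F s in F. hilbert_schmidt (f s)" using assms by (simp add: hs_tendsto_def)
  then show "\<forall>\<^sub>F s in F. norm (f s - l) \<le> hs_norm (f s - l)"
    by eventually_elim (use assms in \<open>auto simp: hs_tendsto_def intro!: norm_le_hs_norm hs_diff\<close>)
qed simp

lemma hs_tendsto_norm:
  assumes "hs_tendsto f l F"
  shows "((\<lambda>s. hs_norm (f s)) \<longlongrightarrow> hs_norm l) F"
proof (rule LIM_zero_cancel, rule tendsto_rabs_zero_cancel, rule tendsto_sandwich[OF _ _ tendsto_const])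
  show "((\<lambda>s. hs_norm (f s - l)) \<longlongrightarrow> 0) F" using assms by (simp add: hs_tendsto_def)
  have "\<forall>\<^sub>F s in F. hilbert_schmidt (f s)" using assms by (simp add: hs_tendsto_def)
  then show "\<forall>\<^sub>F s in F. \<bar>hs_norm (f s) - hs_norm l\<bar> \<le> hs_norm (f s - l)"
    by eventually_elim (use assms in \<open>auto simp: hs_tendsto_def intro!: hs_norm_diff_le\<close>)
qed simp

lemma hs_tendsto_add:
  assumes "hs_tendsto f l F" "hs_tendsto g m F"
  shows "hs_tendsto (\<lambda>s. f s + g s) (l + m) F"
proof (rule hs_tendstoI)
  show "hilbert_schmidt (l + m)" using assms by (simp add: hs_tendsto_def hs_add)
  show "((\<lambda>s. hs_norm (f s - l) + hs_norm (g s - m)) \<longlongrightarrow> 0) F"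
    by (rule tendsto_add_zero) (use assms in \<open>simp_all add: hs_tendsto_def\<close>)
  have "\<forall>\<^sub>F s in F. hilbert_schmidt (f s)" "\<forall>\<^sub>F s in F. hilbert_schmidt (g s)"
    using assms by (simp_all add: hs_tendsto_def)
  then show "\<forall>\<^sub>F s in F. hilbert_schmidt (f s + g s) \<and>
      hs_norm (f s + g s - (l + m)) \<le> hs_norm (f s - l) + hs_norm (g s - m)"
  proof eventually_elim
    case (elim s)
    have eq: "f s + g s - (l + m) = (f s - l) + (g s - m)" by simp
    have lm: "hilbert_schmidt l" "hilbert_schmidt m" using assms by (simp_all add: hs_tendsto_def)
    have "hs_norm (f s + g s - (l + m)) \<le> hs_norm (f s - l) + hs_norm (g s - m)"
      unfolding eq by (intro hs_add hs_diff elim lm)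
    then show ?case using elim by (simp add: hs_add)
  qed
qed

text \<open>
  In \<open>g f - b l = g (f - l) + (g - b) l\<close> the ideal property bounds both terms. The statement is made
  for factors such as projections, which converge in the operator norm and are in general not of
  Hilbert--Schmidt class.
\<close>

lemma hs_tendsto_compose_left:
  assumes g: "(g \<longlongrightarrow> b) F" and f: "hs_tendsto f l F"
  shows "hs_tendsto (\<lambda>s. g s o\<^sub>L f s) (b o\<^sub>L l) F"
proof (rule hs_tendstoI)
  have l: "hilbert_schmidt l" using f by (simp add: hs_tendsto_def)
  show "hilbert_schmidt (b o\<^sub>L l)" using l by (rule hs_compose_left)
  have "((\<lambda>s. norm (g s) * hs_norm (f s - l) + norm (g s - b) * hs_norm l) \<longlongrightarrow> norm b * 0 + norm (b - b) * hs_norm l) F"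
    using f by (intro tendsto_intros g) (simp add: hs_tendsto_def)
  then show "((\<lambda>s. norm (g s) * hs_norm (f s - l) + norm (g s - b) * hs_norm l) \<longlongrightarrow> 0) F" by simp
  have "\<forall>\<^sub>F s in F. hilbert_schmidt (f s)" using f by (simp add: hs_tendsto_def)
  then show "\<forall>\<^sub>F s in F. hilbert_schmidt (g s o\<^sub>L f s) \<and>
      hs_norm ((g s o\<^sub>L f s) - (b o\<^sub>L l)) \<le> norm (g s) * hs_norm (f s - l) + norm (g s - b) * hs_norm l"
  proof eventually_elim
    case (elim s)
    note d = hs_diff(1)[OF elim l]
    have eq: "(g s o\<^sub>L f s) - (b o\<^sub>L l) = (g s o\<^sub>L (f s - l)) + ((g s - b) o\<^sub>L l)"
      by (rule blinfun_eqI) (simp add: blinfun.bilinear_simps)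
    have "hs_norm ((g s o\<^sub>L f s) - (b o\<^sub>L l)) \<le> norm (g s) * hs_norm (f s - l) + norm (g s - b) * hs_norm l"
      unfolding eq
      using hs_add(2)[OF hs_compose_left(1)[OF d] hs_compose_left(1)[OF l], of "g s" "g s - b"]
        hs_compose_left(2)[OF d, of "g s"] hs_compose_left(2)[OF l, of "g s - b"] by linarith
    then show ?case using hs_compose_left(1)[OF elim] by simp
  qed
qed

lemma hs_tendsto_compose_right:
  assumes f: "hs_tendsto f l F" and g: "(g \<longlongrightarrow> b) F"
  shows "hs_tendsto (\<lambda>s. f s o\<^sub>L g s) (l o\<^sub>L b) F"
proof (rule hs_tendstoI)
  have l: "hilbert_schmidt l" using f by (simp add: hs_tendsto_def)
  show "hilbert_schmidt (l o\<^sub>L b)" using l by (rule hs_compose_right)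
  have "((\<lambda>s. hs_norm (f s - l) * norm (g s) + hs_norm l * norm (g s - b)) \<longlongrightarrow> 0 * norm b + hs_norm l * norm (b - b)) F"
    using f by (intro tendsto_intros g) (simp add: hs_tendsto_def)
  then show "((\<lambda>s. hs_norm (f s - l) * norm (g s) + hs_norm l * norm (g s - b)) \<longlongrightarrow> 0) F" by simp
  have "\<forall>\<^sub>F s in F. hilbert_schmidt (f s)" using f by (simp add: hs_tendsto_def)
  then show "\<forall>\<^sub>F s in F. hilbert_schmidt (f s o\<^sub>L g s) \<and>
      hs_norm ((f s o\<^sub>L g s) - (l o\<^sub>L b)) \<le> hs_norm (f s - l) * norm (g s) + hs_norm l * norm (g s - b)"
  proof eventually_elim
    case (elim s)
    note d = hs_diff(1)[OF elim l]
    have eq: "(f s o\<^sub>L g s) - (l o\<^sub>L b) = ((f s - l) o\<^sub>L g s) + (l o\<^sub>L (g s - b))"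
      by (rule blinfun_eqI) (simp add: blinfun.bilinear_simps)
    have "hs_norm ((f s o\<^sub>L g s) - (l o\<^sub>L b)) \<le> hs_norm (f s - l) * norm (g s) + hs_norm l * norm (g s - b)"
      unfolding eq
      using hs_add(2)[OF hs_compose_right(1)[OF d] hs_compose_right(1)[OF l], of "g s" "g s - b"]
        hs_compose_right(2)[OF d, of "g s"] hs_compose_right(2)[OF l, of "g s - b"] by linarith
    then show ?case using hs_compose_right(1)[OF elim] by simp
  qed
qed

lemma hs_tendsto_cong:
  assumes "hs_tendsto f l F" "\<forall>\<^sub>F s in F. f s = g s"
  shows "hs_tendsto g l F"
  unfolding hs_tendsto_def
proof (intro conjI)
  show "hilbert_schmidt l" using assms by (simp add: hs_tendsto_def)
  have "\<forall>\<^sub>F s in F. hilbert_schmidt (f s)" using assms by (simp add: hs_tendsto_def)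
  with assms(2) show "\<forall>\<^sub>F s in F. hilbert_schmidt (g s)" by eventually_elim simp
  show "((\<lambda>s. hs_norm (g s - l)) \<longlongrightarrow> 0) F"
    by (rule Lim_transform_eventually[of "\<lambda>s. hs_norm (f s - l)"])
       (use assms in \<open>auto simp: hs_tendsto_def elim: eventually_mono\<close>)
qed

lemma hs_tendsto_const: "hilbert_schmidt l \<Longrightarrow> hs_tendsto (\<lambda>s. l) l F"
  by (simp add: hs_tendsto_def)

section \<open>Compactness of Hilbert--Schmidt operators\<close>

lemma compact_bounded_coefficients:
  fixes v :: "'b \<Rightarrow> 'a::real_normed_vector"
  assumes "finite F"
  shows "compact {(\<Sum>e\<in>F. c e *\<^sub>R v e) | c. \<forall>e. \<bar>c e\<bar> \<le> (1::real)}"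
  using assms
proof (induction F)
  case empty
  have "{(\<Sum>e\<in>{}. c e *\<^sub>R v e) | c. \<forall>e. \<bar>c e\<bar> \<le> (1::real)} = {0}"
    by (auto intro: exI[of _ "\<lambda>_. 0"])
  then show ?case by simp
next
  case (insert a F)
  let ?S = "(\<lambda>t::real. t *\<^sub>R v a) ` {-1..1}"
  let ?T = "{(\<Sum>e\<in>F. c e *\<^sub>R v e) | c. \<forall>e. \<bar>c e\<bar> \<le> (1::real)}"
  have "compact ?S" by (intro compact_continuous_image continuous_intros) simp
  then have "compact {x + y | x y. x \<in> ?S \<and> y \<in> ?T}" using insert.IH by (rule compact_sums)
  moreover have "{(\<Sum>e\<in>insert a F. c e *\<^sub>R v e) | c. \<forall>e. \<bar>c e\<bar> \<le> (1::real)} = {x + y | x y. x \<in> ?S \<and> y \<in> ?T}"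
  proof (intro equalityI subsetI)
    fix z assume "z \<in> {(\<Sum>e\<in>insert a F. c e *\<^sub>R v e) | c. \<forall>e. \<bar>c e\<bar> \<le> (1::real)}"
    then obtain c :: "'b \<Rightarrow> real" where c: "\<forall>e. \<bar>c e\<bar> \<le> 1" "z = (\<Sum>e\<in>insert a F. c e *\<^sub>R v e)" by blast
    then have "z = c a *\<^sub>R v a + (\<Sum>e\<in>F. c e *\<^sub>R v e)" using insert by simp
    moreover have "c a \<in> {-1..1}" using c(1) by (auto simp: abs_le_iff dest: spec[of _ a])
    ultimately show "z \<in> {x + y | x y. x \<in> ?S \<and> y \<in> ?T}" using c(1) by blast
  next
    fix z assume "z \<in> {x + y | x y. x \<in> ?S \<and> y \<in> ?T}"
    then obtain t c where t: "t \<in> {-1..1}" and c: "\<forall>e. \<bar>c e\<bar> \<le> (1::real)"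
      and z: "z = t *\<^sub>R v a + (\<Sum>e\<in>F. c e *\<^sub>R v e)" by auto
    let ?c = "c(a := t)"
    have "(\<Sum>e\<in>F. ?c e *\<^sub>R v e) = (\<Sum>e\<in>F. c e *\<^sub>R v e)"
      using insert by (intro sum.cong) auto
    then have "z = (\<Sum>e\<in>insert a F. ?c e *\<^sub>R v e)" using insert z by simp
    moreover have "\<forall>e. \<bar>?c e\<bar> \<le> 1" using t c by auto
    ultimately show "z \<in> {(\<Sum>e\<in>insert a F. c e *\<^sub>R v e) | c. \<forall>e. \<bar>c e\<bar> \<le> (1::real)}" by blast
  qed
  ultimately show ?case by simp
qed

text \<open>
  The finite sum omits the contribution of the basis vectors outside \<open>F\<close>; the Hilbert--Schmidt norm
  of what is omitted is a tail of a convergent series, and it dominates the operator norm.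
\<close>

lemma hs_finite_approx:
  assumes D: "hilbert_schmidt D" and \<epsilon>: "\<epsilon> > 0"
  obtains F where "finite F" "F \<subseteq> some_basis"
    "\<And>x. norm (blinfun_apply D x - (\<Sum>e\<in>F. (x \<bullet> e) *\<^sub>R blinfun_apply D e)) \<le> \<epsilon> * norm x"
proof -
  have "\<exists>F. finite F \<and> F \<subseteq> some_basis \<and> (hs_norm D)\<^sup>2 - \<epsilon>\<^sup>2 \<le> (\<Sum>e\<in>F. (norm (D e))\<^sup>2)"
  proof (rule ccontr)
    assume "\<nexists>F. finite F \<and> F \<subseteq> some_basis \<and> (hs_norm D)\<^sup>2 - \<epsilon>\<^sup>2 \<le> (\<Sum>e\<in>F. (norm (D e))\<^sup>2)"
    then have "(\<Sum>e\<in>F. (norm (D e))\<^sup>2) \<le> (hs_norm D)\<^sup>2 - \<epsilon>\<^sup>2" if "finite F" "F \<subseteq> some_basis" for F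
      using that by (meson linorder_le_cases)
    then have "(hs_norm D)\<^sup>2 \<le> (hs_norm D)\<^sup>2 - \<epsilon>\<^sup>2"
      unfolding hs_norm_sq[of D] using D
      by (intro infsum_le_finite_sums) (auto simp: hilbert_schmidt_iff)
    then show False using \<epsilon> by simp
  qed
  then obtain F where F: "finite F" "F \<subseteq> some_basis"
    and FD: "(hs_norm D)\<^sup>2 - \<epsilon>\<^sup>2 \<le> (\<Sum>e\<in>F. (norm (D e))\<^sup>2)" by blast
  have oF: "orthonormal F" using orthonormal_subset[OF orthonormal_some_basis F(2)] .
  define R where "R = Blinfun (\<lambda>x. D x - (\<Sum>e\<in>F. (x \<bullet> e) *\<^sub>R D e))"
  have "bounded_linear (\<lambda>x. D x - (\<Sum>e\<in>F. (x \<bullet> e) *\<^sub>R D e))"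
    by (intro bounded_linear_sub bounded_linear_sum blinfun.bounded_linear_right
        bounded_linear_scaleR_const bounded_linear_inner_left)
  then have R: "R x = D x - (\<Sum>e\<in>F. (x \<bullet> e) *\<^sub>R D e)" for x
    by (simp add: R_def bounded_linear_Blinfun_apply)
  have R_basis: "R f = (if f \<in> F then 0 else D f)" if f: "f \<in> some_basis" for f
  proof -
    have "(\<Sum>e\<in>F. (f \<bullet> e) *\<^sub>R D e) = (\<Sum>e\<in>F. if e = f then D e else 0)"
      by (rule sum.cong) (use F f in \<open>auto simp: orthonormal_inner[OF orthonormal_some_basis] subset_iff\<close>)
    then show ?thesis using F by (simp add: R)
  qed
  have le: "L2_set (\<lambda>e. norm (R e)) G \<le> \<epsilon>" if G: "finite G" "G \<subseteq> some_basis" for G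
  proof -
    have "(\<Sum>e\<in>G. (norm (R e))\<^sup>2) = (\<Sum>e\<in>G. if e \<in> F then 0 else (norm (D e))\<^sup>2)"
      by (rule sum.cong) (use G R_basis in auto)
    also have "\<dots> = (\<Sum>e\<in>G - F. (norm (D e))\<^sup>2)"
      using G by (intro sum.mono_neutral_cong_right) auto
    also have "\<dots> = (\<Sum>e\<in>F \<union> (G - F). (norm (D e))\<^sup>2) - (\<Sum>e\<in>F. (norm (D e))\<^sup>2)"
      using F G by (subst sum.union_disjoint) auto
    also have "\<dots> \<le> \<epsilon>\<^sup>2" using hs_sum_le[OF D, of "F \<union> (G - F)"] F G FD by auto
    finally show ?thesis unfolding L2_set_def using \<epsilon> by (intro real_le_lsqrt) (simp_all add: sum_nonneg)
  qed
  have "0 \<le> \<epsilon>" using \<epsilon> by simp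
  note Rhs = hs_boundI[OF this le]
  have "norm (R x) \<le> \<epsilon> * norm x" for x
  proof -
    have "norm (R x) \<le> norm R * norm x" by (rule norm_blinfun)
    also have "\<dots> \<le> \<epsilon> * norm x" using norm_le_hs_norm[OF Rhs(1)] Rhs(2) by (intro mult_right_mono) auto
    finally show ?thesis .
  qed
  then show ?thesis using that[OF F] by (simp add: R)
qed

text \<open>
  Finite-rank approximation places the image of the unit ball within \<open>\<epsilon>\<close> of a compact set of linear
  combinations with bounded coefficients, so this image is totally bounded.
\<close>

lemma hs_compact_operator:
  fixes D :: "'a::{real_inner,complete_space} \<Rightarrow>\<^sub>L 'a"
  assumes D: "hilbert_schmidt D"
  shows "compact (closure (blinfun_apply D ` cball 0 1))"
  unfolding compact_eq_totally_bounded
proof (intro conjI allI impI)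
  show "complete (closure (blinfun_apply D ` cball 0 1))" by (simp add: complete_eq_closed)
  fix \<epsilon> :: real assume "\<epsilon> > 0"
  then have \<epsilon>: "\<epsilon> / 4 > 0" by simp
  obtain F where F: "finite F" "F \<subseteq> some_basis"
    and approx: "\<And>x. norm (D x - (\<Sum>e\<in>F. (x \<bullet> e) *\<^sub>R D e)) \<le> \<epsilon>/4 * norm x"
    using hs_finite_approx[OF D \<epsilon>] by blast
  let ?C = "{(\<Sum>e\<in>F. c e *\<^sub>R D e) | c. \<forall>e. \<bar>c e\<bar> \<le> (1::real)}"
  obtain K where K: "finite K" "?C \<subseteq> (\<Union>x\<in>K. ball x (\<epsilon>/4))"
    using compact_bounded_coefficients[OF F(1), of "blinfun_apply D"] \<epsilon> unfolding compact_eq_totally_bounded by meson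
  have "closure (blinfun_apply D ` cball 0 1) \<subseteq> (\<Union>x\<in>K. ball x \<epsilon>)"
  proof
    fix z assume "z \<in> closure (blinfun_apply D ` cball 0 1)"
    then obtain x where "x \<in> cball 0 1" and x2: "dist (D x) z < \<epsilon>/4"
      using \<epsilon> unfolding closure_approachable by blast
    then have x: "norm x \<le> 1" "dist (D x) z < \<epsilon>/4" by simp_all
    define c where "c e = (if e \<in> F then x \<bullet> e else 0)" for e
    have "\<bar>c e\<bar> \<le> 1" for e
    proof (cases "e \<in> F")
      case True
      then have "norm e = 1" using F orthonormal_some_basis by (auto simp: orthonormal_def)
      then show ?thesis using Cauchy_Schwarz_ineq2[of x e] x True by (simp add: c_def)
    qed (simp add: c_def)
    moreover have "(\<Sum>e\<in>F. (x \<bullet> e) *\<^sub>R D e) = (\<Sum>e\<in>F. c e *\<^sub>R D e)"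
      by (rule sum.cong) (auto simp: c_def)
    ultimately have "(\<Sum>e\<in>F. (x \<bullet> e) *\<^sub>R D e) \<in> ?C" by auto
    then obtain k where k: "k \<in> K" "dist k (\<Sum>e\<in>F. (x \<bullet> e) *\<^sub>R D e) < \<epsilon>/4"
      using K(2) by (auto simp: subset_iff)
    have "\<epsilon>/4 * norm x \<le> \<epsilon>/4 * 1" using x \<epsilon> by (intro mult_left_mono) auto
    then have "dist (\<Sum>e\<in>F. (x \<bullet> e) *\<^sub>R D e) (D x) \<le> \<epsilon>/4"
      using approx[of x] by (simp add: dist_norm norm_minus_commute)
    then have "dist k (D x) < \<epsilon>/2"
      using k(2) dist_triangle[of k "D x" "\<Sum>e\<in>F. (x \<bullet> e) *\<^sub>R D e"] by linarith
    then have "dist k z < \<epsilon>" using x(2) dist_triangle[of k z "D x"] \<epsilon> by linarith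
    then show "z \<in> (\<Union>x\<in>K. ball x \<epsilon>)" using k(1) by auto
  qed
  then show "\<exists>k. finite k \<and> closure (blinfun_apply D ` cball 0 1) \<subseteq> (\<Union>x\<in>k. ball x \<epsilon>)"
    using K(1) by blast
qed

lemma hs_convergent_subseq:
  assumes "hilbert_schmidt D" "\<And>n. norm (x n) \<le> 1"
  obtains y r where "strict_mono (r::nat\<Rightarrow>nat)" "(\<lambda>n. blinfun_apply D (x (r n))) \<longlonglongrightarrow> y"
proof -
  have "\<forall>n. D (x n) \<in> closure (blinfun_apply D ` cball 0 1)"
  proof
    fix n
    have "x n \<in> cball 0 1" using assms(2) by simp
    then show "D (x n) \<in> closure (blinfun_apply D ` cball 0 1)"
      by (rule closure_subset[THEN subsetD, OF imageI])
  qed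
  with hs_compact_operator[OF assms(1)] show ?thesis
    using that unfolding compact_def o_def by meson
qed

section \<open>Graphs over a closed subspace\<close>

text \<open>
  The operator \<open>T : L \<rightarrow> L\<^sup>\<bottom>\<close> with graph \<open>W\<close>, extended by zero to the orthogonal complement of \<open>L\<close>.
\<close>

definition is_graph_op :: "'a::{real_inner,complete_space} set \<Rightarrow> 'a set \<Rightarrow> ('a \<Rightarrow>\<^sub>L 'a) \<Rightarrow> bool" where
  "is_graph_op L W T \<longleftrightarrow> (\<forall>v\<in>L. T v \<in> L\<^sup>\<bottom>) \<and> (\<forall>u\<in>L\<^sup>\<bottom>. T u = 0) \<and> W = {v + T v | v. v \<in> L}"

lemma is_graph_op_apply_proj:
  assumes L: "subspace L" "closed L" and T: "is_graph_op L W T"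
  shows "T x = T (ortho_proj L x)"
proof -
  have "T (x - ortho_proj L x) = 0" using T ortho_proj_diff[OF L] by (auto simp: is_graph_op_def)
  then show ?thesis by (simp add: blinfun.diff_right)
qed

lemma is_graph_op_range:
  assumes L: "subspace L" "closed L" and T: "is_graph_op L W T"
  shows "T x \<in> L\<^sup>\<bottom>"
  using is_graph_op_apply_proj[OF assms, of x] T ortho_proj_in[OF L] by (auto simp: is_graph_op_def)

lemma is_graph_op_sq:
  assumes L: "subspace L" "closed L" and T: "is_graph_op L W T"
  shows "T (T x) = 0"
  using is_graph_op_range[OF assms] T by (auto simp: is_graph_op_def)

lemma subspace_Int_orthogonal_comp: "x \<in> L \<Longrightarrow> x \<in> L\<^sup>\<bottom> \<Longrightarrow> x = 0"
  by (auto simp: orthogonal_comp_iff)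

text \<open>
  If \<open>v + T' v = w + T w\<close> then \<open>v - w = T w - T' v\<close> lies both in \<open>L\<close> and in its complement.
\<close>

lemma graph_op_eq:
  assumes L: "subspace L" "closed L" and T: "is_graph_op L W T"
  shows "graph_op L W = T"
  unfolding graph_op_def
proof (rule the_equality)
  show "(\<forall>v\<in>L. T v \<in> L\<^sup>\<bottom>) \<and> (\<forall>u\<in>L\<^sup>\<bottom>. T u = 0) \<and> W = {v + T v | v. v \<in> L}"
    using T by (simp add: is_graph_op_def)
  fix T' assume T': "(\<forall>v\<in>L. blinfun_apply T' v \<in> L\<^sup>\<bottom>) \<and> (\<forall>u\<in>L\<^sup>\<bottom>. T' u = 0) \<and> W = {v + T' v | v. v \<in> L}"
  then have T'g: "is_graph_op L W T'" by (simp add: is_graph_op_def)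
  show "T' = T"
  proof (rule blinfun_eqI)
    fix x
    let ?v = "ortho_proj L x"
    have v: "?v \<in> L" by (rule ortho_proj_in[OF L])
    then have "?v + T' ?v \<in> W" using T' by blast
    then obtain w where w: "w \<in> L" "?v + T' ?v = w + T w" using T by (auto simp: is_graph_op_def)
    then have eq: "?v - w = T w - T' ?v" by (simp add: algebra_simps)
    have "?v - w \<in> L" using v w L by (simp add: subspace_diff)
    moreover have "T w - T' ?v \<in> L\<^sup>\<bottom>"
      using is_graph_op_range[OF L T] is_graph_op_range[OF L T'g] subspace_orthogonal_comp subspace_diff by blast
    ultimately have "?v - w = 0" using subspace_Int_orthogonal_comp eq by metis
    with eq have "T' ?v = T ?v" by simp
    then show "T' x = T x"
      using is_graph_op_apply_proj[OF L T, of x] is_graph_op_apply_proj[OF L T'g, of x] by simp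
  qed
qed

text \<open>
  The vector \<open>w + X w\<close> of \<open>W\<close> has the component \<open>w + P X w\<close> in \<open>L\<close> and \<open>(1 - P) X w\<close> in the complement,
  so the graph operator \<open>G\<close> maps the former to the latter. As an equation for \<open>G\<close> this shows that \<open>G\<close>
  inherits the Hilbert--Schmidt property from \<open>X\<close> and that \<open>G\<close> equals \<open>(1 - P) X P\<close> to first order
  in \<open>X\<close>.
\<close>

lemma is_graph_op_offdiagonal:
  assumes L: "subspace L" "closed L" and G: "is_graph_op L W G"
    and X: "\<And>w. w \<in> L \<Longrightarrow> w + blinfun_apply X w \<in> W"
  defines "P \<equiv> ortho_proj L"
  shows "G = ((id_blinfun - P) o\<^sub>L X o\<^sub>L P) - (G o\<^sub>L (P o\<^sub>L X o\<^sub>L P))"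
proof (rule blinfun_eqI)
  fix x
  let ?w = "P x"
  have w: "?w \<in> L" using ortho_proj_in[OF L] by (simp add: P_def)
  obtain v where v: "v \<in> L" "?w + X ?w = v + G v" using X[OF w] G by (auto simp: is_graph_op_def)
  have "P (v + G v) = v"
    unfolding P_def blinfun.add_right using v(1) ortho_proj_id[OF L] ortho_proj_zero[OF L] is_graph_op_range[OF L G] by simp
  then have v2: "v = ?w + P (X ?w)" using v(2) ortho_proj_id[OF L w] by (metis P_def blinfun.add_right)
  then have "G v = X ?w - P (X ?w)" using v(2) by (simp add: algebra_simps)
  then have "G ?w = X ?w - P (X ?w) - G (P (X ?w))" unfolding v2 by (simp add: blinfun.add_right algebra_simps)
  then show "G x = (((id_blinfun - P) o\<^sub>L X o\<^sub>L P) - (G o\<^sub>L (P o\<^sub>L X o\<^sub>L P))) x"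
    using is_graph_op_apply_proj[OF L G, of x] by (simp add: blinfun.diff_left P_def)
qed

lemma norm_compose_le:
  assumes "norm a \<le> c" "norm b \<le> d" "0 \<le> c"
  shows "norm (a o\<^sub>L b) \<le> c * d"
proof -
  have "norm (a o\<^sub>L b) \<le> norm a * norm b" by (rule norm_blinfun_compose)
  also have "\<dots> \<le> c * d" using assms by (intro mult_mono) auto
  finally show ?thesis .
qed

lemma hs_sandwich:
  fixes a b X :: "'a::{real_inner,complete_space} \<Rightarrow>\<^sub>L 'a"
  assumes X: "hilbert_schmidt X" and "norm a \<le> 1" "norm b \<le> 1"
  shows "hilbert_schmidt (a o\<^sub>L X o\<^sub>L b)" "hs_norm (a o\<^sub>L X o\<^sub>L b) \<le> hs_norm X"
proof -
  note aX = hs_compose_left[OF X, of a]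
  show "hilbert_schmidt (a o\<^sub>L X o\<^sub>L b)" by (rule hs_compose_right(1)[OF aX(1)])
  have "hs_norm (a o\<^sub>L X o\<^sub>L b) \<le> hs_norm (a o\<^sub>L X) * norm b" by (rule hs_compose_right(2)[OF aX(1)])
  also have "\<dots> \<le> (norm a * hs_norm X) * norm b" by (intro mult_right_mono aX) simp
  also have "\<dots> \<le> (1 * hs_norm X) * 1" using assms by (intro mult_mono) auto
  finally show "hs_norm (a o\<^sub>L X o\<^sub>L b) \<le> hs_norm X" by simp
qed

text \<open>
  For \<open>\<parallel>X\<parallel> \<le> 1/2\<close> the preceding equation bounds \<open>\<parallel>G\<parallel>\<close> by \<open>2 \<parallel>X\<parallel>\<close>, and the term \<open>G (P X P)\<close> is then of
  second order. The linear bound controls lengths, the quadratic one differentiates charts.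
\<close>

lemma graph_op_hs_estimate:
  assumes L: "subspace L" "closed L" and G: "is_graph_op L W G"
    and X: "\<And>w. w \<in> L \<Longrightarrow> w + blinfun_apply X w \<in> W" and hsX: "hilbert_schmidt X"
  shows "hilbert_schmidt G"
    and "norm X \<le> 1/2 \<Longrightarrow> hs_norm G \<le> 2 * hs_norm X"
    and "norm X \<le> 1/2 \<Longrightarrow>
      hs_norm (G - ((id_blinfun - ortho_proj L) o\<^sub>L X o\<^sub>L ortho_proj L)) \<le> 2 * hs_norm X * hs_norm X"
proof -
  let ?P = "ortho_proj L"
  let ?A = "(id_blinfun - ?P) o\<^sub>L X o\<^sub>L ?P" and ?B = "?P o\<^sub>L X o\<^sub>L ?P"
  have eq: "G = ?A - (G o\<^sub>L ?B)" by (rule is_graph_op_offdiagonal[OF L G X])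
  note P = norm_ortho_proj[OF L] norm_id_minus_ortho_proj[OF L]
  note A = hs_sandwich[OF hsX P(2) P(1)] and B = hs_sandwich[OF hsX P(1) P(1)]
  note GB = hs_compose_left[OF B(1), of G]
  show "hilbert_schmidt G" by (subst eq) (intro hs_diff A GB)
  assume X2: "norm X \<le> 1/2"
  have nB: "norm ?B \<le> norm X" and nA: "norm ?A \<le> norm X"
    using norm_compose_le[OF norm_compose_le[OF P(1) order_refl[of "norm X"]] P(1)]
      norm_compose_le[OF norm_compose_le[OF P(2) order_refl[of "norm X"]] P(1)] by auto
  have "norm G \<le> norm ?A + norm (G o\<^sub>L ?B)" using norm_triangle_ineq4[of ?A "G o\<^sub>L ?B"] eq by simp
  also have "\<dots> \<le> norm X + norm G * norm X"
    using nA norm_compose_le[OF order_refl nB, of G] by simp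
  finally have "norm G \<le> norm X + norm G * norm X" .
  moreover have "norm G * norm X \<le> norm G * (1/2)" using X2 by (intro mult_left_mono) auto
  ultimately have nG: "norm G \<le> 2 * norm X" by simp
  have hGB: "hs_norm (G o\<^sub>L ?B) \<le> norm G * hs_norm X"
    using GB(2) mult_left_mono[OF B(2), of "norm G"] by simp
  have "norm G * hs_norm X \<le> 1 * hs_norm X" using nG X2 by (intro mult_right_mono) auto
  then show "hs_norm G \<le> 2 * hs_norm X"
    using hs_diff(2)[OF A(1) GB(1)] A(2) hGB eq by simp
  have "G - ?A = - (G o\<^sub>L ?B)" by (subst (1) eq) simp
  then have "hs_norm (G - ?A) = hs_norm (G o\<^sub>L ?B)" using hs_minus(2)[OF GB(1)] by simp
  also have "\<dots> \<le> norm G * hs_norm X" by (rule hGB)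
  also have "\<dots> \<le> (2 * hs_norm X) * hs_norm X"
    using nG norm_le_hs_norm[OF hsX] by (intro mult_right_mono) auto
  finally show "hs_norm (G - ?A) \<le> 2 * hs_norm X * hs_norm X" .
qed

section \<open>Lagrangian subspaces and the symplectic group\<close>

locale complex_structure =
  fixes J :: "'a::{real_inner,complete_space} \<Rightarrow>\<^sub>L 'a"
  assumes J_isometry: "norm (J x) = norm x"
    and J_square: "J o\<^sub>L J = - id_blinfun"
    and J_adjoint: "adjoint (blinfun_apply J) = (\<lambda>x. - J x)"
begin

lemma JJ [simp]: "J (J x) = - x"
  using J_square by (metis blinfun_apply_blinfun_compose blinfun_apply_id_blinfun blinfun.minus_left)

lemma J_skew: "J x \<bullet> y = - (x \<bullet> J y)"
  using adjoint_inner[of J x y] J_adjoint by simp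

lemma J_inner [simp]: "J x \<bullet> J y = x \<bullet> y"
  by (simp add: J_skew blinfun.minus_right)

lemma norm_J: "norm J \<le> 1"
  by (rule norm_blinfun_bound) (simp_all add: J_isometry)

lemma
  assumes "L \<in> Lagrangian J"
  shows Lagrangian_subspace: "subspace L" and Lagrangian_closed: "closed L"
    and Lagrangian_J: "x \<in> L \<Longrightarrow> J x \<in> L\<^sup>\<bottom>"
  using assms by (auto simp: Lagrangian_def)

lemma Lagrangian_J_comp:
  assumes "L \<in> Lagrangian J" "x \<in> L\<^sup>\<bottom>"
  shows "J x \<in> L"
proof -
  obtain y where "y \<in> L" "x = J y" using assms unfolding Lagrangian_def by blast
  then show ?thesis using Lagrangian_subspace[OF assms(1)] by (simp add: subspace_neg)
qed

text \<open>
  The Lagrangian subspaces are the closed subspaces that are isotropic for the symplectic form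
  \<open>\<langle>J x, y\<rangle>\<close> and maximal with this property.
\<close>

lemma LagrangianI:
  assumes L: "subspace L" "closed L" and iso: "\<And>x y. x \<in> L \<Longrightarrow> y \<in> L \<Longrightarrow> J x \<bullet> y = 0"
    and maximal: "\<And>x. (\<And>y. y \<in> L \<Longrightarrow> J x \<bullet> y = 0) \<Longrightarrow> x \<in> L"
  shows "L \<in> Lagrangian J"
proof -
  have "blinfun_apply J ` L = L\<^sup>\<bottom>"
  proof (intro equalityI subsetI)
    fix z assume "z \<in> blinfun_apply J ` L" then show "z \<in> L\<^sup>\<bottom>" using iso by (auto simp: orthogonal_comp_iff)
  next
    fix z assume z: "z \<in> L\<^sup>\<bottom>"
    have z2: "z = J (- J z)" by (simp add: blinfun.minus_right)
    have "- J z \<in> L"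
    proof (rule maximal)
      fix y assume "y \<in> L"
      then show "J (- J z) \<bullet> y = 0" using z by (simp add: blinfun.minus_right orthogonal_comp_iff)
    qed
    then show "z \<in> blinfun_apply J ` L" using z2 by (metis imageI)
  qed
  with L show ?thesis by (simp add: Lagrangian_def)
qed

lemma Lagrangian_maximal:
  assumes L: "L \<in> Lagrangian J" and x: "\<And>y. y \<in> L \<Longrightarrow> J x \<bullet> y = 0"
  shows "x \<in> L"
proof -
  have "J x \<in> L\<^sup>\<bottom>" using x by (simp add: orthogonal_comp_iff)
  then have "J (J x) \<in> L" by (rule Lagrangian_J_comp[OF L])
  then show ?thesis using Lagrangian_subspace[OF L] subspace_neg by fastforce
qed

lemma Lagrangian_isotropic: "L \<in> Lagrangian J \<Longrightarrow> x \<in> L \<Longrightarrow> y \<in> L \<Longrightarrow> J x \<bullet> y = 0"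
  using Lagrangian_J by (simp add: orthogonal_comp_iff)

text \<open>
  \<open>J\<close> exchanges \<open>L\<close> and its orthogonal complement, hence conjugates \<open>P\<close> to \<open>1 - P\<close>.
\<close>

lemma ortho_proj_J:
  assumes L: "L \<in> Lagrangian J"
  shows "ortho_proj L (J x) = J x - J (ortho_proj L x)"
proof -
  note Ls = Lagrangian_subspace[OF L] Lagrangian_closed[OF L]
  have "J (x - ortho_proj L x) \<in> L" using Lagrangian_J_comp[OF L ortho_proj_diff[OF Ls]] .
  moreover have "J (ortho_proj L x) \<in> L\<^sup>\<bottom>" using Lagrangian_J[OF L ortho_proj_in[OF Ls]] .
  ultimately have "ortho_proj L (J (x - ortho_proj L x) + J (ortho_proj L x)) = J (x - ortho_proj L x)"
    unfolding blinfun.add_right[of "ortho_proj L"] by (simp add: ortho_proj_id[OF Ls] ortho_proj_zero[OF Ls])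
  then show ?thesis by (simp add: blinfun.diff_right)
qed

text \<open>
  The defining equation says that \<open>g\<close> preserves the symplectic form \<open>\<langle>J x, y\<rangle>\<close>.
\<close>

lemma Sp_iff:
  "g \<in> Sp J \<longleftrightarrow> (\<exists>h. g o\<^sub>L h = id_blinfun \<and> h o\<^sub>L g = id_blinfun) \<and> (\<forall>x y. J (g x) \<bullet> g y = J x \<bullet> y)"
proof -
  have "adjoint (blinfun_apply g) \<circ> blinfun_apply J \<circ> blinfun_apply g = blinfun_apply J \<longleftrightarrow>
      (\<forall>x y. J (g x) \<bullet> g y = J x \<bullet> y)"
  proof
    assume *: "adjoint (blinfun_apply g) \<circ> blinfun_apply J \<circ> blinfun_apply g = blinfun_apply J"
    show "\<forall>x y. J (g x) \<bullet> g y = J x \<bullet> y"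
    proof (intro allI)
      fix x y
      have "J (g x) \<bullet> g y = g y \<bullet> J (g x)" by (rule inner_commute)
      also have "\<dots> = y \<bullet> adjoint (blinfun_apply g) (J (g x))" by (rule adjoint_inner)
      also have "\<dots> = J x \<bullet> y" using fun_cong[OF *, of x] by (simp add: inner_commute)
      finally show "J (g x) \<bullet> g y = J x \<bullet> y" .
    qed
  next
    assume *: "\<forall>x y. J (g x) \<bullet> g y = J x \<bullet> y"
    show "adjoint (blinfun_apply g) \<circ> blinfun_apply J \<circ> blinfun_apply g = blinfun_apply J"
    proof
      fix x
      have "y \<bullet> (adjoint (blinfun_apply g) (J (g x)) - J x) = 0" for y
        using * adjoint_inner[of g y "J (g x)"] by (simp add: inner_diff_right inner_commute)
      from this[of "adjoint (blinfun_apply g) (J (g x)) - J x"]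
      show "(adjoint (blinfun_apply g) \<circ> blinfun_apply J \<circ> blinfun_apply g) x = J x" by simp
    qed
  qed
  then show ?thesis by (simp add: Sp_def)
qed

lemma Sp2_compose:
  assumes "g \<in> Sp2 J" "h \<in> Sp2 J"
  shows "g o\<^sub>L h \<in> Sp2 J"
proof -
  obtain g' h' where g': "g o\<^sub>L g' = id_blinfun" "g' o\<^sub>L g = id_blinfun"
    and h': "h o\<^sub>L h' = id_blinfun" "h' o\<^sub>L h = id_blinfun"
    using assms by (auto simp: Sp2_def Sp_iff)
  have ap: "g (g' x) = x" "g' (g x) = x" "h (h' x) = x" "h' (h x) = x" for x
    using g' h' by (metis blinfun_apply_blinfun_compose blinfun_apply_id_blinfun)+
  have "(g o\<^sub>L h) o\<^sub>L (h' o\<^sub>L g') = id_blinfun" "(h' o\<^sub>L g') o\<^sub>L (g o\<^sub>L h) = id_blinfun"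
    by (auto intro!: blinfun_eqI simp: ap)
  then have Sp: "g o\<^sub>L h \<in> Sp J" using assms by (auto simp: Sp2_def Sp_iff)
  have "(g o\<^sub>L h) - id_blinfun = (g o\<^sub>L (h - id_blinfun)) + (g - id_blinfun)"
    by (rule blinfun_eqI) (simp add: blinfun.diff_left blinfun.diff_right blinfun.add_left)
  then have "hilbert_schmidt ((g o\<^sub>L h) - id_blinfun)"
    using assms by (simp only: Sp2_def mem_Collect_eq hs_add(1) hs_compose_left(1))
  with Sp show ?thesis by (simp add: Sp2_def)
qed

lemma Sp2_id: "id_blinfun \<in> Sp2 J"
  by (auto simp: Sp2_def Sp_iff intro!: exI[of _ id_blinfun] blinfun_eqI)

lemma Sp2_orbit_image:
  assumes "L \<in> Sp2_orbit J L0" "g \<in> Sp2 J"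
  shows "blinfun_apply g ` L \<in> Sp2_orbit J L0"
proof -
  obtain h where h: "h \<in> Sp2 J" "L = blinfun_apply h ` L0" using assms(1) by (auto simp: Sp2_orbit_def)
  have "blinfun_apply g ` L = blinfun_apply (g o\<^sub>L h) ` L0" by (simp add: h(2) image_image)
  then show ?thesis using Sp2_compose[OF assms(2) h(1)] unfolding Sp2_orbit_def by blast
qed

text \<open>
  For the second claim let \<open>P\<close> be the orthogonal projection onto \<open>L\<close> and \<open>R\<close> the one onto \<open>g(L)\<close>. The
  oblique projection \<open>Q = g P g\<^sup>-\<^sup>1\<close> has the same range as \<open>R\<close>, so that \<open>R Q = Q\<close> and \<open>Q R = R\<close>, and it
  differs from \<open>P\<close> by a Hilbert--Schmidt operator. Modulo such operators \<open>R P = P\<close> and \<open>P R = R\<close>; the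
  adjoint of the latter is \<open>R P = R\<close>, whence \<open>R = P\<close>.
\<close>

lemma Sp2_image_Lagrangian:
  assumes g: "g \<in> Sp2 J" and L: "L \<in> Lagrangian J"
  shows "blinfun_apply g ` L \<in> Lagrangian J"
    and "hilbert_schmidt (ortho_proj (blinfun_apply g ` L) - ortho_proj L)"
proof -
  obtain h where h: "g o\<^sub>L h = id_blinfun" "h o\<^sub>L g = id_blinfun" using g by (auto simp: Sp2_def Sp_iff)
  have ap: "g (h x) = x" "h (g x) = x" for x
    using h by (metis blinfun_apply_blinfun_compose blinfun_apply_id_blinfun)+
  have J: "J (g x) \<bullet> g y = J x \<bullet> y" for x y using g by (auto simp: Sp2_def Sp_iff)
  note Ls = Lagrangian_subspace[OF L] Lagrangian_closed[OF L]
  let ?W = "blinfun_apply g ` L"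
  have "?W = blinfun_apply h -` L" using ap by (auto simp: image_iff) metis
  moreover have "closed (blinfun_apply h -` L)"
    by (intro closed_vimage Ls linear_continuous_on blinfun.bounded_linear_right)
  ultimately have cl: "closed ?W" by simp
  have sub: "subspace ?W"
    by (rule linear_subspace_image[OF bounded_linear.linear[OF blinfun.bounded_linear_right] Ls(1)])
  show Wlag: "?W \<in> Lagrangian J"
  proof (rule LagrangianI[OF sub cl])
    show "J x \<bullet> y = 0" if "x \<in> ?W" "y \<in> ?W" for x y
      using that Lagrangian_isotropic[OF L] by (auto simp: J)
    fix x assume x: "\<And>y. y \<in> ?W \<Longrightarrow> J x \<bullet> y = 0"
    have "h x \<in> L"
    proof (rule Lagrangian_maximal[OF L])
      fix y assume "y \<in> L"
      then show "J (h x) \<bullet> y = 0" using x[of "g y"] J[of "h x" y] by (simp add: ap)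
    qed
    then show "x \<in> ?W" using ap(1) by (metis imageI)
  qed
  let ?P = "ortho_proj L" and ?R = "ortho_proj ?W" and ?Q = "g o\<^sub>L ortho_proj L o\<^sub>L h"
  have hg: "hilbert_schmidt (g - id_blinfun)" using g by (simp add: Sp2_def)
  have "h - id_blinfun = - (h o\<^sub>L (g - id_blinfun))"
    by (rule blinfun_eqI) (simp add: blinfun.bilinear_simps ap)
  then have hh: "hilbert_schmidt (h - id_blinfun)" by (simp only: hs_minus(1) hs_compose_left(1) hg)
  have "?Q - ?P = ((g - id_blinfun) o\<^sub>L (?P o\<^sub>L h)) + (?P o\<^sub>L (h - id_blinfun))"
    by (rule blinfun_eqI) (simp add: blinfun.bilinear_simps)
  then have QP: "hilbert_schmidt (?Q - ?P)" by (simp only: hs_add(1) hs_compose_left(1) hs_compose_right(1) hg hh)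
  have RQ: "?R (?Q x) = ?Q x" for x by (rule ortho_proj_id[OF sub cl]) (simp add: ortho_proj_in[OF Ls])
  have QR: "?Q (?R x) = ?R x" for x
  proof -
    obtain l where "l \<in> L" "?R x = g l" using ortho_proj_in[OF sub cl, of x] by blast
    then show ?thesis by (simp add: ap ortho_proj_id[OF Ls])
  qed
  have PQ: "hilbert_schmidt (?P - ?Q)" using hs_norm_commute QP by blast
  have "(?R o\<^sub>L ?P) - ?P = (?R o\<^sub>L (?P - ?Q)) + (?Q - ?P)"
    by (rule blinfun_eqI) (use RQ in \<open>simp add: blinfun.bilinear_simps\<close>)
  then have 1: "hilbert_schmidt ((?R o\<^sub>L ?P) - ?P)" by (simp only: hs_add(1) hs_compose_left(1) PQ QP)
  have "(?P o\<^sub>L ?R) - ?R = (?P - ?Q) o\<^sub>L ?R"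
    by (rule blinfun_eqI) (use QR in \<open>simp add: blinfun.bilinear_simps\<close>)
  then have "hilbert_schmidt ((?P o\<^sub>L ?R) - ?R)" by (simp only: hs_compose_right(1) PQ)
  from hs_adj(1)[OF this] have 2: "hilbert_schmidt (adj ((?P o\<^sub>L ?R) - ?R))" .
  have "adj ((?P o\<^sub>L ?R) - ?R) = (?R o\<^sub>L ?P) - ?R"
    by (rule adj_unique) (simp add: blinfun.bilinear_simps inner_diff_left inner_diff_right
        ortho_proj_sym[OF Ls] ortho_proj_sym[OF sub cl])
  with 2 have "hilbert_schmidt ((?R o\<^sub>L ?P) - ?R)" by simp
  from hs_diff(1)[OF 1 this] show "hilbert_schmidt (?R - ?P)" by simp
qed

text \<open>
  With respect to \<open>L \<oplus> L\<^sup>\<bottom>\<close> the operator \<open>1 + T\<close> is unipotent and block triangular, and symmetry of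
  \<open>J T\<close> on \<open>L\<close> is the condition for it to be symplectic.
\<close>

definition shear :: "'a set \<Rightarrow> ('a \<Rightarrow>\<^sub>L 'a) \<Rightarrow> bool" where
  "shear L T \<longleftrightarrow> (\<forall>v\<in>L. T v \<in> L\<^sup>\<bottom>) \<and> (\<forall>u\<in>L\<^sup>\<bottom>. T u = 0) \<and>
     (\<forall>v\<in>L. \<forall>w\<in>L. J (T v) \<bullet> w = v \<bullet> J (T w))"

text \<open>
  Isotropy of the graph, tested on \<open>v + T v\<close> and \<open>w + T w\<close>, is the symmetry of \<open>J T\<close>: the terms without
  \<open>T\<close> and those quadratic in \<open>T\<close> vanish because \<open>L\<close> is Lagrangian.
\<close>

lemma is_graph_op_shear:
  assumes L: "L \<in> Lagrangian J" and W: "W \<in> Lagrangian J" and T: "is_graph_op L W T"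
  shows "shear L T"
  unfolding shear_def
proof (intro conjI ballI)
  show "T v \<in> L\<^sup>\<bottom>" if "v \<in> L" for v using T that by (simp add: is_graph_op_def)
  show "T v = 0" if "v \<in> L\<^sup>\<bottom>" for v using T that by (simp add: is_graph_op_def)
  fix v w assume v: "v \<in> L" and w: "w \<in> L"
  then have "v + T v \<in> W" "w + T w \<in> W" using T by (auto simp: is_graph_op_def)
  then have "J (v + T v) \<bullet> (w + T w) = 0" by (rule Lagrangian_isotropic[OF W])
  moreover have "J v \<bullet> w = 0" using Lagrangian_isotropic[OF L v w] .
  moreover have "J (T v) \<in> L" "T w \<in> L\<^sup>\<bottom>"
    using T v w Lagrangian_J_comp[OF L] by (auto simp: is_graph_op_def)
  then have "J (T v) \<bullet> T w = 0" using inner_commute[of "T w"] by (simp add: orthogonal_comp_iff)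
  ultimately show "J (T v) \<bullet> w = v \<bullet> J (T w)"
    by (simp add: blinfun.add_right inner_add J_skew[of v])
qed

lemma shear_graph: "shear L T \<Longrightarrow> is_graph_op L (blinfun_apply (id_blinfun + T) ` L) T"
  by (auto simp: shear_def is_graph_op_def blinfun.add_left)

lemma is_graph_op_image: "is_graph_op L W T \<Longrightarrow> W = blinfun_apply (id_blinfun + T) ` L"
  by (auto simp: is_graph_op_def blinfun.add_left)

lemma shear_symmetric:
  assumes L: "L \<in> Lagrangian J" and T: "shear L T"
  shows "J (T x) \<bullet> y = x \<bullet> J (T y)"
proof -
  note Ls = Lagrangian_subspace[OF L] Lagrangian_closed[OF L]
  let ?P = "ortho_proj L"
  note g = shear_graph[OF T]
  have JT: "J (T z) \<in> L" for z using Lagrangian_J_comp[OF L is_graph_op_range[OF Ls g]] .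
  have red: "J (T u) \<bullet> z = J (T (?P u)) \<bullet> ?P z" for u z
    using ortho_proj_sym[OF Ls, of "J (T u)" z] ortho_proj_id[OF Ls JT]
      is_graph_op_apply_proj[OF Ls g, of u] by simp
  have "J (T x) \<bullet> y = J (T (?P x)) \<bullet> ?P y" by (rule red)
  also have "\<dots> = ?P x \<bullet> J (T (?P y))" using T ortho_proj_in[OF Ls] by (simp add: shear_def)
  also have "\<dots> = x \<bullet> J (T y)" using red[of y x] by (simp add: inner_commute)
  finally show ?thesis .
qed

text \<open>
  The square of \<open>T\<close> is zero, so \<open>1 - T\<close> is the inverse of \<open>1 + T\<close>.
\<close>

lemma shear_Sp2:
  assumes L: "L \<in> Lagrangian J" and T: "shear L T" and hs: "hilbert_schmidt T"
  shows "id_blinfun + T \<in> Sp2 J"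
proof -
  note Ls = Lagrangian_subspace[OF L] Lagrangian_closed[OF L]
  note g = shear_graph[OF T]
  have TT: "T (T x) = 0" for x by (rule is_graph_op_sq[OF Ls g])
  have "(id_blinfun + T) o\<^sub>L (id_blinfun - T) = id_blinfun" "(id_blinfun - T) o\<^sub>L (id_blinfun + T) = id_blinfun"
    by (auto intro!: blinfun_eqI simp: blinfun.bilinear_simps TT)
  moreover have "J ((id_blinfun + T) x) \<bullet> (id_blinfun + T) y = J x \<bullet> y" for x y
  proof -
    have "J (T x) \<in> L" "T y \<in> L\<^sup>\<bottom>"
      using Lagrangian_J_comp[OF L is_graph_op_range[OF Ls g]] is_graph_op_range[OF Ls g] by auto
    then have "J (T x) \<bullet> T y = 0" using inner_commute[of "T y"] by (simp add: orthogonal_comp_iff)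
    moreover have "J x \<bullet> T y = - (J (T x) \<bullet> y)" using shear_symmetric[OF L T] by (simp add: J_skew[of x])
    ultimately show ?thesis by (simp add: blinfun.bilinear_simps inner_add)
  qed
  ultimately have "id_blinfun + T \<in> Sp J" unfolding Sp_iff by blast
  then show ?thesis using hs by (simp add: Sp2_def)
qed

lemma is_graph_op_chart_dom:
  assumes L: "L \<in> Lagrangian J" and W: "W \<in> Lagrangian J" and T: "is_graph_op L W T"
  shows "W \<in> chart_dom J L"
proof -
  note Ls = Lagrangian_subspace[OF L] Lagrangian_closed[OF L]
  let ?P = "ortho_proj L"
  have "x = 0" if xW: "x \<in> W" and xL: "x \<in> L\<^sup>\<bottom>" for x
  proof -
    obtain v where v: "v \<in> L" "x = v + T v" using T xW unfolding is_graph_op_def by blast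
    have "x - T v \<in> L\<^sup>\<bottom>" using xL is_graph_op_range[OF Ls T] subspace_orthogonal_comp subspace_diff by blast
    then have "v = 0" using v subspace_Int_orthogonal_comp by auto
    then show ?thesis using v(2) by simp
  qed
  moreover have "0 \<in> W" "0 \<in> L\<^sup>\<bottom>" using Lagrangian_subspace[OF W] subspace_0 subspace_orthogonal_comp by blast+
  moreover have "\<exists>w\<in>W. \<exists>u\<in>L\<^sup>\<bottom>. x = w + u" for x
  proof (intro bexI)
    show "x = (?P x + T (?P x)) + ((x - ?P x) - T (?P x))" by simp
    show "(x - ?P x) - T (?P x) \<in> L\<^sup>\<bottom>"
      using ortho_proj_diff[OF Ls] is_graph_op_range[OF Ls T] subspace_orthogonal_comp subspace_diff by blast
    show "?P x + T (?P x) \<in> W" using T ortho_proj_in[OF Ls] by (auto simp: is_graph_op_def)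
  qed
  ultimately show ?thesis using W by (auto simp: chart_dom_def)
qed

text \<open>
  The bound makes the projection \<open>P\<close> onto \<open>S\<close> injective on \<open>L\<close>, with closed range. A vector \<open>z\<close> of \<open>S\<close>
  orthogonal to this range is orthogonal to \<open>L\<close>, so \<open>J z\<close> is a vector of \<open>L\<close> with \<open>P (J z) = 0\<close>, and
  therefore \<open>z = 0\<close>. So \<open>P\<close> maps \<open>L\<close> onto \<open>S\<close> with an inverse \<open>R\<close> of norm at most \<open>1 / c\<close>, and \<open>T\<close> is
  \<open>R - P\<close>.
\<close>

lemma graph_op_exists:
  assumes S: "S \<in> Lagrangian J" and L: "L \<in> Lagrangian J" and c: "c > 0"
    and below: "\<And>l. l \<in> L \<Longrightarrow> norm (ortho_proj S l) \<ge> c * norm l"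
  shows "\<exists>T. is_graph_op S L T"
proof -
  note Ss = Lagrangian_subspace[OF S] Lagrangian_closed[OF S]
  note Ls = Lagrangian_subspace[OF L] Lagrangian_closed[OF L]
  let ?P = "blinfun_apply (ortho_proj S)"
  have inj: "l = l'" if "l \<in> L" "l' \<in> L" "?P l = ?P l'" for l l'
  proof -
    have "l - l' \<in> L" using that Ls by (simp add: subspace_diff)
    from below[OF this] that(3) have "c * norm (l - l') \<le> 0" by (simp add: blinfun.diff_right)
    then show ?thesis using c by (simp add: mult_le_0_iff)
  qed
  have "complete (?P ` L)"
    by (rule complete_isometric_image[OF c Ls(1) blinfun.bounded_linear_right])
       (use below Ls in \<open>auto simp: complete_eq_closed\<close>)
  then have cl: "closed (?P ` L)" by (simp add: complete_eq_closed)
  have sub: "subspace (?P ` L)"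
    by (rule linear_subspace_image[OF bounded_linear.linear[OF blinfun.bounded_linear_right] Ls(1)])
  have surj: "s \<in> ?P ` L" if s: "s \<in> S" for s
  proof -
    obtain y where y: "y \<in> ?P ` L" "s - y \<in> (?P ` L)\<^sup>\<bottom>" using orthogonal_decomposition[OF sub cl] by blast
    let ?z = "s - y"
    have "y \<in> S" using y(1) ortho_proj_in[OF Ss] by auto
    then have zS: "?z \<in> S" using s Ss by (simp add: subspace_diff)
    have "?z \<bullet> l = 0" if l: "l \<in> L" for l
    proof -
      have "?z \<bullet> l = ?P ?z \<bullet> l" using ortho_proj_id[OF Ss zS] by simp
      also have "\<dots> = ?z \<bullet> ?P l" by (rule ortho_proj_sym[OF Ss])
      also have "\<dots> = 0" using y(2) l by (auto simp: orthogonal_comp_iff)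
      finally show ?thesis .
    qed
    then have "?z \<in> L\<^sup>\<bottom>" by (simp add: orthogonal_comp_iff)
    then have "J ?z \<in> L" by (rule Lagrangian_J_comp[OF L])
    moreover have "?P (J ?z) = 0" by (rule ortho_proj_zero[OF Ss Lagrangian_J[OF S zS]])
    ultimately have "c * norm (J ?z) \<le> 0" using below[of "J ?z"] by simp
    then have "norm ?z = 0" using c by (simp add: J_isometry mult_le_0_iff)
    then show ?thesis using y(1) by simp
  qed
  have "\<forall>x. \<exists>l. l \<in> L \<and> ?P l = ?P x" using surj ortho_proj_in[OF Ss] by (metis imageE)
  then obtain R where R: "\<And>x. R x \<in> L" "\<And>x. ?P (R x) = ?P x" by metis
  define t where "t x = R x - ?P x" for x
  have R_add: "R (x + y) = R x + R y" for x y
    by (rule inj) (use R Ls in \<open>auto simp: blinfun.add_right subspace_add\<close>)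
  have R_scale: "R (a *\<^sub>R x) = a *\<^sub>R R x" for a x
    by (rule inj) (use R Ls in \<open>auto simp: blinfun.scaleR_right subspace_scale\<close>)
  have "norm (t x) \<le> norm x * (1 / c + 1)" for x
  proof -
    have "c * norm (R x) \<le> norm x"
      using below[OF R(1), of x] R(2)[of x] norm_ortho_proj_le[OF Ss, of x] by simp
    then have "norm (R x) \<le> norm x / c" using c by (simp add: field_simps)
    then show ?thesis
      using norm_triangle_ineq4[of "R x" "?P x"] norm_ortho_proj_le[OF Ss, of x]
      by (simp add: t_def algebra_simps)
  qed
  then have "bounded_linear t"
    by (intro bounded_linear_intro[of t "1 / c + 1"])
       (simp_all add: t_def R_add R_scale blinfun.add_right blinfun.scaleR_right algebra_simps)
  then have T: "blinfun_apply (Blinfun t) = t" by (rule bounded_linear_Blinfun_apply)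
  have tS: "t x \<in> S\<^sup>\<bottom>" for x
    using ortho_proj_diff[OF Ss, of "R x"] R(2)[of x] by (simp add: t_def)
  have "t u = 0" if "u \<in> S\<^sup>\<bottom>" for u
  proof -
    have "?P u = 0" by (rule ortho_proj_zero[OF Ss that])
    moreover have "R u = 0" by (rule inj[OF R(1) subspace_0[OF Ls(1)]]) (simp add: R(2) \<open>?P u = 0\<close>)
    ultimately show ?thesis by (simp add: t_def)
  qed
  moreover have "L = {v + t v | v. v \<in> S}"
  proof (intro equalityI subsetI)
    fix l assume l: "l \<in> L"
    have "R (?P l) = l" by (rule inj[OF R(1) l]) (simp add: R(2) ortho_proj_idem[OF Ss])
    then have "l = ?P l + t (?P l)" by (simp add: t_def ortho_proj_idem[OF Ss])
    then show "l \<in> {v + t v | v. v \<in> S}" using ortho_proj_in[OF Ss, of l] by blast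
  next
    fix l assume "l \<in> {v + t v | v. v \<in> S}"
    then obtain v where "v \<in> S" "l = v + t v" by blast
    then show "l \<in> L" using R(1)[of v] by (simp add: t_def ortho_proj_id[OF Ss])
  qed
  ultimately have "is_graph_op S L (Blinfun t)" using tS by (simp add: is_graph_op_def T)
  then show ?thesis by blast
qed

text \<open>
  This is the place where compactness enters. If there is no such constant, there are unit vectors
  \<open>x\<^sub>n\<close> of \<open>T\<close> orthogonal to \<open>F\<close> whose projections to \<open>S\<close> tend to zero. With \<open>D\<close> the difference of the
  two projections, \<open>x\<^sub>n - D x\<^sub>n\<close> is the projection of \<open>x\<^sub>n\<close> to \<open>S\<close>. Since \<open>D\<close> is compact, a subsequence
  of \<open>D x\<^sub>n\<close> converges, hence also of \<open>x\<^sub>n\<close>, and the limit is a unit vector of \<open>F\<close> orthogonal to \<open>F\<close>.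
\<close>

lemma proj_below:
  assumes S: "S \<in> Lagrangian J" and T: "T \<in> Lagrangian J"
    and D: "hilbert_schmidt (ortho_proj T - ortho_proj S)"
  defines "F \<equiv> T \<inter> S\<^sup>\<bottom>"
  obtains c where "c > 0" "\<And>x. x \<in> T \<Longrightarrow> x \<in> F\<^sup>\<bottom> \<Longrightarrow> norm (ortho_proj S x) \<ge> c * norm x"
proof -
  note Ss = Lagrangian_subspace[OF S] Lagrangian_closed[OF S]
  note Ts = Lagrangian_subspace[OF T] Lagrangian_closed[OF T]
  let ?D = "ortho_proj T - ortho_proj S" and ?P = "ortho_proj S"
  have "\<exists>c>0. \<forall>x. x \<in> T \<longrightarrow> x \<in> F\<^sup>\<bottom> \<longrightarrow> norm (?P x) \<ge> c * norm x"
  proof (rule ccontr)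
    assume neg: "\<not> ?thesis"
    have "\<exists>x. norm x = 1 \<and> x \<in> T \<and> x \<in> F\<^sup>\<bottom> \<and> norm (?P x) \<le> 1 / real (Suc n)" for n
    proof -
      have "1 / real (Suc n) > 0" by simp
      with neg obtain x where x: "x \<in> T" "x \<in> F\<^sup>\<bottom>" "norm (?P x) < 1 / real (Suc n) * norm x"
        by (meson not_le)
      then have nz: "norm x > 0" using norm_ge_zero[of "?P x"] by (cases "x = 0") auto
      let ?y = "(1 / norm x) *\<^sub>R x"
      have "norm ?y = 1" using nz by simp
      moreover have "?y \<in> T" using x Ts by (simp add: subspace_scale)
      moreover have "?y \<in> F\<^sup>\<bottom>" using x subspace_orthogonal_comp subspace_scale by blast
      moreover have "norm (?P ?y) \<le> 1 / real (Suc n)"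
        using x(3) nz by (simp add: blinfun.scaleR_right field_simps)
      ultimately show ?thesis by blast
    qed
    then obtain x where x: "\<And>n. norm (x n) = 1" "\<And>n. x n \<in> T" "\<And>n. x n \<in> F\<^sup>\<bottom>"
      "\<And>n. norm (?P (x n)) \<le> 1 / real (Suc n)" by metis
    obtain y r where r: "strict_mono (r::nat\<Rightarrow>nat)" and y: "(\<lambda>n. ?D (x (r n))) \<longlonglongrightarrow> y"
      using hs_convergent_subseq[OF D, of x] x(1) by (metis order_refl)
    have Px: "(\<lambda>n. ?P (x n)) \<longlonglongrightarrow> 0"
      by (rule tendsto_norm_zero_cancel, rule tendsto_sandwich[OF _ _ tendsto_const LIMSEQ_Suc[OF lim_1_over_n]])
         (use x(4) in auto)
    then have Pxr: "(\<lambda>n. ?P (x (r n))) \<longlonglongrightarrow> 0" using LIMSEQ_subseq_LIMSEQ[OF _ r] by (auto simp: o_def)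
    have "x (r n) = ?D (x (r n)) + ?P (x (r n))" for n
      using ortho_proj_id[OF Ts x(2)] by (simp add: blinfun.diff_left)
    then have xy: "(\<lambda>n. x (r n)) \<longlonglongrightarrow> y" using tendsto_add[OF y Pxr] by simp
    have "y \<in> T" by (rule closed_sequentially[OF Ts(2) _ xy]) (use x in auto)
    moreover have "y \<in> F\<^sup>\<bottom>" by (rule closed_sequentially[OF closed_orthogonal_comp _ xy]) (use x in auto)
    moreover have "?P y = 0"
      using LIMSEQ_unique[OF Pxr bounded_linear.tendsto[OF blinfun.bounded_linear_right xy]] by simp
    then have "y \<in> S\<^sup>\<bottom>" using ortho_proj_orthogonal_comp[OF Ss] by simp
    ultimately have "y \<in> F" "y \<in> F\<^sup>\<bottom>" by (auto simp: F_def)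
    then have "y = 0" by (rule subspace_Int_orthogonal_comp)
    moreover have "(\<lambda>n. norm (x (r n))) \<longlonglongrightarrow> norm y" by (intro tendsto_intros xy)
    then have "norm y = 1" using LIMSEQ_unique[OF _ tendsto_const] x(1) by simp
    ultimately show False by simp
  qed
  then show ?thesis using that by blast
qed

end

section \<open>The orbit and its charts\<close>

locale Lagrangian_orbit = complex_structure +
  fixes L0 :: "'a set"
  assumes L0: "L0 \<in> Lagrangian J"
begin

abbreviation orbit :: "'a set set" where "orbit \<equiv> Sp2_orbit J L0"

lemma orbit_Lagrangian: "W \<in> orbit \<Longrightarrow> W \<in> Lagrangian J"
  using Sp2_image_Lagrangian(1)[OF _ L0] by (auto simp: Sp2_orbit_def)

lemma orbit_subspace: "W \<in> orbit \<Longrightarrow> subspace W"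
  and orbit_closed: "W \<in> orbit \<Longrightarrow> closed W"
  using orbit_Lagrangian Lagrangian_subspace Lagrangian_closed by blast+

lemma orbit_proj_diff:
  assumes "W \<in> orbit" "L \<in> orbit"
  shows "hilbert_schmidt (ortho_proj W - ortho_proj L)"
proof -
  have "hilbert_schmidt (ortho_proj V - ortho_proj L0)" if "V \<in> orbit" for V
    using that Sp2_image_Lagrangian(2)[OF _ L0] by (auto simp: Sp2_orbit_def)
  from hs_diff(1)[OF this[OF assms(1)] this[OF assms(2)]] show ?thesis by simp
qed

lemma orbit_graph:
  assumes L: "L \<in> orbit" and W: "W \<in> Lagrangian J"
    and T: "is_graph_op L W T" and hs: "hilbert_schmidt T"
  shows "W \<in> orbit"
  unfolding is_graph_op_image[OF T]
  by (rule Sp2_orbit_image[OF L shear_Sp2[OF orbit_Lagrangian[OF L] is_graph_op_shear[OF orbit_Lagrangian[OF L] W T] hs]])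

text \<open>
  The difference of the two projections is an operator \<open>X\<close> as in the graph estimates above: on \<open>L\<close>
  the operator \<open>1 + X\<close> is the projection to \<open>W\<close>.
\<close>

lemma proj_mem_add:
  assumes "W \<in> Lagrangian J" "L \<in> Lagrangian J" "w \<in> L"
  shows "w + blinfun_apply (ortho_proj W - ortho_proj L) w \<in> W"
  using ortho_proj_id[OF Lagrangian_subspace Lagrangian_closed assms(3)] ortho_proj_in[OF Lagrangian_subspace Lagrangian_closed] assms
  by (simp add: blinfun.diff_left)

lemma orbit_graph_hs:
  assumes L: "L \<in> orbit" and W: "W \<in> orbit" and T: "is_graph_op L W T"
  shows "hilbert_schmidt T"
  using graph_op_hs_estimate(1)[OF orbit_subspace[OF L] orbit_closed[OF L] T proj_mem_add orbit_proj_diff[OF W L]]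
    orbit_Lagrangian L W by blast

text \<open>
  The domain of a chart is defined by algebraic transversality. For elements of the orbit the
  graph operator is nevertheless bounded, because the subspace \<open>F\<close> of \<open>proj_below\<close> is zero.
\<close>

lemma chart_dom_graph:
  assumes L: "L \<in> orbit" and W: "W \<in> orbit" and dom: "W \<in> chart_dom J L"
  shows "\<exists>T. is_graph_op L W T"
proof -
  note LL = orbit_Lagrangian[OF L] orbit_Lagrangian[OF W]
  have F: "W \<inter> L\<^sup>\<bottom> = {0}" using dom by (simp add: chart_dom_def)
  obtain c where "c > 0" "\<And>x. x \<in> W \<Longrightarrow> x \<in> (W \<inter> L\<^sup>\<bottom>)\<^sup>\<bottom> \<Longrightarrow> norm (ortho_proj L x) \<ge> c * norm x"
    using proj_below[OF LL orbit_proj_diff[OF W L]] by blast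
  with graph_op_exists[OF LL] show ?thesis unfolding F by simp
qed

text \<open>
  On \<open>W\<close> the projection to \<open>L\<close> differs from the identity by at most \<open>\<parallel>x\<parallel> / 2\<close>.
\<close>

lemma proj_close_graph:
  assumes L: "L \<in> Lagrangian J" and W: "W \<in> Lagrangian J"
    and close: "norm (ortho_proj W - ortho_proj L) \<le> 1/2"
  shows "\<exists>T. is_graph_op L W T"
proof (rule graph_op_exists[OF L W])
  show "(1/2::real) > 0" by simp
  fix l assume l: "l \<in> W"
  have "l = ortho_proj L l + (ortho_proj W - ortho_proj L) l"
    using ortho_proj_id[OF Lagrangian_subspace[OF W] Lagrangian_closed[OF W] l] by (simp add: blinfun.diff_left)
  then have "norm l \<le> norm (ortho_proj L l) + norm ((ortho_proj W - ortho_proj L) l)"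
    by (metis norm_triangle_ineq)
  also have "norm ((ortho_proj W - ortho_proj L) l) \<le> (1/2) * norm l"
    by (rule order_trans[OF norm_blinfun mult_right_mono[OF close]]) simp
  finally show "norm (ortho_proj L l) \<ge> 1/2 * norm l" by simp
qed

text \<open>
  Connectedness of the orbit rests on this construction. The obstruction to \<open>T\<close> being a graph over
  \<open>S\<close> is \<open>F = T \<inter> S\<^sup>\<bottom>\<close>. The difference \<open>D\<close> of the projections is the identity on \<open>F\<close>, so the projection
  \<open>P\<^sub>F\<close> to \<open>F\<close> equals \<open>D P\<^sub>F\<close> and is of Hilbert--Schmidt class; thus \<open>F\<close> has finite
  dimension. Turning \<open>F\<close> halfway towards \<open>J F\<close>, which is contained in \<open>S\<close>, and leaving the rest of \<open>T\<close>
  fixed gives \<open>L = {f + J f + t | f \<in> F, t \<in> T, t \<perp> F}\<close>. It is the graph of \<open>J P\<^sub>F\<close> over \<open>T\<close>, and its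
  projection to \<open>S\<close>, which maps \<open>f + J f + t\<close> to the orthogonal sum of \<open>J f\<close> and the projection of \<open>t\<close>,
  is bounded below.
\<close>

lemma common_chart:
  assumes S: "S \<in> orbit" and T: "T \<in> orbit"
  obtains L G H where "L \<in> orbit" "is_graph_op T L G" "is_graph_op S L H"
proof -
  note lag = orbit_Lagrangian[OF S] orbit_Lagrangian[OF T]
  note Ss = orbit_subspace[OF S] orbit_closed[OF S]
  note Ts = orbit_subspace[OF T] orbit_closed[OF T]
  define F where "F = T \<inter> S\<^sup>\<bottom>"
  have Fs: "subspace F" "closed F"
    using Ts closed_orthogonal_comp by (auto simp: F_def intro!: subspace_inter subspace_orthogonal_comp)
  let ?P = "ortho_proj S" and ?D = "ortho_proj T - ortho_proj S" and ?F = "ortho_proj F"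
  have D: "hilbert_schmidt ?D" by (rule orbit_proj_diff[OF T S])
  have inF: "?F x \<in> T" "?F x \<in> S\<^sup>\<bottom>" for x using ortho_proj_in[OF Fs, of x] by (auto simp: F_def)
  have "?F = ?D o\<^sub>L ?F"
    by (rule blinfun_eqI) (simp add: blinfun.diff_left ortho_proj_id[OF Ts inF(1)] ortho_proj_zero[OF Ss inF(2)])
  then have hsF: "hilbert_schmidt ?F" using hs_compose_right(1)[OF D] by metis
  define G where "G = J o\<^sub>L ?F"
  have hsG: "hilbert_schmidt G" unfolding G_def by (rule hs_compose_left(1)[OF hsF])
  have "shear T G"
    unfolding shear_def
  proof (intro conjI ballI)
    show "G v \<in> T\<^sup>\<bottom>" for v using Lagrangian_J[OF lag(2) inF(1)] by (simp add: G_def)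
    show "G u = 0" if "u \<in> T\<^sup>\<bottom>" for u
    proof -
      have "u \<in> F\<^sup>\<bottom>" using that by (auto simp: F_def orthogonal_comp_iff)
      then show ?thesis by (simp add: G_def ortho_proj_zero[OF Fs])
    qed
    show "J (G v) \<bullet> w = v \<bullet> J (G w)" for v w by (simp add: G_def ortho_proj_sym[OF Fs])
  qed
  then have sG: "id_blinfun + G \<in> Sp2 J" and gG: "is_graph_op T (blinfun_apply (id_blinfun + G) ` T) G"
    using shear_Sp2[OF lag(2) _ hsG] shear_graph by auto
  define L where "L = blinfun_apply (id_blinfun + G) ` T"
  have L: "L \<in> orbit" unfolding L_def by (rule Sp2_orbit_image[OF T sG])
  obtain c where c: "c > 0" "\<And>x. x \<in> T \<Longrightarrow> x \<in> F\<^sup>\<bottom> \<Longrightarrow> norm (?P x) \<ge> c * norm x"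
    using proj_below[OF lag D] unfolding F_def by blast
  \<comment> \<open>chosen such that \<open>m (2 \<parallel>f\<parallel> + \<parallel>t\<parallel>) \<le> (\<parallel>f\<parallel> + c \<parallel>t\<parallel>) / 2\<close>\<close>
  define m where "m = min 1 c / 4"
  have m: "m > 0" "4 * m \<le> 1" "2 * m \<le> c" using c(1) by (auto simp: m_def)
  have "norm (?P l) \<ge> m * norm l" if lL: "l \<in> L" for l
  proof -
    obtain x where x: "x \<in> T" "l = x + G x" using lL gG unfolding L_def is_graph_op_def by blast
    define f where "f = ?F x"
    define t where "t = x - f"
    have f: "f \<in> T" "f \<in> S\<^sup>\<bottom>" unfolding f_def by (rule inF)+
    have t: "t \<in> T" "t \<in> F\<^sup>\<bottom>"
      unfolding t_def using subspace_diff[OF Ts(1) x(1) f(1)] ortho_proj_diff[OF Fs, of x] by (simp_all add: f_def)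
    have l: "l = f + J f + t" by (simp add: x(2) G_def t_def f_def)
    have JfS: "J f \<in> S" by (rule Lagrangian_J_comp[OF lag(1) f(2)])
    have Pl: "?P l = J f + ?P t"
      using ortho_proj_id[OF Ss JfS] ortho_proj_zero[OF Ss f(2)] by (simp add: l blinfun.add_right)
    have "J f \<bullet> ?P t = ?P (J f) \<bullet> t" by (rule ortho_proj_sym[OF Ss, symmetric])
    also have "\<dots> = 0" using ortho_proj_id[OF Ss JfS] Lagrangian_isotropic[OF lag(2) f(1) t(1)] by simp
    finally have orth: "J f \<bullet> ?P t = 0" .
    have "(norm (?P l))\<^sup>2 = (norm (J f))\<^sup>2 + (norm (?P t))\<^sup>2"
      unfolding Pl by (rule norm_add_Pythagorean) (simp add: orthogonal_def orth)
    then have sq: "(norm (?P l))\<^sup>2 = (norm f)\<^sup>2 + (norm (?P t))\<^sup>2" by (simp add: J_isometry)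
    have "norm f \<le> norm (?P l)" by (rule power2_le_imp_le) (use sq in auto)
    moreover have "norm (?P t) \<le> norm (?P l)" by (rule power2_le_imp_le) (use sq in auto)
    ultimately have fl: "norm f \<le> norm (?P l)" and tl: "c * norm t \<le> norm (?P l)" using c(2)[OF t] by auto
    show ?thesis
    proof -
      have "norm l \<le> norm (f + J f) + norm t" unfolding l by (rule norm_triangle_ineq)
      also have "norm (f + J f) \<le> norm f + norm (J f)" by (rule norm_triangle_ineq)
      finally have "norm l \<le> 2 * norm f + norm t" by (simp add: J_isometry)
      then have "m * norm l \<le> m * (2 * norm f + norm t)" using m(1) by (intro mult_left_mono) auto
      also have "\<dots> = ((4 * m) * norm f + (2 * m) * norm t) / 2" by (simp add: algebra_simps)
      also have "\<dots> \<le> (1 * norm f + c * norm t) / 2"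
        using m by (intro divide_right_mono add_mono mult_right_mono) auto
      also have "\<dots> \<le> norm (?P l)" using fl tl by simp
      finally show ?thesis .
    qed
  qed
  then have "\<exists>H. is_graph_op S L H"
    by (rule graph_op_exists[OF lag(1) orbit_Lagrangian[OF L] m(1)])
  then show ?thesis using that[OF L] gG by (auto simp: L_def)
qed

end

section \<open>Velocities of curves of Lagrangian subspaces\<close>

lemma hs_has_derivativeD:
  assumes "hs_has_derivative f D t S"
  shows "hs_tendsto (\<lambda>s. (1 / (s - t)) *\<^sub>R (f s - f t)) D (at t within S)"
proof -
  have "\<forall>\<^sub>F s in at t within S. hilbert_schmidt ((1 / (s - t)) *\<^sub>R (f s - f t))"
  proof -
    have "\<forall>\<^sub>F s in at t within S. hilbert_schmidt (f s)" using assms by (simp add: hs_has_derivative_def)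
    then show ?thesis
      by eventually_elim (use assms in \<open>simp add: hs_has_derivative_def hs_scaleR hs_diff\<close>)
  qed
  then show ?thesis using assms by (simp add: hs_has_derivative_def hs_tendsto_def)
qed

lemma hs_has_derivativeI:
  assumes "hs_tendsto (\<lambda>s. (1 / (s - t)) *\<^sub>R (f s - f t)) D (at t within S)"
    and "hilbert_schmidt (f t)" "\<forall>\<^sub>F s in at t within S. hilbert_schmidt (f s)"
  shows "hs_has_derivative f D t S"
  using assms by (simp add: hs_has_derivative_def hs_tendsto_def)

text \<open>
  Differentiability implies continuity. The function \<open>f\<close> itself may take values outside the
  Hilbert--Schmidt class, as the projections onto a curve of subspaces do.
\<close>

lemma hs_tendsto_of_quotient:
  assumes q: "hs_tendsto (\<lambda>s. (1 / (s - t)) *\<^sub>R (f s - f t)) D (at t within S)"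
  shows "((\<lambda>s. hs_norm (f s - f t)) \<longlongrightarrow> 0) (at t within S)"
    and "\<forall>\<^sub>F s in at t within S. hilbert_schmidt (f s - f t)"
proof -
  have ne: "\<forall>\<^sub>F s in at t within S. s \<noteq> t" by (simp add: eventually_at_filter)
  have hq: "\<forall>\<^sub>F s in at t within S. hilbert_schmidt ((1 / (s - t)) *\<^sub>R (f s - f t))"
    using q by (simp add: hs_tendsto_def)
  have eq: "f s - f t = (s - t) *\<^sub>R ((1 / (s - t)) *\<^sub>R (f s - f t))" if "s \<noteq> t" for s using that by simp
  show "\<forall>\<^sub>F s in at t within S. hilbert_schmidt (f s - f t)"
    using ne hq by eventually_elim (metis eq hs_scaleR(1))
  have "((\<lambda>s. \<bar>s - t\<bar> * hs_norm ((1 / (s - t)) *\<^sub>R (f s - f t))) \<longlongrightarrow> \<bar>t - t\<bar> * hs_norm D) (at t within S)"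
    by (intro tendsto_intros hs_tendsto_norm[OF q])
  then have lim: "((\<lambda>s. \<bar>s - t\<bar> * hs_norm ((1 / (s - t)) *\<^sub>R (f s - f t))) \<longlongrightarrow> 0) (at t within S)" by simp
  show "((\<lambda>s. hs_norm (f s - f t)) \<longlongrightarrow> 0) (at t within S)"
  proof (rule Lim_transform_eventually[OF lim])
    show "\<forall>\<^sub>F s in at t within S. \<bar>s - t\<bar> * hs_norm ((1 / (s - t)) *\<^sub>R (f s - f t)) = hs_norm (f s - f t)"
      using ne hq by eventually_elim (metis eq hs_scaleR(2))
  qed
qed

lemma hs_has_derivative_continuous:
  assumes "hs_has_derivative f D t S"
  shows "hs_tendsto f (f t) (at t within S)"
  using hs_tendsto_of_quotient(1)[OF hs_has_derivativeD[OF assms]] assms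
  by (simp add: hs_tendsto_def hs_has_derivative_def)

text \<open>
  The tangent vector of a curve of Lagrangian subspaces, expressed through the derivative \<open>V J - J V\<close>
  of the orthogonal projections. In contrast to a chart, the projection is defined for every
  closed subspace and refers to no base point.
\<close>

definition has_velocity ::
  "('a::{real_inner,complete_space} \<Rightarrow>\<^sub>L 'a) \<Rightarrow> (real \<Rightarrow> 'a set) \<Rightarrow> ('a \<Rightarrow>\<^sub>L 'a) \<Rightarrow> real \<Rightarrow> real set \<Rightarrow> bool" where
  "has_velocity J \<gamma> V t S \<longleftrightarrow> V \<in> sym_hs_on (\<gamma> t) \<and>
     hs_tendsto (\<lambda>s. (1 / (s - t)) *\<^sub>R (ortho_proj (\<gamma> s) - ortho_proj (\<gamma> t)))
       ((V o\<^sub>L J) - (J o\<^sub>L V)) (at t within S)"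

lemma sym_hs_on_compress:
  assumes W: "subspace W" "closed W" and V: "V \<in> sym_hs_on W"
  shows "ortho_proj W (V x) = V x" "V (ortho_proj W x) = V x" "V x \<bullet> y = x \<bullet> V y"
proof -
  let ?P = "ortho_proj W"
  have "V (x - ?P x) = 0" for x using V ortho_proj_diff[OF W] by (auto simp: sym_hs_on_def)
  then show VP: "V (?P x) = V x" for x by (simp add: blinfun.diff_right)
  have "V (?P x) \<in> W" for x using V ortho_proj_in[OF W] by (auto simp: sym_hs_on_def)
  then have VW: "V x \<in> W" for x by (simp add: VP)
  then show PV: "?P (V x) = V x" for x by (rule ortho_proj_id[OF W])
  have "V (?P x) \<bullet> ?P y = ?P x \<bullet> V (?P y)" using V ortho_proj_in[OF W] by (auto simp: sym_hs_on_def)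
  then show "V x \<bullet> y = x \<bullet> V y" using ortho_proj_sym[OF W] by (metis VP PV)
qed

context complex_structure
begin

text \<open>
  An operator \<open>z\<close> is in the Lie algebra if and only if \<open>J z\<close> is symmetric, and its image in the
  tangent space is the compression of \<open>J z\<close> to \<open>W\<close>. Compression does not increase the
  Hilbert--Schmidt norm, and \<open>z = - J v\<close>, for which \<open>J z = v\<close>, attains the infimum.
\<close>

lemma quotient_metric_eq:
  assumes W: "W \<in> Lagrangian J" and v: "v \<in> sym_hs_on W"
  shows "quotient_metric J W v = hs_norm v"
proof -
  note Ws = Lagrangian_subspace[OF W] Lagrangian_closed[OF W]
  note c = sym_hs_on_compress[OF Ws v]
  have hv: "hilbert_schmidt v" using v by (simp add: sym_hs_on_def)
  let ?z = "- (J o\<^sub>L v)"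
  have hz: "hilbert_schmidt (J o\<^sub>L v)" by (rule hs_compose_left(1)[OF hv])
  have "adj ?z = v o\<^sub>L J"
    by (rule adj_unique) (simp add: blinfun.minus_left J_skew c(3))
  then have adjz: "adjoint (blinfun_apply ?z) = blinfun_apply (v o\<^sub>L J)" by (metis adj_apply)
  have z: "?z \<in> sp2_algebra J"
    unfolding sp2_algebra_def mem_Collect_eq adjz using hs_minus(1)[OF hz] by (simp add: blinfun.minus_left)
  have dz: "d_orbit_map J W ?z = v"
    by (rule blinfun_eqI) (simp add: d_orbit_map_def blinfun.minus_left blinfun.minus_right c(1,2))
  have "hs_norm ?z \<le> norm J * hs_norm v" using hs_compose_left(2)[OF hv, of J] hs_minus(2)[OF hz] by simp
  also have "\<dots> \<le> 1 * hs_norm v" using norm_J by (intro mult_right_mono) auto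
  finally have z_le: "hs_norm ?z \<le> hs_norm v" by simp
  have low: "hs_norm v \<le> hs_norm z" if "z \<in> sp2_algebra J" "d_orbit_map J W z = v" for z
  proof -
    have hz: "hilbert_schmidt z" using that by (simp add: sp2_algebra_def)
    have PJ: "norm (ortho_proj W o\<^sub>L J) \<le> 1" using norm_compose_le[OF norm_ortho_proj[OF Ws] norm_J] by simp
    have "hs_norm ((ortho_proj W o\<^sub>L J) o\<^sub>L z o\<^sub>L ortho_proj W) \<le> hs_norm z"
      by (rule hs_sandwich(2)[OF hz PJ norm_ortho_proj[OF Ws]])
    moreover have "(ortho_proj W o\<^sub>L J) o\<^sub>L z o\<^sub>L ortho_proj W = v" using that(2) by (simp add: d_orbit_map_def)
    ultimately show ?thesis by simp
  qed
  have "hs_norm v = hs_norm ?z" using z_le low[OF z dz] by simp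
  then show ?thesis
    unfolding quotient_metric_def
    by (intro cInf_eq_minimum) (use z dz low in \<open>auto intro!: exI[of _ ?z]\<close>)
qed

text \<open>
  For projections \<open>p\<close> onto \<open>W\<close> and \<open>q\<close> onto \<open>V\<close> one has \<open>q - p = q (1 - p) - (1 - q) p\<close>. Conjugation by
  \<open>J\<close> exchanges every projection with its complement and so carries one term to the other. Finally
  \<open>(1 - q) p = - (1 - q) X p\<close>, because \<open>1 - q\<close> annihilates \<open>w + X w\<close>.
\<close>

lemma proj_diff_formula:
  assumes W: "W \<in> Lagrangian J" and V: "V \<in> Lagrangian J"
    and X: "\<And>w. w \<in> W \<Longrightarrow> w + blinfun_apply X w \<in> V"
  defines "B \<equiv> (id_blinfun - ortho_proj V) o\<^sub>L X o\<^sub>L ortho_proj W"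
  shows "ortho_proj V - ortho_proj W = B + (J o\<^sub>L B o\<^sub>L J)"
proof (rule blinfun_eqI)
  fix x
  note Ws = Lagrangian_subspace[OF W] Lagrangian_closed[OF W]
  note Vs = Lagrangian_subspace[OF V] Lagrangian_closed[OF V]
  let ?p = "ortho_proj W" and ?q = "ortho_proj V"
  have B: "B y = - (?p y - ?q (?p y))" for y
  proof -
    have "?q (?p y + X (?p y)) = ?p y + X (?p y)" by (intro ortho_proj_id[OF Vs] X ortho_proj_in[OF Ws])
    then have "?q (X (?p y)) = ?p y + X (?p y) - ?q (?p y)"
      by (simp add: blinfun.add_right algebra_simps)
    then show ?thesis by (simp add: B_def blinfun.diff_left)
  qed
  have "B (J x) = - (J x - J (?p x) - (J x - J (?p x) - (J (?q x) - J (?q (?p x)))))"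
    by (simp add: B ortho_proj_J[OF W] ortho_proj_J[OF V] blinfun.diff_right)
  then have "J (B (J x)) = ?q x - ?q (?p x)"
    by (simp add: blinfun.minus_right blinfun.diff_right)
  then show "(?q - ?p) x = (B + (J o\<^sub>L B o\<^sub>L J)) x"
    by (simp add: B blinfun.add_left blinfun.diff_left)
qed

lemma proj_diff_norm_le:
  assumes W: "W \<in> Lagrangian J" and V: "V \<in> Lagrangian J"
    and X: "\<And>w. w \<in> W \<Longrightarrow> w + blinfun_apply X w \<in> V"
  shows "norm (ortho_proj V - ortho_proj W) \<le> 2 * norm X"
proof -
  note Ws = Lagrangian_subspace[OF W] Lagrangian_closed[OF W]
  note Vs = Lagrangian_subspace[OF V] Lagrangian_closed[OF V]
  let ?B = "(id_blinfun - ortho_proj V) o\<^sub>L X o\<^sub>L ortho_proj W"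
  have B: "norm ?B \<le> norm X"
    using norm_compose_le[OF norm_compose_le[OF norm_id_minus_ortho_proj[OF Vs] order_refl[of "norm X"]] norm_ortho_proj[OF Ws]]
    by simp
  have JB: "norm (J o\<^sub>L ?B o\<^sub>L J) \<le> norm X"
    using norm_compose_le[OF norm_compose_le[OF norm_J B] norm_J] by simp
  have "ortho_proj V - ortho_proj W = ?B + (J o\<^sub>L ?B o\<^sub>L J)" by (rule proj_diff_formula[OF W V X])
  then have "norm (ortho_proj V - ortho_proj W) \<le> norm ?B + norm (J o\<^sub>L ?B o\<^sub>L J)"
    by (simp only: norm_triangle_ineq)
  also have "\<dots> \<le> norm X + norm X" by (intro add_mono B JB)
  finally show ?thesis by simp
qed

text \<open>
  \<open>V\<close> is recovered from the derivative of the projections as \<open>V = J (V J - J V) P\<close>, where \<open>P\<close> is the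
  projection onto \<open>\<gamma> t\<close>.
\<close>

lemma has_velocity_unique:
  assumes W: "\<gamma> t \<in> Lagrangian J"
    and V: "has_velocity J \<gamma> V t S" "has_velocity J \<gamma> V' t S" and S: "at t within S \<noteq> bot"
  shows "V = V'"
proof -
  note Ws = Lagrangian_subspace[OF W] Lagrangian_closed[OF W]
  have "(V o\<^sub>L J) - (J o\<^sub>L V) = (V' o\<^sub>L J) - (J o\<^sub>L V')"
    using tendsto_unique[OF S hs_tendsto_imp_tendsto hs_tendsto_imp_tendsto] V by (auto simp: has_velocity_def)
  then have eq: "V (J x) - J (V x) = V' (J x) - J (V' x)" for x
    by (metis blinfun.diff_left blinfun_apply_blinfun_compose)
  \<comment> \<open>since \<open>U\<close> vanishes on \<open>J\<close> applied to \<open>\<gamma> t\<close>, only the second term contributes\<close>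
  have rec: "U x = J (U (J (ortho_proj (\<gamma> t) x)) - J (U (ortho_proj (\<gamma> t) x)))" if "U \<in> sym_hs_on (\<gamma> t)" for U x
  proof -
    have "J (ortho_proj (\<gamma> t) x) \<in> (\<gamma> t)\<^sup>\<bottom>" by (rule Lagrangian_J[OF W ortho_proj_in[OF Ws]])
    then have "U (J (ortho_proj (\<gamma> t) x)) = 0" using that by (auto simp: sym_hs_on_def)
    then show ?thesis using sym_hs_on_compress(2)[OF Ws that] by (simp add: blinfun.minus_right)
  qed
  show ?thesis
    by (rule blinfun_eqI) (use V rec eq in \<open>metis has_velocity_def\<close>)
qed

lemma has_velocity_hs_norm:
  assumes W: "\<gamma> t \<in> Lagrangian J" and V: "has_velocity J \<gamma> V t S"
  shows "hilbert_schmidt V" and "hilbert_schmidt ((V o\<^sub>L J) - (J o\<^sub>L V))"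
    and "hs_norm ((V o\<^sub>L J) - (J o\<^sub>L V)) \<le> 2 * hs_norm V"
proof -
  show hV: "hilbert_schmidt V" using V by (simp add: has_velocity_def sym_hs_on_def)
  note l = hs_compose_left[OF hV, of J] and r = hs_compose_right[OF hV, of J]
  show "hilbert_schmidt ((V o\<^sub>L J) - (J o\<^sub>L V))" by (rule hs_diff(1)[OF r(1) l(1)])
  have "norm J * hs_norm V \<le> 1 * hs_norm V" using norm_J by (intro mult_right_mono) auto
  then show "hs_norm ((V o\<^sub>L J) - (J o\<^sub>L V)) \<le> 2 * hs_norm V"
    using hs_diff(2)[OF r(1) l(1)] l(2) r(2) by (simp add: mult.commute)
qed

end

context Lagrangian_orbit
begin

text \<open>
  In the chart at \<open>L\<close> let \<open>\<gamma> s\<close> be the graph of \<open>T\<^sub>s\<close>. As \<open>T\<^sub>s T\<^sub>t = 0\<close>, the operator \<open>1 + X\<close> with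
  \<open>X = T\<^sub>s - T\<^sub>t\<close> maps \<open>\<gamma> t\<close> into \<open>\<gamma> s\<close>. So the derivative of the projections follows from
  \<open>proj_diff_formula\<close>, and the velocity is the compression of the chart derivative to \<open>\<gamma> t\<close>.
\<close>

lemma chart_velocity:
  assumes L: "L \<in> orbit" and t: "t \<in> S"
    and dom: "\<And>s. s \<in> S \<Longrightarrow> \<gamma> s \<in> chart_dom J L \<inter> orbit"
    and der: "hs_has_derivative (\<lambda>s. chart J L (\<gamma> s)) D t S"
    and S: "at t within S \<noteq> bot"
  shows "has_velocity J \<gamma> (ortho_proj (\<gamma> t) o\<^sub>L D o\<^sub>L ortho_proj (\<gamma> t)) t S"
proof -
  note LL = orbit_Lagrangian[OF L]
  note Ls = orbit_subspace[OF L] orbit_closed[OF L]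
  have orb: "\<gamma> s \<in> orbit" if "s \<in> S" for s using dom[OF that] by simp
  note lag = orbit_Lagrangian[OF orb]
  note Ws = orbit_subspace[OF orb[OF t]] orbit_closed[OF orb[OF t]]
  define T where "T s = graph_op L (\<gamma> s)" for s
  have T: "is_graph_op L (\<gamma> s) (T s)" if "s \<in> S" for s
    using chart_dom_graph[OF L orb[OF that]] dom[OF that] graph_op_eq[OF Ls] by (auto simp: T_def)
  define q where "q s = (1 / (s - t)) *\<^sub>R (chart J L (\<gamma> s) - chart J L (\<gamma> t))" for s
  have q: "hs_tendsto q D (at t within S)" using hs_has_derivativeD[OF der] by (simp add: q_def[abs_def])
  have hD: "hilbert_schmidt D" using q by (simp add: hs_tendsto_def)
  define Y where "Y s = (- J) o\<^sub>L q s" for s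
  have Y: "hs_tendsto Y ((- J) o\<^sub>L D) (at t within S)"
    unfolding Y_def by (rule hs_tendsto_compose_left[OF tendsto_const q])
  define X where "X s = T s - T t" for s
  have YX: "Y s = (1 / (s - t)) *\<^sub>R X s" for s
    by (rule blinfun_eqI)
       (simp add: X_def Y_def q_def chart_def T_def[symmetric] blinfun.bilinear_simps scaleR_diff_right)
  have XY: "X s = (s - t) *\<^sub>R Y s" if "s \<noteq> t" for s
    using that by (simp add: YX)
  have inS: "\<forall>\<^sub>F s in at t within S. s \<in> S \<and> s \<noteq> t" by (simp add: eventually_at_filter)
  have Xin: "w + X s w \<in> \<gamma> s" if sS: "s \<in> S" and w: "w \<in> \<gamma> t" for s w
  proof -
    obtain v where v: "v \<in> L" "w = v + T t v" using T[OF t] w unfolding is_graph_op_def by blast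
    have TT: "T s (T t v) = 0"
      using T[OF sS] is_graph_op_range[OF Ls T[OF t]] by (simp add: is_graph_op_def)
    have "w + X s w = v + T s v"
      using v(2) TT is_graph_op_sq[OF Ls T[OF t]] by (simp add: X_def blinfun.bilinear_simps)
    then show ?thesis using T[OF sS] v(1) by (auto simp: is_graph_op_def)
  qed
  let ?p = "\<lambda>s. ortho_proj (\<gamma> s)"
  have pt: "(?p \<longlongrightarrow> ?p t) (at t within S)"
  proof (rule LIM_zero_cancel, rule tendsto_norm_zero_cancel, rule tendsto_sandwich[OF _ _ tendsto_const])
    have "((\<lambda>s. 2 * norm ((s - t) *\<^sub>R Y s)) \<longlongrightarrow> 2 * norm ((t - t) *\<^sub>R ((- J) o\<^sub>L D))) (at t within S)"
      by (intro tendsto_intros hs_tendsto_imp_tendsto[OF Y])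
    then show "((\<lambda>s. 2 * norm ((s - t) *\<^sub>R Y s)) \<longlongrightarrow> 0) (at t within S)" by simp
    show "\<forall>\<^sub>F s in at t within S. norm (?p s - ?p t) \<le> 2 * norm ((s - t) *\<^sub>R Y s)"
      using inS
    proof eventually_elim
      case (elim s)
      then have "norm (?p s - ?p t) \<le> 2 * norm (X s)" by (intro proj_diff_norm_le[OF lag[OF t] lag] Xin) auto
      then show ?case using XY[of s] elim by simp
    qed
  qed simp
  let ?B = "\<lambda>s. (id_blinfun - ?p s) o\<^sub>L Y s o\<^sub>L ?p t"
  have B: "hs_tendsto ?B ((id_blinfun - ?p t) o\<^sub>L ((- J) o\<^sub>L D) o\<^sub>L ?p t) (at t within S)"
    by (intro hs_tendsto_compose_left hs_tendsto_compose_right Y tendsto_intros pt)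
  have "hs_tendsto (\<lambda>s. ?B s + (J o\<^sub>L ?B s o\<^sub>L J))
     (((id_blinfun - ?p t) o\<^sub>L ((- J) o\<^sub>L D) o\<^sub>L ?p t) + (J o\<^sub>L ((id_blinfun - ?p t) o\<^sub>L ((- J) o\<^sub>L D) o\<^sub>L ?p t) o\<^sub>L J)) (at t within S)"
    by (intro hs_tendsto_add B hs_tendsto_compose_left hs_tendsto_compose_right tendsto_const)
  then have lim: "hs_tendsto (\<lambda>s. (1 / (s - t)) *\<^sub>R (?p s - ?p t))
     (((id_blinfun - ?p t) o\<^sub>L ((- J) o\<^sub>L D) o\<^sub>L ?p t) + (J o\<^sub>L ((id_blinfun - ?p t) o\<^sub>L ((- J) o\<^sub>L D) o\<^sub>L ?p t) o\<^sub>L J)) (at t within S)"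
  proof (rule hs_tendsto_cong)
    show "\<forall>\<^sub>F s in at t within S. ?B s + (J o\<^sub>L ?B s o\<^sub>L J) = (1 / (s - t)) *\<^sub>R (?p s - ?p t)"
      using inS
    proof eventually_elim
      case (elim s)
      have "?p s - ?p t = ((id_blinfun - ?p s) o\<^sub>L X s o\<^sub>L ?p t) + (J o\<^sub>L ((id_blinfun - ?p s) o\<^sub>L X s o\<^sub>L ?p t) o\<^sub>L J)"
        using elim by (intro proj_diff_formula[OF lag[OF t] lag] Xin) auto
      also have "\<dots> = (s - t) *\<^sub>R (?B s + (J o\<^sub>L ?B s o\<^sub>L J))"
        by (rule blinfun_eqI) (use XY[of s] elim in \<open>simp add: blinfun.bilinear_simps scaleR_add_right scaleR_diff_right\<close>)
      finally show ?case using elim by simp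
    qed
  qed
  let ?V = "?p t o\<^sub>L D o\<^sub>L ?p t"
  have "((id_blinfun - ?p t) o\<^sub>L ((- J) o\<^sub>L D) o\<^sub>L ?p t) + (J o\<^sub>L ((id_blinfun - ?p t) o\<^sub>L ((- J) o\<^sub>L D) o\<^sub>L ?p t) o\<^sub>L J)
      = (?V o\<^sub>L J) - (J o\<^sub>L ?V)"
    by (rule blinfun_eqI) (simp add: blinfun.bilinear_simps ortho_proj_J[OF lag[OF t]])
  with lim have lim': "hs_tendsto (\<lambda>s. (1 / (s - t)) *\<^sub>R (?p s - ?p t)) ((?V o\<^sub>L J) - (J o\<^sub>L ?V)) (at t within S)"
    by simp
  have Dsym: "D x \<bullet> y = x \<bullet> D y" for x y
  proof (rule tendsto_unique[OF S])
    have app: "((\<lambda>s. q s z) \<longlongrightarrow> D z) (at t within S)" for z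
      by (intro tendsto_intros hs_tendsto_imp_tendsto[OF q])
    show "((\<lambda>s. q s x \<bullet> y) \<longlongrightarrow> D x \<bullet> y) (at t within S)" by (intro tendsto_intros app)
    have lim2: "((\<lambda>s. x \<bullet> q s y) \<longlongrightarrow> x \<bullet> D y) (at t within S)" by (intro tendsto_intros app)
    show "((\<lambda>s. q s x \<bullet> y) \<longlongrightarrow> x \<bullet> D y) (at t within S)"
    proof (rule Lim_transform_eventually[OF lim2])
      show "\<forall>\<^sub>F s in at t within S. x \<bullet> q s y = q s x \<bullet> y"
        using inS
      proof eventually_elim
        case (elim s)
        have "J (T u x) \<bullet> y = x \<bullet> J (T u y)" if "u \<in> S" for u
          by (rule shear_symmetric[OF LL is_graph_op_shear[OF LL lag[OF that] T[OF that]]])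
        then show ?case using elim t
          by (simp add: q_def chart_def T_def[symmetric] blinfun.bilinear_simps inner_diff_left inner_diff_right)
      qed
    qed
  qed
  have "?V \<in> sym_hs_on (\<gamma> t)"
    unfolding sym_hs_on_def mem_Collect_eq
  proof (intro conjI ballI)
    show "hilbert_schmidt ?V" by (intro hs_compose_left(1) hs_compose_right(1) hD)
    show "?V v \<in> \<gamma> t" for v by (simp add: ortho_proj_in[OF Ws])
    show "?V u = 0" if "u \<in> (\<gamma> t)\<^sup>\<bottom>" for u by (simp add: ortho_proj_zero[OF Ws that])
    show "?V v \<bullet> w = v \<bullet> ?V w" for v w by (simp add: ortho_proj_sym[OF Ws] Dsym)
  qed
  with lim' show ?thesis by (simp add: has_velocity_def)
qed

text \<open>
  Differentiating in the chart centred at \<open>\<gamma> t\<close>: by \<open>graph_op_hs_estimate\<close> the graph operator of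
  \<open>\<gamma> s\<close> over \<open>\<gamma> t\<close> is \<open>(1 - P) \<Delta> P\<close> up to second order in \<open>\<Delta>\<close>, the difference of the projections at \<open>s\<close> and
  \<open>t\<close>. Hence it has the derivative \<open>(1 - P) (V J - J V) P = - J V\<close>, which \<open>J\<close> takes to \<open>V\<close>.
\<close>

lemma velocity_eq:
  assumes V: "has_velocity J \<gamma> V t {0..1}" and t: "0 \<le> t" "t \<le> 1" "\<gamma> t \<in> orbit"
    and orb: "\<forall>\<^sub>F s in at t within {0..1}. \<gamma> s \<in> orbit"
  shows "velocity J \<gamma> t = V"
proof -
  let ?F = "at t within {0..1}"
  have nbot: "?F \<noteq> bot"
    using t by (simp add: trivial_limit_within islimpt_Icc)
  note W = orbit_Lagrangian[OF t(3)]
  note Ws = orbit_subspace[OF t(3)] orbit_closed[OF t(3)]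
  let ?W = "\<gamma> t" and ?P = "ortho_proj (\<gamma> t)"
  define \<Delta> where "\<Delta> s = ortho_proj (\<gamma> s) - ?P" for s
  define G where "G s = graph_op ?W (\<gamma> s)" for s
  have Vs: "V \<in> sym_hs_on ?W"
    and q: "hs_tendsto (\<lambda>s. (1 / (s - t)) *\<^sub>R \<Delta> s) ((V o\<^sub>L J) - (J o\<^sub>L V)) ?F"
    using V by (auto simp: has_velocity_def \<Delta>_def)
  have q': "hs_tendsto (\<lambda>s. (1 / (s - t)) *\<^sub>R (\<Delta> s - \<Delta> t)) ((V o\<^sub>L J) - (J o\<^sub>L V)) ?F"
    using q by (simp add: \<Delta>_def)
  note \<Delta>0 = hs_tendsto_of_quotient[OF q']
  have \<Delta>t: "\<Delta> t = 0" by (simp add: \<Delta>_def)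
  have small: "\<forall>\<^sub>F s in ?F. hs_norm (\<Delta> s) < 1/2"
    using order_tendstoD(2)[OF \<Delta>0(1), of "1/2"] \<Delta>t by simp
  have ne: "\<forall>\<^sub>F s in ?F. s \<noteq> t" by (simp add: eventually_at_filter)
  have hs\<Delta>: "\<forall>\<^sub>F s in ?F. hilbert_schmidt (\<Delta> s)" using \<Delta>0(2) \<Delta>t by simp
  let ?A = "\<lambda>s. (id_blinfun - ?P) o\<^sub>L \<Delta> s o\<^sub>L ?P"
  have est: "\<forall>\<^sub>F s in ?F. s \<noteq> t \<and> hilbert_schmidt (\<Delta> s) \<and> hilbert_schmidt (G s) \<and>
      hs_norm (G s - ?A s) \<le> 2 * hs_norm (\<Delta> s) * hs_norm (\<Delta> s)"
    using small hs\<Delta> orb ne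
  proof eventually_elim
    case (elim s)
    note lag = orbit_Lagrangian[OF elim(3)]
    have n: "norm (\<Delta> s) \<le> 1/2" using norm_le_hs_norm[OF elim(2)] elim(1) by simp
    obtain T where T: "is_graph_op ?W (\<gamma> s) T"
      using proj_close_graph[OF W lag] n by (auto simp: \<Delta>_def)
    have GT: "G s = T" unfolding G_def by (rule graph_op_eq[OF Ws T])
    have mem: "w + \<Delta> s w \<in> \<gamma> s" if "w \<in> ?W" for w
      using proj_mem_add[OF lag W that] by (simp add: \<Delta>_def)
    show ?case
      unfolding GT using graph_op_hs_estimate(1,3)[OF Ws T mem elim(2)] n elim by simp
  qed
  have Gt: "G t = 0"
  proof -
    have "is_graph_op ?W ?W 0"
      using subspace_0[OF subspace_orthogonal_comp] by (auto simp: is_graph_op_def)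
    then show ?thesis unfolding G_def by (rule graph_op_eq[OF Ws])
  qed
  have limA: "hs_tendsto (\<lambda>s. (id_blinfun - ?P) o\<^sub>L ((1 / (s - t)) *\<^sub>R \<Delta> s) o\<^sub>L ?P)
      ((id_blinfun - ?P) o\<^sub>L ((V o\<^sub>L J) - (J o\<^sub>L V)) o\<^sub>L ?P) ?F"
    by (intro hs_tendsto_compose_left hs_tendsto_compose_right q tendsto_const)
  have limR: "hs_tendsto (\<lambda>s. (1 / (s - t)) *\<^sub>R (G s - ?A s)) 0 ?F"
  proof (rule hs_tendstoI)
    have "((\<lambda>s. 2 * hs_norm (\<Delta> s - \<Delta> t) * hs_norm ((1 / (s - t)) *\<^sub>R \<Delta> s)) \<longlongrightarrow> 2 * 0 * hs_norm ((V o\<^sub>L J) - (J o\<^sub>L V))) ?F"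
      by (intro tendsto_intros \<Delta>0(1) hs_tendsto_norm[OF q])
    then show "((\<lambda>s. 2 * hs_norm (\<Delta> s) * hs_norm ((1 / (s - t)) *\<^sub>R \<Delta> s)) \<longlongrightarrow> 0) ?F" by (simp add: \<Delta>t)
    show "\<forall>\<^sub>F s in ?F. hilbert_schmidt ((1 / (s - t)) *\<^sub>R (G s - ?A s)) \<and>
        hs_norm ((1 / (s - t)) *\<^sub>R (G s - ?A s) - 0) \<le> 2 * hs_norm (\<Delta> s) * hs_norm ((1 / (s - t)) *\<^sub>R \<Delta> s)"
      using est
    proof eventually_elim
      case (elim s)
      have hA: "hilbert_schmidt (?A s)" using elim by (intro hs_compose_left(1) hs_compose_right(1)) simp
      have hGA: "hilbert_schmidt (G s - ?A s)" using elim hA by (intro hs_diff(1)) auto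
      have "\<bar>1 / (s - t)\<bar> * hs_norm (G s - ?A s) \<le> \<bar>1 / (s - t)\<bar> * (2 * hs_norm (\<Delta> s) * hs_norm (\<Delta> s))"
        using elim by (intro mult_left_mono) auto
      then show ?case
        using hs_scaleR[OF hGA, of "1 / (s - t)"] hs_scaleR(2)[of "\<Delta> s" "1 / (s - t)"] elim
        by (simp add: algebra_simps)
    qed
  qed simp
  have "hs_tendsto (\<lambda>s. J o\<^sub>L (((id_blinfun - ?P) o\<^sub>L ((1 / (s - t)) *\<^sub>R \<Delta> s) o\<^sub>L ?P) + (1 / (s - t)) *\<^sub>R (G s - ?A s)))
      (J o\<^sub>L (((id_blinfun - ?P) o\<^sub>L ((V o\<^sub>L J) - (J o\<^sub>L V)) o\<^sub>L ?P) + 0)) ?F"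
    by (intro hs_tendsto_compose_left tendsto_const hs_tendsto_add limA limR)
  moreover have "J o\<^sub>L (((id_blinfun - ?P) o\<^sub>L ((V o\<^sub>L J) - (J o\<^sub>L V)) o\<^sub>L ?P) + 0) = V"
  proof (rule blinfun_eqI)
    fix x
    note c = sym_hs_on_compress[OF Ws Vs]
    have "V (J (?P x)) = 0"
      using Vs Lagrangian_J[OF W ortho_proj_in[OF Ws]] by (auto simp: sym_hs_on_def)
    then show "(J o\<^sub>L (((id_blinfun - ?P) o\<^sub>L ((V o\<^sub>L J) - (J o\<^sub>L V)) o\<^sub>L ?P) + 0)) x = V x"
      by (simp add: blinfun.bilinear_simps ortho_proj_J[OF W] c)
  qed
  moreover have "J o\<^sub>L (((id_blinfun - ?P) o\<^sub>L ((1 / (s - t)) *\<^sub>R \<Delta> s) o\<^sub>L ?P) + (1 / (s - t)) *\<^sub>R (G s - ?A s))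
      = (1 / (s - t)) *\<^sub>R (chart J ?W (\<gamma> s) - chart J ?W (\<gamma> t))" for s
    by (rule blinfun_eqI) (simp add: chart_def G_def[symmetric] Gt blinfun.bilinear_simps scaleR_diff_right)
  ultimately have qV: "hs_tendsto (\<lambda>s. (1 / (s - t)) *\<^sub>R (chart J ?W (\<gamma> s) - chart J ?W (\<gamma> t))) V ?F"
    by (simp only:)
  have "hs_has_derivative (\<lambda>s. chart J ?W (\<gamma> s)) V t {0..1}"
  proof (rule hs_has_derivativeI[OF qV])
    show "hilbert_schmidt (chart J ?W (\<gamma> t))"
      unfolding chart_def using Gt by (intro hs_compose_left(1)) (simp add: G_def)
    show "\<forall>\<^sub>F s in ?F. hilbert_schmidt (chart J ?W (\<gamma> s))"
      using est by eventually_elim (simp add: chart_def G_def hs_compose_left)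
  qed
  with Vs show ?thesis
    unfolding velocity_def
  proof (intro the_equality conjI)
    fix v assume "v \<in> sym_hs_on ?W \<and> hs_has_derivative (\<lambda>s. chart J ?W (\<gamma> s)) v t {0..1}"
    then have "hs_tendsto (\<lambda>s. (1 / (s - t)) *\<^sub>R (chart J ?W (\<gamma> s) - chart J ?W (\<gamma> t))) v ?F"
      using hs_has_derivativeD by blast
    then show "v = V" using tendsto_unique[OF nbot] hs_tendsto_imp_tendsto qV by blast
  qed
qed

end

section \<open>Piecewise smooth curves and their reparametrization\<close>

lemma hs_tendsto_filterlim:
  assumes "hs_tendsto f l F" "filterlim g F F'"
  shows "hs_tendsto (\<lambda>s. f (g s)) l F'"
  using assms filterlim_compose[OF _ assms(2)] eventually_compose_filterlim[OF _ assms(2)]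
  by (auto simp: hs_tendsto_def)

lemma hs_tendsto_scaleR:
  fixes l :: "'a::{real_inner,complete_space} \<Rightarrow>\<^sub>L 'a"
  assumes "hs_tendsto f l F"
  shows "hs_tendsto (\<lambda>s. c *\<^sub>R f s) (c *\<^sub>R l) F"
proof -
  have eq: "c *\<^sub>R a = (c *\<^sub>R id_blinfun) o\<^sub>L a" for a :: "'a \<Rightarrow>\<^sub>L 'a"
    by (rule blinfun_eqI) (simp add: blinfun.scaleR_left)
  show ?thesis
    using hs_tendsto_compose_left[OF tendsto_const assms, of "c *\<^sub>R id_blinfun"]
    by (simp only: eq[symmetric])
qed

lemma hs_has_derivative_affine:
  assumes f: "hs_has_derivative f D (\<alpha> * t + \<beta>) S" and \<alpha>: "\<alpha> \<noteq> 0"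
    and S: "\<And>s. s \<in> S' \<Longrightarrow> \<alpha> * s + \<beta> \<in> S"
  shows "hs_has_derivative (\<lambda>s. f (\<alpha> * s + \<beta>)) (\<alpha> *\<^sub>R D) t S'"
proof (rule hs_has_derivativeI)
  let ?\<phi> = "\<lambda>s. \<alpha> * s + \<beta>"
  have lim: "filterlim ?\<phi> (at (?\<phi> t) within S) (at t within S')"
    unfolding filterlim_at
  proof
    show "\<forall>\<^sub>F s in at t within S'. ?\<phi> s \<in> S \<and> ?\<phi> s \<noteq> ?\<phi> t"
      using S \<alpha> by (simp add: eventually_at_filter)
    show "(?\<phi> \<longlongrightarrow> ?\<phi> t) (at t within S')" by (intro tendsto_intros)
  qed
  show "hilbert_schmidt (f (?\<phi> t))" using f by (simp add: hs_has_derivative_def)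
  show "\<forall>\<^sub>F s in at t within S'. hilbert_schmidt (f (?\<phi> s))"
    using f by (intro eventually_compose_filterlim[OF _ lim]) (simp add: hs_has_derivative_def)
  have q: "hs_tendsto (\<lambda>s. \<alpha> *\<^sub>R ((1 / (?\<phi> s - ?\<phi> t)) *\<^sub>R (f (?\<phi> s) - f (?\<phi> t)))) (\<alpha> *\<^sub>R D) (at t within S')"
    by (intro hs_tendsto_scaleR hs_tendsto_filterlim[OF hs_has_derivativeD[OF f] lim])
  have "\<alpha> / (\<alpha> * s - \<alpha> * t) = 1 / (s - t)" for s
    using \<alpha> by (simp add: right_diff_distrib[symmetric])
  with q show "hs_tendsto (\<lambda>s. (1 / (s - t)) *\<^sub>R (f (?\<phi> s) - f (?\<phi> t))) (\<alpha> *\<^sub>R D) (at t within S')"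
    by simp
qed

lemma hs_smooth_on_affine:
  assumes f: "hs_smooth_on S f" and \<alpha>: "\<alpha> \<noteq> 0"
    and S: "\<And>s. s \<in> S' \<Longrightarrow> \<alpha> * s + \<beta> \<in> S"
  shows "hs_smooth_on S' (\<lambda>s. f (\<alpha> * s + \<beta>))"
proof -
  obtain D where D0: "\<And>t. t \<in> S \<Longrightarrow> D 0 t = f t"
    and D: "\<And>n t. t \<in> S \<Longrightarrow> hs_has_derivative (D n) (D (Suc n) t) t S"
    using f unfolding hs_smooth_on_def by blast
  have scale: "hs_has_derivative (\<lambda>s. c *\<^sub>R g s) (c *\<^sub>R E) t S'"
    if g: "hs_has_derivative g E t S'" for c g E t
  proof (rule hs_has_derivativeI)
    show "hilbert_schmidt (c *\<^sub>R g t)" using g by (simp add: hs_has_derivative_def hs_scaleR)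
    have "\<forall>\<^sub>F s in at t within S'. hilbert_schmidt (g s)" using g by (simp add: hs_has_derivative_def)
    then show "\<forall>\<^sub>F s in at t within S'. hilbert_schmidt (c *\<^sub>R g s)" by eventually_elim (rule hs_scaleR)
    show "hs_tendsto (\<lambda>s. (1 / (s - t)) *\<^sub>R (c *\<^sub>R g s - c *\<^sub>R g t)) (c *\<^sub>R E) (at t within S')"
      using hs_tendsto_scaleR[OF hs_has_derivativeD[OF g], of c]
      by (simp add: scaleR_diff_right[symmetric] mult.commute)
  qed
  \<comment> \<open>chain rule: every derivative contributes one factor \<open>\<alpha>\<close>\<close>
  define D' where "D' n t = (\<alpha> ^ n) *\<^sub>R D n (\<alpha> * t + \<beta>)" for n t
  have "D' 0 t = f (\<alpha> * t + \<beta>)" if "t \<in> S'" for t using D0 S that by (simp add: D'_def)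
  moreover have "hs_has_derivative (D' n) (D' (Suc n) t) t S'" if t: "t \<in> S'" for n t
    using scale[OF hs_has_derivative_affine[OF D[OF S[OF t]] \<alpha> S], of "\<alpha> ^ n" n]
    by (simp add: D'_def[abs_def] mult.commute)
  ultimately show ?thesis unfolding hs_smooth_on_def by blast
qed

lemma smooth_curve_on_affine:
  assumes \<gamma>: "smooth_curve_on J L0 c d \<gamma>" and \<alpha>: "\<alpha> \<noteq> 0"
    and S: "\<And>s. s \<in> {a..b} \<Longrightarrow> \<alpha> * s + \<beta> \<in> {c..d}"
  shows "smooth_curve_on J L0 a b (\<lambda>s. \<gamma> (\<alpha> * s + \<beta>))"
  unfolding smooth_curve_on_def
proof
  fix t assume t: "t \<in> {a..b}"
  let ?\<phi> = "\<lambda>s. \<alpha> * s + \<beta>"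
  obtain L \<epsilon> where L: "L \<in> Sp2_orbit J L0" and \<epsilon>: "\<epsilon> > 0"
    and dom: "\<forall>s\<in>{c..d} \<inter> {?\<phi> t - \<epsilon><..<?\<phi> t + \<epsilon>}. \<gamma> s \<in> chart_dom J L \<inter> Sp2_orbit J L0"
    and sm: "hs_smooth_on ({c..d} \<inter> {?\<phi> t - \<epsilon><..<?\<phi> t + \<epsilon>}) (\<lambda>s. chart J L (\<gamma> s))"
    using \<gamma> S[OF t] unfolding smooth_curve_on_def by blast
  define \<delta> where "\<delta> = \<epsilon> / \<bar>\<alpha>\<bar>"
  have \<delta>: "\<delta> > 0" using \<epsilon> \<alpha> by (simp add: \<delta>_def)
  have sub: "?\<phi> s \<in> {c..d} \<inter> {?\<phi> t - \<epsilon><..<?\<phi> t + \<epsilon>}" if s: "s \<in> {a..b} \<inter> {t - \<delta><..<t + \<delta>}" for s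
  proof -
    have "\<bar>s - t\<bar> < \<delta>" using s by (auto simp: abs_less_iff)
    then have "\<bar>\<alpha>\<bar> * \<bar>s - t\<bar> < \<epsilon>" using \<alpha> by (simp add: \<delta>_def pos_less_divide_eq mult.commute)
    then have "\<bar>?\<phi> s - ?\<phi> t\<bar> < \<epsilon>" by (simp add: abs_mult[symmetric] right_diff_distrib)
    then show ?thesis using S[of s] s by (auto simp: abs_less_iff)
  qed
  show "\<exists>L\<in>Sp2_orbit J L0. \<exists>\<epsilon>>0.
        (\<forall>s\<in>{a..b} \<inter> {t-\<epsilon><..<t+\<epsilon>}. \<gamma> (?\<phi> s) \<in> chart_dom J L \<inter> Sp2_orbit J L0) \<and>
        hs_smooth_on ({a..b} \<inter> {t-\<epsilon><..<t+\<epsilon>}) (\<lambda>s. chart J L (\<gamma> (?\<phi> s)))"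
    using L \<delta> dom sub hs_smooth_on_affine[OF sm \<alpha> sub] by blast
qed

text \<open>
  Piecewise smoothness on an arbitrary interval, in a form that allows induction over the pieces and
  makes concatenation immediate.
\<close>

inductive pw_smooth ::
  "('a::{real_inner,complete_space} \<Rightarrow>\<^sub>L 'a) \<Rightarrow> 'a set \<Rightarrow> (real \<Rightarrow> 'a set) \<Rightarrow> real \<Rightarrow> real \<Rightarrow> bool"
  for J L0 \<gamma> where
  piece: "a < b \<Longrightarrow> smooth_curve_on J L0 a b \<gamma> \<Longrightarrow> pw_smooth J L0 \<gamma> a b"
| join: "pw_smooth J L0 \<gamma> a b \<Longrightarrow> b < c \<Longrightarrow> smooth_curve_on J L0 b c \<gamma> \<Longrightarrow> pw_smooth J L0 \<gamma> a c"

lemma pw_smooth_less: "pw_smooth J L0 \<gamma> a b \<Longrightarrow> a < b"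
  by (induction rule: pw_smooth.induct) auto

lemma pw_smooth_trans:
  assumes "pw_smooth J L0 \<gamma> a b" "pw_smooth J L0 \<gamma> b c"
  shows "pw_smooth J L0 \<gamma> a c"
  using assms(2,1)
proof (induction b c rule: pw_smooth.induct)
  case (piece b c) then show ?case by (blast intro: pw_smooth.join)
next
  case (join b c d) then show ?case by (blast intro: pw_smooth.join)
qed

lemma piecewise_smooth_curve_iff: "piecewise_smooth_curve J L0 \<gamma> \<longleftrightarrow> pw_smooth J L0 \<gamma> 0 1"
proof
  assume "piecewise_smooth_curve J L0 \<gamma>"
  then obtain n and \<tau> :: "nat \<Rightarrow> real" where \<tau>: "\<tau> 0 = 0" "\<tau> n = 1"
    and pc: "\<And>i. i < n \<Longrightarrow> \<tau> i < \<tau> (Suc i) \<and> smooth_curve_on J L0 (\<tau> i) (\<tau> (Suc i)) \<gamma>"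
    unfolding piecewise_smooth_curve_def by blast
  have pw: "m < n \<Longrightarrow> pw_smooth J L0 \<gamma> (\<tau> 0) (\<tau> (Suc m))" for m
  proof (induction m)
    case 0 then show ?case using pc[of 0] by (auto intro: pw_smooth.piece)
  next
    case (Suc m) then show ?case using pc[of "Suc m"] by (auto intro: pw_smooth.join)
  qed
  obtain m where m: "n = Suc m" using \<tau> by (cases n) auto
  show "pw_smooth J L0 \<gamma> 0 1" using pw[of m] \<tau> by (simp add: m)
next
  have "\<exists>(n::nat) \<tau>. \<tau> 0 = a \<and> \<tau> n = b \<and>
      (\<forall>i<n. \<tau> i < \<tau> (Suc i) \<and> smooth_curve_on J L0 (\<tau> i) (\<tau> (Suc i)) \<gamma>)"
    if "pw_smooth J L0 \<gamma> a b" for a b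
    using that
  proof (induction rule: pw_smooth.induct)
    case (piece a b)
    then show ?case by (intro exI[of _ 1] exI[of _ "\<lambda>i. if i = 0 then a else b"]) simp
  next
    case (join a b c)
    then obtain n and \<tau> :: "nat \<Rightarrow> real" where \<tau>: "\<tau> 0 = a" "\<tau> n = b"
      and pc: "\<And>i. i < n \<Longrightarrow> \<tau> i < \<tau> (Suc i) \<and> smooth_curve_on J L0 (\<tau> i) (\<tau> (Suc i)) \<gamma>"
      by blast
    let ?\<tau> = "\<tau>(Suc n := c)"
    have "?\<tau> i < ?\<tau> (Suc i) \<and> smooth_curve_on J L0 (?\<tau> i) (?\<tau> (Suc i)) \<gamma>" if "i < Suc n" for i
      using pc[of i] that join \<tau> by (cases "i = n") auto
    then show ?case using \<tau> by (intro exI[of _ "Suc n"] exI[of _ ?\<tau>]) simp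
  qed
  then show "pw_smooth J L0 \<gamma> 0 1 \<Longrightarrow> piecewise_smooth_curve J L0 \<gamma>"
    unfolding piecewise_smooth_curve_def by blast
qed

lemma smooth_curve_on_cong:
  assumes "smooth_curve_on J L0 a b \<gamma>" "\<And>t. t \<in> {a..b} \<Longrightarrow> \<gamma> t = \<delta> t"
  shows "smooth_curve_on J L0 a b \<delta>"
proof -
  have "hs_smooth_on ({a..b} \<inter> N) (\<lambda>s. chart J L (\<gamma> s)) \<longleftrightarrow> hs_smooth_on ({a..b} \<inter> N) (\<lambda>s. chart J L (\<delta> s))" for N L
    unfolding hs_smooth_on_def using assms(2) by (intro ex_cong1 conj_cong ball_cong) auto
  then show ?thesis using assms unfolding smooth_curve_on_def by (smt (verit, best) IntD1)
qed

lemma pw_smooth_cong: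
  assumes "pw_smooth J L0 \<gamma> a b" "\<And>t. t \<in> {a..b} \<Longrightarrow> \<gamma> t = \<delta> t"
  shows "pw_smooth J L0 \<delta> a b"
  using assms
proof (induction rule: pw_smooth.induct)
  case (piece a b) then show ?case by (blast intro: pw_smooth.piece smooth_curve_on_cong)
next
  case (join a b c)
  have "pw_smooth J L0 \<delta> a b" using join by auto
  moreover have "smooth_curve_on J L0 b c \<delta>"
    by (rule smooth_curve_on_cong[OF join.hyps(3)]) (use pw_smooth_less[OF join.hyps(1)] join.prems in auto)
  ultimately show ?case using join.hyps(2) by (blast intro: pw_smooth.join)
qed

lemma pw_smooth_affine_pos:
  assumes "pw_smooth J L0 \<gamma> c d" and \<alpha>: "\<alpha> > 0"
  shows "pw_smooth J L0 (\<lambda>s. \<gamma> (\<alpha> * s + \<beta>)) ((c - \<beta>) / \<alpha>) ((d - \<beta>) / \<alpha>)"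
proof -
  have pc: "(c - \<beta>) / \<alpha> < (d - \<beta>) / \<alpha>" "smooth_curve_on J L0 ((c - \<beta>) / \<alpha>) ((d - \<beta>) / \<alpha>) (\<lambda>s. \<gamma> (\<alpha> * s + \<beta>))"
    if "c < d" "smooth_curve_on J L0 c d \<gamma>" for c d
    using that \<alpha> by (intro divide_strict_right_mono smooth_curve_on_affine; auto simp: field_simps)+
  show ?thesis using assms(1)
    by (induction rule: pw_smooth.induct) (auto intro: pw_smooth.intros pc)
qed

lemma pw_smooth_affine_neg:
  assumes "pw_smooth J L0 \<gamma> c d" and \<alpha>: "\<alpha> < 0"
  shows "pw_smooth J L0 (\<lambda>s. \<gamma> (\<alpha> * s + \<beta>)) ((d - \<beta>) / \<alpha>) ((c - \<beta>) / \<alpha>)"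
proof -
  have pc: "pw_smooth J L0 (\<lambda>s. \<gamma> (\<alpha> * s + \<beta>)) ((d - \<beta>) / \<alpha>) ((c - \<beta>) / \<alpha>)"
    if "c < d" "smooth_curve_on J L0 c d \<gamma>" for c d
    using that \<alpha> by (intro pw_smooth.piece smooth_curve_on_affine) (auto simp: field_simps)
  show ?thesis using assms(1)
  proof (induction rule: pw_smooth.induct)
    case (piece a b) then show ?case by (rule pc)
  next
    case (join a b c) then show ?case using pc pw_smooth_trans by blast
  qed
qed

section \<open>Speed and length\<close>

text \<open>
  The integrand of the length functional in terms of projections. It depends on the curve near \<open>t\<close>
  only and is compatible with affine reparametrization; it has an arbitrary value where there is
  no velocity, as may be the case at break points.
\<close>

definition speed :: "('a::{real_inner,complete_space} \<Rightarrow>\<^sub>L 'a) \<Rightarrow> (real \<Rightarrow> 'a set) \<Rightarrow> real \<Rightarrow> real" where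
  "speed J \<gamma> t = hs_norm (SOME V. has_velocity J \<gamma> V t UNIV)"

lemma speed_nonneg [simp]: "0 \<le> speed J \<gamma> t"
  by (simp add: speed_def)

lemma has_velocity_tendsto:
  assumes "has_velocity J \<gamma> V t S"
  shows "((\<lambda>s. ortho_proj (\<gamma> s)) \<longlongrightarrow> ortho_proj (\<gamma> t)) (at t within S)"
proof (rule LIM_zero_cancel)
  let ?q = "\<lambda>s. (1 / (s - t)) *\<^sub>R (ortho_proj (\<gamma> s) - ortho_proj (\<gamma> t))"
  have q: "hs_tendsto ?q ((V o\<^sub>L J) - (J o\<^sub>L V)) (at t within S)" using assms by (simp add: has_velocity_def)
  have "((\<lambda>s. (s - t) *\<^sub>R ?q s) \<longlongrightarrow> (t - t) *\<^sub>R ((V o\<^sub>L J) - (J o\<^sub>L V))) (at t within S)"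
    by (intro tendsto_intros hs_tendsto_imp_tendsto[OF q])
  then have "((\<lambda>s. (s - t) *\<^sub>R ?q s) \<longlongrightarrow> 0) (at t within S)" by simp
  then show "((\<lambda>s. ortho_proj (\<gamma> s) - ortho_proj (\<gamma> t)) \<longlongrightarrow> 0) (at t within S)"
    by (rule Lim_transform_eventually) (simp add: eventually_at_filter)
qed

lemma has_velocity_at_cong: "at t within S = at t within S' \<Longrightarrow> has_velocity J \<gamma> V t S = has_velocity J \<gamma> V t S'"
  by (simp add: has_velocity_def)

context complex_structure
begin

lemma speed_eq:
  assumes "\<gamma> t \<in> Lagrangian J" "has_velocity J \<gamma> V t UNIV"
  shows "speed J \<gamma> t = hs_norm V"
proof -
  have "has_velocity J \<gamma> (SOME V. has_velocity J \<gamma> V t UNIV) t UNIV" using assms(2) by (rule someI)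
  then show ?thesis unfolding speed_def using has_velocity_unique[OF assms(1) _ assms(2)] by fastforce
qed

lemma has_velocity_affine:
  assumes W: "\<gamma> (\<alpha> * t + \<beta>) \<in> Lagrangian J"
    and V: "has_velocity J \<gamma> V (\<alpha> * t + \<beta>) UNIV" and \<alpha>: "\<alpha> \<noteq> 0"
  shows "has_velocity J (\<lambda>s. \<gamma> (\<alpha> * s + \<beta>)) (\<alpha> *\<^sub>R V) t UNIV"
proof -
  let ?\<phi> = "\<lambda>s. \<alpha> * s + \<beta>"
  have lim: "filterlim ?\<phi> (at (?\<phi> t)) (at t)"
    unfolding filterlim_at
  proof
    show "\<forall>\<^sub>F s in at t. ?\<phi> s \<in> UNIV \<and> ?\<phi> s \<noteq> ?\<phi> t"
      using \<alpha> by (simp add: eventually_at_filter)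
    show "(?\<phi> \<longlongrightarrow> ?\<phi> t) (at t)" by (intro tendsto_intros)
  qed
  let ?p = "\<lambda>s. ortho_proj (\<gamma> s)"
  have "hs_tendsto (\<lambda>s. (1 / (s - ?\<phi> t)) *\<^sub>R (?p s - ?p (?\<phi> t))) ((V o\<^sub>L J) - (J o\<^sub>L V)) (at (?\<phi> t))"
    using V by (simp add: has_velocity_def)
  from hs_tendsto_scaleR[OF hs_tendsto_filterlim[OF this lim], of \<alpha>]
  have q: "hs_tendsto (\<lambda>s. \<alpha> *\<^sub>R ((1 / (?\<phi> s - ?\<phi> t)) *\<^sub>R (?p (?\<phi> s) - ?p (?\<phi> t))))
     (\<alpha> *\<^sub>R ((V o\<^sub>L J) - (J o\<^sub>L V))) (at t)" .
  have e: "\<alpha> / (\<alpha> * s - \<alpha> * t) = 1 / (s - t)" for s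
    using \<alpha> by (simp add: right_diff_distrib[symmetric])
  have e2: "\<alpha> *\<^sub>R ((V o\<^sub>L J) - (J o\<^sub>L V)) = ((\<alpha> *\<^sub>R V) o\<^sub>L J) - (J o\<^sub>L (\<alpha> *\<^sub>R V))"
    by (rule blinfun_eqI) (simp add: blinfun.bilinear_simps scaleR_diff_right)
  have "hs_tendsto (\<lambda>s. (1 / (s - t)) *\<^sub>R (?p (?\<phi> s) - ?p (?\<phi> t)))
     (((\<alpha> *\<^sub>R V) o\<^sub>L J) - (J o\<^sub>L (\<alpha> *\<^sub>R V))) (at t)"
    using q unfolding e2 by (simp add: e)
  moreover have "\<alpha> *\<^sub>R V \<in> sym_hs_on (\<gamma> (?\<phi> t))"
    using V Lagrangian_subspace[OF W]
    by (auto simp: has_velocity_def sym_hs_on_def hs_scaleR blinfun.scaleR_left subspace_scale)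
  ultimately show ?thesis by (simp add: has_velocity_def)
qed

end

lemma hs_tendsto_mono: "F' \<le> F \<Longrightarrow> hs_tendsto f l F \<Longrightarrow> hs_tendsto f l F'"
  by (auto simp: hs_tendsto_def intro: tendsto_mono filter_leD)

lemma has_velocity_subset: "has_velocity J \<gamma> V t S \<Longrightarrow> S' \<subseteq> S \<Longrightarrow> has_velocity J \<gamma> V t S'"
  unfolding has_velocity_def using hs_tendsto_mono at_le by blast

lemma has_velocity_cong:
  assumes eq: "\<And>s. s \<in> {a<..<b} \<Longrightarrow> \<gamma> s = \<delta> s" and t: "t \<in> {a<..<b}"
  shows "has_velocity J \<gamma> V t UNIV \<longleftrightarrow> has_velocity J \<delta> V t UNIV"
proof -
  have "has_velocity J \<delta>' V t UNIV" if v: "has_velocity J \<gamma>' V t UNIV"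
    and e: "\<And>s. s \<in> {a<..<b} \<Longrightarrow> \<gamma>' s = \<delta>' s" for \<gamma>' \<delta>'
  proof -
    have "\<forall>\<^sub>F s in at t. s \<in> {a<..<b}"
      using t by (intro eventually_at_in_open') auto
    then have "\<forall>\<^sub>F s in at t. (1 / (s - t)) *\<^sub>R (ortho_proj (\<gamma>' s) - ortho_proj (\<gamma>' t))
        = (1 / (s - t)) *\<^sub>R (ortho_proj (\<delta>' s) - ortho_proj (\<delta>' t))"
      by eventually_elim (use e t in simp)
    then show ?thesis using v e[OF t] hs_tendsto_cong unfolding has_velocity_def by fastforce
  qed
  then show ?thesis using eq by metis
qed

lemma speed_cong:
  assumes "\<And>s. s \<in> {a<..<b} \<Longrightarrow> \<gamma> s = \<delta> s" "t \<in> {a<..<b}"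
  shows "speed J \<gamma> t = speed J \<delta> t"
proof -
  have "(\<lambda>V. has_velocity J \<gamma> V t UNIV) = (\<lambda>V. has_velocity J \<delta> V t UNIV)"
    by (rule ext, rule has_velocity_cong[of a b]) (use assms in auto)
  then show ?thesis by (simp add: speed_def)
qed

lemma integral_speed_cong:
  assumes "\<And>s. s \<in> {a..b} \<Longrightarrow> \<gamma> s = \<delta> s"
  shows "integral {a..b} (speed J \<gamma>) = integral {a..b} (speed J \<delta>)"
proof (rule integral_spike)
  show "negligible {a, b}" by simp
  show "speed J \<delta> t = speed J \<gamma> t" if "t \<in> {a..b} - {a, b}" for t
    using that assms by (intro speed_cong[of a b]) auto
qed

context Lagrangian_orbit
begin

text \<open>
  Each local chart gives a formula for the velocity with Hilbert--Schmidt continuous dependence on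
  time. By uniqueness the velocities from overlapping charts agree, so the norm is continuous on
  the whole interval and the length integral of the piece exists.
\<close>

lemma smooth_velocity:
  assumes ab: "a < b" and sm: "smooth_curve_on J L0 a b \<gamma>"
  obtains V where "\<And>t. t \<in> {a..b} \<Longrightarrow> \<gamma> t \<in> orbit"
    and "\<And>t. t \<in> {a..b} \<Longrightarrow> has_velocity J \<gamma> (V t) t {a..b}"
    and "continuous_on {a..b} (\<lambda>t. hs_norm (V t))"
proof -
  have nbot: "at t within {a..b} \<noteq> bot" if "t \<in> {a..b}" for t
    using that ab by (simp add: trivial_limit_within islimpt_Icc)
  have loc: "\<exists>N E. open N \<and> t0 \<in> N \<and> (\<forall>t\<in>{a..b} \<inter> N. \<gamma> t \<in> orbit \<and>
       has_velocity J \<gamma> (ortho_proj (\<gamma> t) o\<^sub>L E t o\<^sub>L ortho_proj (\<gamma> t)) t {a..b}) \<and>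
       hs_tendsto E (E t0) (at t0 within {a..b})" if t0: "t0 \<in> {a..b}" for t0
  proof -
    obtain L \<epsilon> where L: "L \<in> orbit" and \<epsilon>: "\<epsilon> > 0"
      and dom: "\<forall>s\<in>{a..b} \<inter> {t0 - \<epsilon><..<t0 + \<epsilon>}. \<gamma> s \<in> chart_dom J L \<inter> orbit"
      and sm: "hs_smooth_on ({a..b} \<inter> {t0 - \<epsilon><..<t0 + \<epsilon>}) (\<lambda>s. chart J L (\<gamma> s))"
      using sm t0 unfolding smooth_curve_on_def by blast
    let ?N = "{t0 - \<epsilon><..<t0 + \<epsilon>}" and ?S = "{a..b} \<inter> {t0 - \<epsilon><..<t0 + \<epsilon>}"
    obtain D where D0: "\<And>t. t \<in> ?S \<Longrightarrow> D 0 t = chart J L (\<gamma> t)"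
      and D: "\<And>n t. t \<in> ?S \<Longrightarrow> hs_has_derivative (D n) (D (Suc n) t) t ?S"
      using sm unfolding hs_smooth_on_def by blast
    have at: "at t within ?S = at t within {a..b}" if "t \<in> ?S" for t
      by (rule at_within_nhd[of t ?N]) (use that in auto)
    have "has_velocity J \<gamma> (ortho_proj (\<gamma> t) o\<^sub>L D 1 t o\<^sub>L ortho_proj (\<gamma> t)) t {a..b}" if t: "t \<in> ?S" for t
    proof -
      have q: "hs_tendsto (\<lambda>s. (1 / (s - t)) *\<^sub>R (D 0 s - D 0 t)) (D 1 t) (at t within ?S)"
        using hs_has_derivativeD[OF D[OF t, of 0]] by simp
      have "hs_has_derivative (\<lambda>s. chart J L (\<gamma> s)) (D 1 t) t ?S"
      proof (rule hs_has_derivativeI)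
        have ev: "\<forall>\<^sub>F s in at t within ?S. D 0 s = chart J L (\<gamma> s)"
          using D0 by (auto simp: eventually_at_filter)
        then show "hs_tendsto (\<lambda>s. (1 / (s - t)) *\<^sub>R (chart J L (\<gamma> s) - chart J L (\<gamma> t))) (D 1 t) (at t within ?S)"
          by (intro hs_tendsto_cong[OF q], elim eventually_mono) (simp add: D0[OF t])
        show "hilbert_schmidt (chart J L (\<gamma> t))"
          using D[OF t, of 0] D0[OF t] by (simp add: hs_has_derivative_def)
        have "\<forall>\<^sub>F s in at t within ?S. hilbert_schmidt (D 0 s)"
          using D[OF t, of 0] by (simp add: hs_has_derivative_def)
        with ev show "\<forall>\<^sub>F s in at t within ?S. hilbert_schmidt (chart J L (\<gamma> s))"
          by eventually_elim simp
      qed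
      moreover have "at t within ?S \<noteq> bot" using nbot[of t] t by (simp only: at[OF t]) simp
      ultimately have "has_velocity J \<gamma> (ortho_proj (\<gamma> t) o\<^sub>L D 1 t o\<^sub>L ortho_proj (\<gamma> t)) t ?S"
        using dom by (intro chart_velocity[OF L t]) blast+
      then show ?thesis using has_velocity_at_cong[OF at[OF t]] by blast
    qed
    moreover have t0S: "t0 \<in> ?S" using t0 \<epsilon> by simp
    have "hs_tendsto (D 1) (D 1 t0) (at t0 within {a..b})"
      using hs_has_derivative_continuous[OF D[OF t0S, of 1]] at[OF t0S] by simp
    ultimately show ?thesis using dom t0S by (intro exI[of _ ?N] exI[of _ "D 1"]) auto
  qed
  have orb: "\<gamma> t \<in> orbit" if "t \<in> {a..b}" for t using loc[OF that] that by blast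
  have "\<forall>t\<in>{a..b}. \<exists>V. has_velocity J \<gamma> V t {a..b}" using loc by blast
  then obtain V where V: "\<And>t. t \<in> {a..b} \<Longrightarrow> has_velocity J \<gamma> (V t) t {a..b}" by metis
  have "continuous_on {a..b} (\<lambda>t. hs_norm (V t))"
    unfolding continuous_on_def
  proof
    fix t0 assume t0: "t0 \<in> {a..b}"
    obtain N E where N: "open N" "t0 \<in> N"
      and vel: "\<And>t. t \<in> {a..b} \<inter> N \<Longrightarrow> has_velocity J \<gamma> (ortho_proj (\<gamma> t) o\<^sub>L E t o\<^sub>L ortho_proj (\<gamma> t)) t {a..b}"
      and E: "hs_tendsto E (E t0) (at t0 within {a..b})" using loc[OF t0] by blast
    have VE: "V t = ortho_proj (\<gamma> t) o\<^sub>L E t o\<^sub>L ortho_proj (\<gamma> t)" if "t \<in> {a..b} \<inter> N" for t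
      using has_velocity_unique[OF orbit_Lagrangian[OF orb] V vel nbot, of t] that by auto
    have p: "((\<lambda>s. ortho_proj (\<gamma> s)) \<longlongrightarrow> ortho_proj (\<gamma> t0)) (at t0 within {a..b})"
      by (rule has_velocity_tendsto[OF V[OF t0]])
    have "hs_tendsto (\<lambda>t. ortho_proj (\<gamma> t) o\<^sub>L E t o\<^sub>L ortho_proj (\<gamma> t))
        (ortho_proj (\<gamma> t0) o\<^sub>L E t0 o\<^sub>L ortho_proj (\<gamma> t0)) (at t0 within {a..b})"
      by (intro hs_tendsto_compose_left hs_tendsto_compose_right p E)
    moreover have "\<forall>\<^sub>F t in at t0 within {a..b}. t \<in> {a..b} \<inter> N"
      using N eventually_at_topological by (auto simp: eventually_at_topological)
    then have "\<forall>\<^sub>F t in at t0 within {a..b}. ortho_proj (\<gamma> t) o\<^sub>L E t o\<^sub>L ortho_proj (\<gamma> t) = V t"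
      by eventually_elim (simp add: VE)
    ultimately have "hs_tendsto V (V t0) (at t0 within {a..b})"
      using hs_tendsto_cong VE[of t0] t0 N by fastforce
    then show "((\<lambda>t. hs_norm (V t)) \<longlongrightarrow> hs_norm (V t0)) (at t0 within {a..b})"
      by (rule hs_tendsto_norm)
  qed
  with orb V show ?thesis using that by blast
qed

text \<open>
  The times at which the integrand of the length is governed by a velocity. A piecewise smooth
  curve has only finitely many other times, and these do not affect integrals.
\<close>

definition regular :: "(real \<Rightarrow> 'a set) \<Rightarrow> real \<Rightarrow> bool" where
  "regular \<gamma> t \<longleftrightarrow> \<gamma> t \<in> orbit \<and> (\<forall>\<^sub>F s in at t. \<gamma> s \<in> orbit) \<and>
     (\<exists>V. has_velocity J \<gamma> V t UNIV)"

text \<open>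
  Pairing the projections with fixed vectors \<open>y e\<close> gives a real function, to which the fundamental
  theorem of calculus applies. By Cauchy--Schwarz its derivative is at most the Hilbert--Schmidt
  norm of \<open>V J - J V\<close>, hence at most \<open>2 \<parallel>V\<parallel>\<^sub>2\<close>, times the Euclidean norm of \<open>y\<close>.
\<close>

lemma projection_increment_le:
  assumes ab: "a < b"
    and orb: "\<And>t. t \<in> {a..b} \<Longrightarrow> \<gamma> t \<in> orbit"
    and V: "\<And>t. t \<in> {a..b} \<Longrightarrow> has_velocity J \<gamma> (V t) t {a..b}"
    and int: "(\<lambda>t. hs_norm (V t)) integrable_on {a..b}"
    and G: "finite G" "G \<subseteq> some_basis"
  shows "(\<Sum>e\<in>G. (ortho_proj (\<gamma> b) e - ortho_proj (\<gamma> a) e) \<bullet> y e)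
     \<le> 2 * L2_set (\<lambda>e. norm (y e)) G * integral {a..b} (\<lambda>t. hs_norm (V t))"
proof -
  let ?h = "\<lambda>t. \<Sum>e\<in>G. ortho_proj (\<gamma> t) e \<bullet> y e"
  let ?\<Phi> = "\<lambda>t. (V t o\<^sub>L J) - (J o\<^sub>L V t)"
  let ?h' = "\<lambda>t. \<Sum>e\<in>G. ?\<Phi> t e \<bullet> y e"
  have der: "(?h has_vector_derivative ?h' t) (at t within {a..b})" if t: "t \<in> {a..b}" for t
    unfolding has_real_derivative_iff_has_vector_derivative[symmetric] has_field_derivative_iff
  proof -
    let ?q = "\<lambda>s. (1 / (s - t)) *\<^sub>R (ortho_proj (\<gamma> s) - ortho_proj (\<gamma> t))"
    have q: "(?q \<longlongrightarrow> ?\<Phi> t) (at t within {a..b})"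
      by (rule hs_tendsto_imp_tendsto) (use V[OF t] in \<open>simp add: has_velocity_def\<close>)
    have "((\<lambda>s. \<Sum>e\<in>G. ?q s e \<bullet> y e) \<longlongrightarrow> ?h' t) (at t within {a..b})"
      by (intro tendsto_intros q)
    moreover have "(\<Sum>e\<in>G. ?q s e \<bullet> y e) = (?h s - ?h t) / (s - t)" for s
      by (simp add: blinfun.bilinear_simps inner_diff_left sum_subtractf sum_divide_distrib[symmetric])
    ultimately show "((\<lambda>s. (?h s - ?h t) / (s - t)) \<longlongrightarrow> ?h' t) (at t within {a..b})" by simp
  qed
  have le: "?h' t \<le> 2 * L2_set (\<lambda>e. norm (y e)) G * hs_norm (V t)" if t: "t \<in> {a..b}" for t
  proof -
    note v = has_velocity_hs_norm[OF orbit_Lagrangian[OF orb[OF t]] V[OF t]]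
    have "?h' t \<le> (\<Sum>e\<in>G. \<bar>norm (?\<Phi> t e)\<bar> * \<bar>norm (y e)\<bar>)"
      by (intro sum_mono) (simp add: norm_cauchy_schwarz)
    also have "\<dots> \<le> L2_set (\<lambda>e. norm (?\<Phi> t e)) G * L2_set (\<lambda>e. norm (y e)) G"
      by (rule L2_set_mult_ineq)
    also have "\<dots> \<le> (2 * hs_norm (V t)) * L2_set (\<lambda>e. norm (y e)) G"
      using hs_L2_set_le[OF v(2) G] v(3) by (intro mult_right_mono) auto
    finally show ?thesis by (simp add: ac_simps)
  qed
  have "(?h' has_integral (?h b - ?h a)) {a..b}"
    by (rule fundamental_theorem_of_calculus) (use ab der in auto)
  moreover have "((\<lambda>t. 2 * L2_set (\<lambda>e. norm (y e)) G * hs_norm (V t)) has_integral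
      2 * L2_set (\<lambda>e. norm (y e)) G * integral {a..b} (\<lambda>t. hs_norm (V t))) {a..b}"
    by (intro has_integral_mult_right integrable_integral int)
  ultimately have "?h b - ?h a \<le> 2 * L2_set (\<lambda>e. norm (y e)) G * integral {a..b} (\<lambda>t. hs_norm (V t))"
    by (rule has_integral_le) (rule le)
  then show ?thesis by (simp add: inner_diff_left sum_subtractf)
qed

lemma smooth_piece:
  assumes ab: "a < b" and sm: "smooth_curve_on J L0 a b \<gamma>"
  shows "\<And>t. t \<in> {a..b} \<Longrightarrow> \<gamma> t \<in> orbit"
    and "\<And>t. t \<in> {a<..<b} \<Longrightarrow> regular \<gamma> t"
    and "speed J \<gamma> integrable_on {a..b}"
    and "\<And>G y. finite G \<Longrightarrow> G \<subseteq> some_basis \<Longrightarrow>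
      (\<Sum>e\<in>G. (ortho_proj (\<gamma> b) e - ortho_proj (\<gamma> a) e) \<bullet> y e)
        \<le> 2 * L2_set (\<lambda>e. norm (y e)) G * integral {a..b} (speed J \<gamma>)"
proof -
  obtain V where orb: "\<And>t. t \<in> {a..b} \<Longrightarrow> \<gamma> t \<in> orbit"
    and V: "\<And>t. t \<in> {a..b} \<Longrightarrow> has_velocity J \<gamma> (V t) t {a..b}"
    and cont: "continuous_on {a..b} (\<lambda>t. hs_norm (V t))" using smooth_velocity[OF ab sm] by blast
  show "\<And>t. t \<in> {a..b} \<Longrightarrow> \<gamma> t \<in> orbit" by (rule orb)
  have VU: "has_velocity J \<gamma> (V t) t UNIV" if "t \<in> {a<..<b}" for t
  proof -
    have "at t within {a..b} = at t" using that by (intro at_within_Icc_at) auto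
    then show ?thesis using has_velocity_at_cong[of t "{a..b}" UNIV] V[of t] that by auto
  qed
  show "regular \<gamma> t" if t: "t \<in> {a<..<b}" for t
  proof -
    have "\<forall>\<^sub>F s in at t. s \<in> {a<..<b}" using t by (intro eventually_at_in_open') auto
    then have "\<forall>\<^sub>F s in at t. \<gamma> s \<in> orbit" by eventually_elim (rule orb, simp)
    then show ?thesis using VU[OF t] orb[of t] t by (auto simp: regular_def)
  qed
  have int: "(\<lambda>t. hs_norm (V t)) integrable_on {a..b}" using cont by (rule integrable_continuous_real)
  have eq: "speed J \<gamma> t = hs_norm (V t)" if "t \<in> {a..b} - {a, b}" for t
    using that by (intro speed_eq VU orbit_Lagrangian orb) auto
  show "speed J \<gamma> integrable_on {a..b}" by (rule integrable_spike_finite[of "{a, b}", OF _ eq int]) auto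
  have "integral {a..b} (\<lambda>t. hs_norm (V t)) = integral {a..b} (speed J \<gamma>)"
    by (rule integral_spike[of "{a, b}", OF _ eq]) auto
  then show "(\<Sum>e\<in>G. (ortho_proj (\<gamma> b) e - ortho_proj (\<gamma> a) e) \<bullet> y e)
        \<le> 2 * L2_set (\<lambda>e. norm (y e)) G * integral {a..b} (speed J \<gamma>)"
    if "finite G" "G \<subseteq> some_basis" for G y
    using projection_increment_le[OF ab orb V int that] by simp
qed

lemma pw_smooth_props:
  assumes "pw_smooth J L0 \<gamma> a b"
  shows "\<gamma> a \<in> orbit \<and> \<gamma> b \<in> orbit"
    and "\<exists>F. finite F \<and> (\<forall>t\<in>{a..b} - F. regular \<gamma> t)"
    and "speed J \<gamma> integrable_on {a..b}"
    and "\<forall>G y. finite G \<longrightarrow> G \<subseteq> some_basis \<longrightarrow>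
      (\<Sum>e\<in>G. (ortho_proj (\<gamma> b) e - ortho_proj (\<gamma> a) e) \<bullet> y e)
        \<le> 2 * L2_set (\<lambda>e. norm (y e)) G * integral {a..b} (speed J \<gamma>)"
  using assms
proof (induction rule: pw_smooth.induct)
  case (piece a b)
  note p = smooth_piece[OF piece]
  { case 1 show ?case using p(1) piece(1) by simp }
  { case 2 show ?case using p(2) by (intro exI[of _ "{a, b}"]) auto }
  { case 3 show ?case by (rule p(3)) }
  { case 4 show ?case using p(4) by blast }
next
  case (join a b c)
  note p = smooth_piece[OF join.hyps(2,3)]
  have ab: "a < b" by (rule pw_smooth_less[OF join.hyps(1)])
  have int: "speed J \<gamma> integrable_on {a..c}"
    using ab join.hyps(2) by (intro Henstock_Kurzweil_Integration.integrable_combine[OF _ _ join.IH(3) p(3)]) auto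
  have comb: "integral {a..b} (speed J \<gamma>) + integral {b..c} (speed J \<gamma>) = integral {a..c} (speed J \<gamma>)"
    using ab join.hyps(2) by (intro Henstock_Kurzweil_Integration.integral_combine int) auto
  { case 1 show ?case using join.IH(1) p(1)[of c] join.hyps(2) by simp }
  { case 2
    obtain F where F: "finite F" "\<forall>t\<in>{a..b} - F. regular \<gamma> t" using join.IH(2) by blast
    have "regular \<gamma> t" if "t \<in> {a..c} - (F \<union> {b, c})" for t
      using F(2) p(2)[of t] that by (cases "t \<le> b") auto
    then show ?case using F(1) by (intro exI[of _ "F \<union> {b, c}"]) auto }
  { case 3 show ?case by (rule int) }
  { case 4 show ?case
    proof (intro allI impI)
      fix G :: "'a set" and y :: "'a \<Rightarrow> 'a"
      assume G: "finite G" "G \<subseteq> some_basis"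
      have "(\<Sum>e\<in>G. (ortho_proj (\<gamma> c) e - ortho_proj (\<gamma> a) e) \<bullet> y e)
        = (\<Sum>e\<in>G. (ortho_proj (\<gamma> b) e - ortho_proj (\<gamma> a) e) \<bullet> y e)
          + (\<Sum>e\<in>G. (ortho_proj (\<gamma> c) e - ortho_proj (\<gamma> b) e) \<bullet> y e)"
        by (simp add: inner_diff_left sum_subtractf)
      also have "\<dots> \<le> 2 * L2_set (\<lambda>e. norm (y e)) G * integral {a..b} (speed J \<gamma>)
          + 2 * L2_set (\<lambda>e. norm (y e)) G * integral {b..c} (speed J \<gamma>)"
        using join.IH(4) p(4) G by (intro add_mono) auto
      also have "\<dots> = 2 * L2_set (\<lambda>e. norm (y e)) G * integral {a..c} (speed J \<gamma>)"
        by (simp add: comb[symmetric] distrib_left)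
      finally show "(\<Sum>e\<in>G. (ortho_proj (\<gamma> c) e - ortho_proj (\<gamma> a) e) \<bullet> y e)
        \<le> 2 * L2_set (\<lambda>e. norm (y e)) G * integral {a..c} (speed J \<gamma>)" .
    qed }
qed

text \<open>
  The vectors \<open>y e\<close> of \<open>projection_increment_le\<close> are chosen as the values at \<open>e\<close> of the increment of
  the projections, so that the left-hand side becomes a partial sum of its squared norm. This is
  the lower bound for lengths from which separation of points and convergence are derived.
\<close>

lemma hs_norm_proj_diff_le:
  assumes pw: "pw_smooth J L0 \<gamma> a b"
  shows "hs_norm (ortho_proj (\<gamma> b) - ortho_proj (\<gamma> a)) \<le> 2 * integral {a..b} (speed J \<gamma>)"
proof (rule hs_boundI(2))
  note p = pw_smooth_props[OF pw]
  show "0 \<le> 2 * integral {a..b} (speed J \<gamma>)" by (simp add: Henstock_Kurzweil_Integration.integral_nonneg[OF p(3)])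
  fix G :: "'a set" assume G: "finite G" "G \<subseteq> some_basis"
  let ?y = "\<lambda>e. (ortho_proj (\<gamma> b) - ortho_proj (\<gamma> a)) e"
  let ?l = "L2_set (\<lambda>e. norm (?y e)) G"
  have "?l * ?l = (\<Sum>e\<in>G. (norm (?y e))\<^sup>2)"
    unfolding L2_set_def by (simp add: sum_nonneg)
  also have "\<dots> = (\<Sum>e\<in>G. (ortho_proj (\<gamma> b) e - ortho_proj (\<gamma> a) e) \<bullet> ?y e)"
    by (simp add: power2_norm_eq_inner blinfun.diff_left)
  also have "\<dots> \<le> 2 * ?l * integral {a..b} (speed J \<gamma>)" using p(4) G by blast
  finally have "?l * ?l \<le> ?l * (2 * integral {a..b} (speed J \<gamma>))" by (simp add: ac_simps)
  then show "?l \<le> 2 * integral {a..b} (speed J \<gamma>)"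
  proof (cases "?l = 0")
    case True
    show ?thesis unfolding True by (simp add: Henstock_Kurzweil_Integration.integral_nonneg[OF p(3)])
  next
    case False
    then have "?l > 0" using L2_set_nonneg[of "\<lambda>e. norm (?y e)" G] by linarith
    with \<open>?l * ?l \<le> ?l * (2 * integral {a..b} (speed J \<gamma>))\<close> show ?thesis by (simp only: mult_le_cancel_left_pos)
  qed
qed

lemma curve_length_eq:
  assumes pw: "pw_smooth J L0 \<gamma> 0 1"
  shows "curve_length J \<gamma> = integral {0..1} (speed J \<gamma>)"
proof -
  obtain F where F: "finite F" "\<forall>t\<in>{0..1} - F. regular \<gamma> t" using pw_smooth_props(2)[OF pw] by blast
  show ?thesis
    unfolding curve_length_def
  proof (rule integral_spike)
    show "negligible F" by (rule negligible_finite[OF F(1)])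
    fix t assume t: "t \<in> {0..1} - F"
    then have "regular \<gamma> t" using F by blast
    then obtain V where orb: "\<gamma> t \<in> orbit" "\<forall>\<^sub>F s in at t. \<gamma> s \<in> orbit"
      and V: "has_velocity J \<gamma> V t UNIV" by (auto simp: regular_def)
    have "velocity J \<gamma> t = V"
    proof (rule velocity_eq[OF has_velocity_subset[OF V]])
      show "\<forall>\<^sub>F s in at t within {0..1}. \<gamma> s \<in> orbit"
        using orb(2) at_le[of "{0..1}" UNIV t] filter_leD by blast
    qed (use t orb in auto)
    moreover have "V \<in> sym_hs_on (\<gamma> t)" using V by (simp add: has_velocity_def)
    ultimately show "speed J \<gamma> t = quotient_metric J (\<gamma> t) (velocity J \<gamma> t)"
      using quotient_metric_eq[OF orbit_Lagrangian[OF orb(1)]] speed_eq[OF orbit_Lagrangian[OF orb(1)] V] by simp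
  qed
qed

text \<open>
  The speed is multiplied by \<open>\<bar>\<alpha>\<bar>\<close> and the parameter interval by \<open>1 / \<bar>\<alpha>\<bar>\<close>.
\<close>

lemma integral_speed_affine:
  assumes pw: "pw_smooth J L0 \<gamma> c d" and \<alpha>: "\<alpha> \<noteq> 0"
    and im: "(\<lambda>x. (x - \<beta>) / \<alpha>) ` {c..d} = {a..b}"
  shows "integral {a..b} (speed J (\<lambda>s. \<gamma> (\<alpha> * s + \<beta>))) = integral {c..d} (speed J \<gamma>)"
proof -
  let ?\<phi> = "\<lambda>s. \<alpha> * s + \<beta>"
  note p = pw_smooth_props[OF pw]
  obtain F where F: "finite F" "\<forall>t\<in>{c..d} - F. regular \<gamma> t" using p(2) by blast
  have "(speed J \<gamma> has_integral integral {c..d} (speed J \<gamma>)) (cbox c d)"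
    using p(3) by (simp add: has_integral_integral)
  from has_integral_affinity[OF this \<alpha>, of \<beta>]
  have "((\<lambda>s. speed J \<gamma> (?\<phi> s)) has_integral (1 / \<bar>\<alpha>\<bar>) * integral {c..d} (speed J \<gamma>)) ((\<lambda>x. (x - \<beta>) / \<alpha>) ` {c..d})"
    by (simp add: diff_divide_distrib)
  then have "((\<lambda>s. speed J \<gamma> (?\<phi> s)) has_integral (1 / \<bar>\<alpha>\<bar>) * integral {c..d} (speed J \<gamma>)) {a..b}"
    unfolding im .
  from has_integral_mult_right[OF this, of "\<bar>\<alpha>\<bar>"]
  have "((\<lambda>s. \<bar>\<alpha>\<bar> * speed J \<gamma> (?\<phi> s)) has_integral integral {c..d} (speed J \<gamma>)) {a..b}"
    using \<alpha> by simp
  then have "((speed J (\<lambda>s. \<gamma> (?\<phi> s))) has_integral integral {c..d} (speed J \<gamma>)) {a..b}"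
  proof (rule has_integral_spike_finite[rotated 2])
    show "finite ((\<lambda>x. (x - \<beta>) / \<alpha>) ` F)" using F by simp
    fix s assume s: "s \<in> {a..b} - (\<lambda>x. (x - \<beta>) / \<alpha>) ` F"
    have "s = (?\<phi> s - \<beta>) / \<alpha>" using \<alpha> by simp
    moreover have "?\<phi> s \<in> {c..d}"
    proof -
      obtain x where "x \<in> {c..d}" "s = (x - \<beta>) / \<alpha>" using s im by blast
      then show ?thesis using \<alpha> by simp
    qed
    ultimately have "?\<phi> s \<in> {c..d} - F" using s by blast
    then have "regular \<gamma> (?\<phi> s)" using F(2) by blast
    then obtain V where orb: "\<gamma> (?\<phi> s) \<in> orbit" and V: "has_velocity J \<gamma> V (?\<phi> s) UNIV"
      unfolding regular_def by blast
    note W = orbit_Lagrangian[OF orb]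
    have "hilbert_schmidt V" using V by (simp add: has_velocity_def sym_hs_on_def)
    moreover have "speed J (\<lambda>s. \<gamma> (?\<phi> s)) s = hs_norm (\<alpha> *\<^sub>R V)"
      using W by (intro speed_eq has_velocity_affine[OF W V \<alpha>]) simp
    ultimately show "speed J (\<lambda>s. \<gamma> (?\<phi> s)) s = \<bar>\<alpha>\<bar> * speed J \<gamma> (?\<phi> s)"
      using speed_eq[OF W V] by (simp add: hs_scaleR)
  qed
  then show ?thesis by (rule integral_unique)
qed

definition path_length :: "'a set \<Rightarrow> 'a set \<Rightarrow> real \<Rightarrow> bool" where
  "path_length S T l \<longleftrightarrow>
     (\<exists>\<gamma>. pw_smooth J L0 \<gamma> 0 1 \<and> \<gamma> 0 = S \<and> \<gamma> 1 = T \<and> l = integral {0..1} (speed J \<gamma>))"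

lemma path_length_proj: "path_length S T l \<Longrightarrow> hs_norm (ortho_proj T - ortho_proj S) \<le> 2 * l"
  using hs_norm_proj_diff_le by (auto simp: path_length_def)

lemma path_length_sym:
  assumes "path_length S T l"
  shows "path_length T S l"
proof -
  obtain \<gamma> where \<gamma>: "pw_smooth J L0 \<gamma> 0 1" "\<gamma> 0 = S" "\<gamma> 1 = T" "l = integral {0..1} (speed J \<gamma>)"
    using assms by (auto simp: path_length_def)
  have "pw_smooth J L0 (\<lambda>s. \<gamma> ((-1) * s + 1)) 0 1"
    using pw_smooth_affine_neg[OF \<gamma>(1), of "-1" 1] by simp
  moreover have "(\<lambda>x. (x - 1) / (-1)) ` {0..1} = {0..1::real}"
    by (auto simp: image_iff intro!: bexI[of _ "1 - _"])
  from integral_speed_affine[OF \<gamma>(1) _ this]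
  have "integral {0..1} (speed J (\<lambda>s. \<gamma> ((-1) * s + 1))) = l" by (simp add: \<gamma>)
  ultimately show ?thesis using \<gamma> unfolding path_length_def by (intro exI[of _ "\<lambda>s. \<gamma> ((-1) * s + 1)"]) simp
qed

text \<open>
  The two curves are traversed one after the other at double speed.
\<close>

lemma path_length_trans:
  assumes "path_length S T l" "path_length T U m"
  shows "path_length S U (l + m)"
proof -
  obtain \<gamma> where \<gamma>: "pw_smooth J L0 \<gamma> 0 1" "\<gamma> 0 = S" "\<gamma> 1 = T" "l = integral {0..1} (speed J \<gamma>)"
    using assms by (auto simp: path_length_def)
  obtain \<delta> where \<delta>: "pw_smooth J L0 \<delta> 0 1" "\<delta> 0 = T" "\<delta> 1 = U" "m = integral {0..1} (speed J \<delta>)"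
    using assms by (auto simp: path_length_def)
  define \<eta> where "\<eta> s = (if s \<le> 1/2 then \<gamma> (2 * s + 0) else \<delta> (2 * s + -1))" for s :: real
  have e1: "\<gamma> (2 * s + 0) = \<eta> s" if "s \<in> {0..1/2}" for s using that by (simp add: \<eta>_def)
  have e2: "\<delta> (2 * s + -1) = \<eta> s" if "s \<in> {1/2..1}" for s
  proof (cases "s = 1/2")
    case True
    show ?thesis unfolding True by (simp add: \<eta>_def \<gamma> \<delta>)
  next
    case False then show ?thesis using that by (simp add: \<eta>_def)
  qed
  have p1: "pw_smooth J L0 (\<lambda>s. \<gamma> (2 * s + 0)) 0 (1/2)"
    using pw_smooth_affine_pos[OF \<gamma>(1), of 2 0] by simp
  have p2: "pw_smooth J L0 (\<lambda>s. \<delta> (2 * s + -1)) (1/2) 1"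
    using pw_smooth_affine_pos[OF \<delta>(1), of 2 "-1"] by simp
  have pw: "pw_smooth J L0 \<eta> 0 1"
    using pw_smooth_trans[OF pw_smooth_cong[OF p1 e1] pw_smooth_cong[OF p2 e2]] by simp
  have "(\<lambda>x. (x - 0) / 2) ` {0..1} = {0..1/2::real}"
    by (auto simp: image_iff intro!: bexI[of _ "2 * _"])
  from integral_speed_affine[OF \<gamma>(1) _ this]
  have i1: "integral {0..1/2} (speed J \<eta>) = l"
    using integral_speed_cong[OF e1, where J=J] by (simp add: \<gamma>)
  have "(\<lambda>x. (x - (-1)) / 2) ` {0..1} = {1/2..1::real}"
    by (auto simp: image_iff intro!: bexI[of _ "2 * _ - 1"])
  from integral_speed_affine[OF \<delta>(1) _ this]
  have i2: "integral {1/2..1} (speed J \<eta>) = m"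
    using integral_speed_cong[OF e2, where J=J] by (simp add: \<delta>)
  have "integral {0..1/2} (speed J \<eta>) + integral {1/2..1} (speed J \<eta>) = integral {0..1} (speed J \<eta>)"
    by (rule Henstock_Kurzweil_Integration.integral_combine[OF _ _ pw_smooth_props(3)[OF pw]]) auto
  then have "l + m = integral {0..1} (speed J \<eta>)" by (simp add: i1 i2)
  moreover have "\<eta> 0 = S" "\<eta> 1 = U" by (simp_all add: \<eta>_def \<gamma> \<delta>)
  ultimately show ?thesis using pw by (auto simp: path_length_def)
qed

lemma hs_smooth_on_linear:
  assumes A: "hilbert_schmidt A"
  shows "hs_smooth_on S (\<lambda>s. s *\<^sub>R A)" and "hs_has_derivative (\<lambda>s. s *\<^sub>R A) A t S"
proof -
  show d: "hs_has_derivative (\<lambda>s. s *\<^sub>R A) A t S" for t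
  proof (rule hs_has_derivativeI)
    show "hs_tendsto (\<lambda>s. (1 / (s - t)) *\<^sub>R (s *\<^sub>R A - t *\<^sub>R A)) A (at t within S)"
      by (rule hs_tendsto_cong[OF hs_tendsto_const[OF A]])
         (simp add: eventually_at_filter scaleR_left_diff_distrib[symmetric])
  qed (simp_all add: A hs_scaleR)
  have c: "hs_has_derivative (\<lambda>s. B) 0 t S" if "hilbert_schmidt B" for B t
    by (rule hs_has_derivativeI) (simp_all add: that hs_tendsto_const)
  define D where "D n s = (if n = 0 then s *\<^sub>R A else if n = 1 then A else 0)" for n :: nat and s :: real
  have D0: "D 0 = (\<lambda>s. s *\<^sub>R A)" and D1: "D (Suc 0) = (\<lambda>s. A)" and D2: "D (Suc (Suc n)) = (\<lambda>s. 0)" for n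
    by (auto simp: D_def)
  have "hs_has_derivative (D n) (D (Suc n) t) t S" for n t
  proof (cases n)
    case 0 then show ?thesis using d by (simp add: D0 D1)
  next
    case (Suc k) then show ?thesis using c[OF A, of t] c[of 0 t] by (cases k) (simp_all add: D1 D2)
  qed
  then show "hs_smooth_on S (\<lambda>s. s *\<^sub>R A)"
    unfolding hs_smooth_on_def by (intro exI[of _ D]) (simp add: D0)
qed

text \<open>
  The graphs of \<open>s T\<close> for \<open>0 \<le> s \<le> 1\<close> form a straight segment in the chart at \<open>L\<close>, with constant chart
  derivative \<open>J T\<close>. Its velocity at each time is a compression of \<open>J T\<close>, and so has norm at most \<open>\<parallel>T\<parallel>\<^sub>2\<close>.
\<close>

lemma segment_path:
  assumes L: "L \<in> orbit" and W: "W \<in> Lagrangian J" and T: "is_graph_op L W T" and hs: "hilbert_schmidt T"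
  shows "\<exists>l\<le>hs_norm T. path_length L W l"
proof -
  note LL = orbit_Lagrangian[OF L]
  note Ls = orbit_subspace[OF L] orbit_closed[OF L]
  have sh: "shear L (s *\<^sub>R T)" for s
    using is_graph_op_shear[OF LL W T] subspace_orthogonal_comp[of L]
    by (auto simp: shear_def blinfun.scaleR_left blinfun.scaleR_right subspace_scale)
  define \<gamma> where "\<gamma> s = blinfun_apply (id_blinfun + s *\<^sub>R T) ` L" for s
  have g: "is_graph_op L (\<gamma> s) (s *\<^sub>R T)" for s unfolding \<gamma>_def by (rule shear_graph[OF sh])
  have orb: "\<gamma> s \<in> orbit" for s
    unfolding \<gamma>_def by (rule Sp2_orbit_image[OF L shear_Sp2[OF LL sh hs_scaleR(1)[OF hs]]])
  have dom: "\<gamma> s \<in> chart_dom J L \<inter> orbit" for s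
    using is_graph_op_chart_dom[OF LL orbit_Lagrangian[OF orb] g] orb by blast
  let ?A = "J o\<^sub>L T"
  have A: "hilbert_schmidt ?A" by (rule hs_compose_left(1)[OF hs])
  have ch: "chart J L (\<gamma> s) = s *\<^sub>R ?A" for s
    by (rule blinfun_eqI) (simp add: chart_def graph_op_eq[OF Ls g] blinfun.scaleR_left blinfun.scaleR_right)
  have "smooth_curve_on J L0 0 1 \<gamma>"
    unfolding smooth_curve_on_def
    using L dom hs_smooth_on_linear(1)[OF A] by (intro ballI bexI[of _ L] exI[of _ 1]) (auto simp: ch)
  then have pw: "pw_smooth J L0 \<gamma> 0 1" by (intro pw_smooth.piece) simp_all
  have le: "speed J \<gamma> t \<le> hs_norm T" for t
  proof -
    let ?p = "ortho_proj (\<gamma> t)"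
    have "has_velocity J \<gamma> (?p o\<^sub>L ?A o\<^sub>L ?p) t UNIV"
    proof (rule chart_velocity[OF L _ dom])
      show "hs_has_derivative (\<lambda>s. chart J L (\<gamma> s)) ?A t UNIV"
        unfolding ch by (rule hs_smooth_on_linear(2)[OF A])
    qed simp_all
    then have "speed J \<gamma> t = hs_norm (?p o\<^sub>L ?A o\<^sub>L ?p)" by (rule speed_eq[OF orbit_Lagrangian[OF orb]])
    also have "\<dots> \<le> hs_norm ?A"
      using norm_ortho_proj[OF orbit_subspace[OF orb] orbit_closed[OF orb]] by (intro hs_sandwich(2)[OF A])
    also have "\<dots> \<le> norm J * hs_norm T" by (rule hs_compose_left(2)[OF hs])
    also have "\<dots> \<le> 1 * hs_norm T" using norm_J by (intro mult_right_mono) auto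
    finally show ?thesis by simp
  qed
  have "integral {0..1} (speed J \<gamma>) \<le> integral {0..1} (\<lambda>t::real. hs_norm T)"
    using le by (intro integral_le pw_smooth_props(3)[OF pw]) auto
  then have "integral {0..1} (speed J \<gamma>) \<le> hs_norm T" by simp
  moreover have "\<gamma> 0 = L" by (simp add: \<gamma>_def)
  moreover have "\<gamma> 1 = W" using is_graph_op_image[OF T] by (simp add: \<gamma>_def)
  ultimately show ?thesis using pw by (auto simp: path_length_def)
qed

text \<open>
  Two straight segments, one in the chart at \<open>S\<close> and one in the chart at \<open>T\<close>, meet at the subspace
  constructed in \<open>common_chart\<close>.
\<close>

lemma path_exists:
  assumes S: "S \<in> orbit" and T: "T \<in> orbit"
  shows "\<exists>l. path_length S T l"
proof -
  obtain L G H where L: "L \<in> orbit" and G: "is_graph_op T L G" and H: "is_graph_op S L H"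
    using common_chart[OF S T] by blast
  obtain l where "path_length T L l"
    using segment_path[OF T orbit_Lagrangian[OF L] G orbit_graph_hs[OF T L G]] by blast
  moreover obtain m where "path_length S L m"
    using segment_path[OF S orbit_Lagrangian[OF L] H orbit_graph_hs[OF S L H]] by blast
  ultimately show ?thesis using path_length_trans path_length_sym by blast
qed

section \<open>The geodesic distance\<close>

lemma path_length_nonneg:
  assumes "path_length S T l" shows "0 \<le> l"
  using path_length_proj[OF assms] hs_norm_ge_0[of "ortho_proj T - ortho_proj S"] by linarith

lemma geodesic_dist_eq:
  assumes "S \<in> orbit" "T \<in> orbit"
  shows "geodesic_dist J L0 S T = Inf {l. path_length S T l}"
proof -
  have "{curve_length J \<gamma> | \<gamma>. piecewise_smooth_curve J L0 \<gamma> \<and> \<gamma> 0 = S \<and> \<gamma> 1 = T} = {l. path_length S T l}"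
    unfolding piecewise_smooth_curve_iff path_length_def by (rule Collect_cong) (metis curve_length_eq)
  then show ?thesis using assms by (simp add: geodesic_dist_def)
qed

lemma geodesic_dist_le:
  assumes "S \<in> orbit" "T \<in> orbit" "path_length S T l"
  shows "geodesic_dist J L0 S T \<le> l"
  unfolding geodesic_dist_eq[OF assms(1,2)]
  by (rule cInf_lower) (use assms(3) path_length_nonneg in \<open>auto intro: bdd_belowI[of _ 0]\<close>)

lemma geodesic_dist_approx:
  assumes "S \<in> orbit" "T \<in> orbit" "\<epsilon> > 0"
  obtains l where "path_length S T l" "l < geodesic_dist J L0 S T + \<epsilon>"
  using cInf_lessD[of "{l. path_length S T l}" "geodesic_dist J L0 S T + \<epsilon>"] path_exists[OF assms(1,2)] assms(3)
  by (auto simp: geodesic_dist_eq[OF assms(1,2)])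

text \<open>
  The estimate \<open>hs_norm_proj_diff_le\<close>, passed to the infimum over all curves.
\<close>

lemma geodesic_dist_ge:
  assumes "S \<in> orbit" "T \<in> orbit"
  shows "hs_norm (ortho_proj T - ortho_proj S) \<le> 2 * geodesic_dist J L0 S T"
proof (rule field_le_epsilon)
  fix \<epsilon> :: real assume "\<epsilon> > 0"
  then have "\<epsilon> / 2 > 0" by simp
  from geodesic_dist_approx[OF assms this] obtain l
    where "path_length S T l" "l < geodesic_dist J L0 S T + \<epsilon> / 2" by blast
  with path_length_proj show "hs_norm (ortho_proj T - ortho_proj S) \<le> 2 * geodesic_dist J L0 S T + \<epsilon>"
    by fastforce
qed

lemma geodesic_dist_le_graph:
  assumes S: "S \<in> orbit" and W: "W \<in> orbit"
    and T: "is_graph_op S W T" "hilbert_schmidt T"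
  shows "geodesic_dist J L0 S W \<le> hs_norm T"
  using segment_path[OF S orbit_Lagrangian[OF W] T] geodesic_dist_le[OF S W] by fastforce

lemma Metric_space_geodesic_dist: "Metric_space orbit (geodesic_dist J L0)"
proof
  show "0 \<le> geodesic_dist J L0 S T" for S T
  proof (cases "S \<in> orbit \<and> T \<in> orbit")
    case True
    then show ?thesis using geodesic_dist_ge[of S T] hs_norm_ge_0[of "ortho_proj T - ortho_proj S"] by linarith
  next
    case False then show ?thesis by (auto simp: geodesic_dist_def)
  qed
  show "geodesic_dist J L0 S T = geodesic_dist J L0 T S" for S T
  proof (cases "S \<in> orbit \<and> T \<in> orbit")
    case True
    have "{l. path_length S T l} = {l. path_length T S l}" using path_length_sym by blast
    then show ?thesis using True by (simp add: geodesic_dist_eq)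
  next
    case False then show ?thesis by (auto simp: geodesic_dist_def)
  qed
  show "geodesic_dist J L0 S T = 0 \<longleftrightarrow> S = T"
    if S: "S \<in> orbit" and T: "T \<in> orbit" for S T
  proof
    assume "geodesic_dist J L0 S T = 0"
    then have "hs_norm (ortho_proj T - ortho_proj S) \<le> 0" using geodesic_dist_ge[OF S T] by simp
    then have "norm (ortho_proj T - ortho_proj S) \<le> 0" using norm_le_hs_norm[OF orbit_proj_diff[OF T S]] by linarith
    then have "ortho_proj T = ortho_proj S" by simp
    then show "S = T"
      using ortho_proj_fixed[OF orbit_subspace[OF S] orbit_closed[OF S]]
        ortho_proj_fixed[OF orbit_subspace[OF T] orbit_closed[OF T]] by (metis set_eqI)
  next
    assume "S = T"
    have "is_graph_op S S 0"
      using subspace_0[OF subspace_orthogonal_comp] by (auto simp: is_graph_op_def)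
    then have "geodesic_dist J L0 S S \<le> 0" using geodesic_dist_le_graph[OF S S] by fastforce
    then show "geodesic_dist J L0 S T = 0"
      using \<open>S = T\<close> geodesic_dist_ge[OF S S] hs_norm_ge_0[of "ortho_proj S - ortho_proj S"] by simp
  qed
  show "geodesic_dist J L0 S U \<le> geodesic_dist J L0 S T + geodesic_dist J L0 T U"
    if S: "S \<in> orbit" and T: "T \<in> orbit" and U: "U \<in> orbit" for S T U
  proof (rule field_le_epsilon)
    fix \<epsilon> :: real assume "\<epsilon> > 0"
    then have e: "\<epsilon> / 2 > 0" by simp
    obtain l where l: "path_length S T l" "l < geodesic_dist J L0 S T + \<epsilon> / 2"
      using geodesic_dist_approx[OF S T e] by blast
    obtain m where m: "path_length T U m" "m < geodesic_dist J L0 T U + \<epsilon> / 2"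
      using geodesic_dist_approx[OF T U e] by blast
    have "geodesic_dist J L0 S U \<le> l + m" by (rule geodesic_dist_le[OF S U path_length_trans[OF l(1) m(1)]])
    then show "geodesic_dist J L0 S U \<le> geodesic_dist J L0 S T + geodesic_dist J L0 T U + \<epsilon>"
      using l m by linarith
  qed
qed

text \<open>
  The pointwise limit \<open>P\<close> is again symmetric and idempotent and satisfies \<open>P J = J - J P\<close>. The first
  two properties make it the orthogonal projection onto its fixed space, the last one makes this
  space maximal isotropic.
\<close>

lemma Lagrangian_limit:
  assumes lag: "\<And>n. W n \<in> Lagrangian J"
    and lim: "\<And>x. (\<lambda>n. ortho_proj (W n) x) \<longlonglongrightarrow> P x"
  obtains V where "V \<in> Lagrangian J" "\<And>x. ortho_proj V x = P x"
proof -
  note sub = Lagrangian_subspace[OF lag] and cl = Lagrangian_closed[OF lag]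
  have P_add: "P (x + y) = P x + P y" for x y
  proof (rule LIMSEQ_unique[OF lim])
    show "(\<lambda>n. ortho_proj (W n) (x + y)) \<longlonglongrightarrow> P x + P y"
      unfolding blinfun.add_right by (intro tendsto_intros lim)
  qed
  have P_scale: "P (c *\<^sub>R x) = c *\<^sub>R P x" for c x
  proof (rule LIMSEQ_unique[OF lim])
    show "(\<lambda>n. ortho_proj (W n) (c *\<^sub>R x)) \<longlonglongrightarrow> c *\<^sub>R P x"
      unfolding blinfun.scaleR_right by (intro tendsto_intros lim)
  qed
  have P_norm: "norm (P x) \<le> norm x" for x
    by (rule tendsto_upperbound[OF tendsto_norm[OF lim]]) (use norm_ortho_proj_le[OF sub cl] in auto)
  have blin: "bounded_linear P"
    by (rule bounded_linear_intro[of P 1]) (use P_add P_scale P_norm in auto)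
  interpret P: bounded_linear P by (rule blin)
  have P_sym: "P x \<bullet> y = x \<bullet> P y" for x y
  proof (rule LIMSEQ_unique)
    show "(\<lambda>n. ortho_proj (W n) x \<bullet> y) \<longlonglongrightarrow> P x \<bullet> y" by (intro tendsto_intros lim)
    show "(\<lambda>n. ortho_proj (W n) x \<bullet> y) \<longlonglongrightarrow> x \<bullet> P y"
      unfolding ortho_proj_sym[OF sub cl] by (intro tendsto_intros lim)
  qed
  have P_J: "P (J x) = J x - J (P x)" for x
  proof (rule LIMSEQ_unique[OF lim])
    show "(\<lambda>n. ortho_proj (W n) (J x)) \<longlonglongrightarrow> J x - J (P x)"
      unfolding ortho_proj_J[OF lag] by (intro tendsto_intros lim)
  qed
  have P_idem: "P (P x) = P x" for x
  proof (rule LIMSEQ_unique[OF _ lim])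
    have "(\<lambda>n. ortho_proj (W n) (ortho_proj (W n) x - P x) + ortho_proj (W n) (P x)) \<longlonglongrightarrow> 0 + P (P x)"
    proof (intro tendsto_add lim)
      have "(\<lambda>n. norm (ortho_proj (W n) x - P x)) \<longlonglongrightarrow> 0"
        using tendsto_norm_zero[OF LIM_zero[OF lim]] .
      then show "(\<lambda>n. ortho_proj (W n) (ortho_proj (W n) x - P x)) \<longlonglongrightarrow> 0"
        by (rule Lim_null_comparison[rotated]) (simp add: norm_ortho_proj_le[OF sub cl])
    qed
    then show "(\<lambda>n. ortho_proj (W n) x) \<longlonglongrightarrow> P (P x)"
      by (simp add: blinfun.diff_right ortho_proj_idem[OF sub cl])
  qed
  define V where "V = {x. P x = x}"
  have Vs: "subspace V" by (auto simp: V_def subspace_def P.add P.scaleR P.zero)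
  have Vc: "closed V"
    unfolding V_def by (intro closed_Collect_eq P.continuous_on[OF continuous_on_id] continuous_on_id)
  have "V \<in> Lagrangian J"
  proof (rule LagrangianI[OF Vs Vc])
    fix x y assume "x \<in> V" "y \<in> V"
    then have xy: "P x = x" "P y = y" by (auto simp: V_def)
    have "(\<lambda>n. J (ortho_proj (W n) x) \<bullet> ortho_proj (W n) y) \<longlonglongrightarrow> J (P x) \<bullet> P y"
      by (intro tendsto_intros lim)
    moreover have "J (ortho_proj (W n) x) \<bullet> ortho_proj (W n) y = 0" for n
      by (rule Lagrangian_isotropic[OF lag ortho_proj_in[OF sub cl] ortho_proj_in[OF sub cl]])
    ultimately show "J x \<bullet> y = 0" using LIMSEQ_unique[OF _ tendsto_const] xy by fastforce
  next
    fix x assume x: "\<And>y. y \<in> V \<Longrightarrow> J x \<bullet> y = 0"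
    have "P (J x) \<bullet> P (J x) = J x \<bullet> P (P (J x))" by (rule P_sym)
    also have "\<dots> = 0" by (rule x) (simp add: V_def P_idem)
    finally have "P (J x) = 0" by simp
    then have "J (x - P x) = 0" using P_J by (simp add: blinfun.diff_right)
    then have "norm (x - P x) = 0" using J_isometry by (metis norm_zero)
    then show "x \<in> V" by (simp add: V_def)
  qed
  moreover have "ortho_proj V x = P x" for x
  proof (rule orthogonal_decomposition_unique[OF Vs ortho_proj_in[OF Vs Vc] _ ortho_proj_diff[OF Vs Vc]])
    show "P x \<in> V" by (simp add: V_def P_idem)
    show "x - P x \<in> V\<^sup>\<bottom>"
      unfolding orthogonal_comp_iff
    proof
      fix w assume "w \<in> V"
      then have "(x - P x) \<bullet> w = (x - P x) \<bullet> P w" by (simp add: V_def)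
      also have "\<dots> = P (x - P x) \<bullet> w" by (simp add: P_sym)
      finally show "(x - P x) \<bullet> w = 0" by (simp add: P.diff P_idem)
    qed
  qed
  ultimately show ?thesis using that by blast
qed

text \<open>
  For a Cauchy sequence \<open>\<sigma>\<close> the projections are Cauchy in the Hilbert--Schmidt norm, so their
  pointwise limit is the projection onto a Lagrangian \<open>V\<close>, and the differences to it are
  Hilbert--Schmidt operators of norm tending to zero. Hence \<open>V\<close> is eventually the graph over \<open>\<sigma> n\<close> of
  an operator of small norm. The associated shear moves \<open>\<sigma> n\<close> to \<open>V\<close>, so \<open>V\<close> belongs to the orbit, and
  the straight segment bounds the distance.
\<close>

lemma mcomplete_geodesic_dist: "Metric_space.mcomplete orbit (geodesic_dist J L0)"
proof -
  interpret M: Metric_space "orbit" "geodesic_dist J L0" by (rule Metric_space_geodesic_dist)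
  show ?thesis
    unfolding M.mcomplete_def
  proof (intro allI impI)
    fix \<sigma> :: "nat \<Rightarrow> 'a set" assume "M.MCauchy \<sigma>"
    then have orb: "\<And>n. \<sigma> n \<in> orbit"
      and cau: "\<And>\<epsilon>. \<epsilon> > 0 \<Longrightarrow> \<exists>N. \<forall>n n'. N \<le> n \<longrightarrow> N \<le> n' \<longrightarrow> geodesic_dist J L0 (\<sigma> n) (\<sigma> n') < \<epsilon>"
      by (auto simp: M.MCauchy_def)
    note lag = orbit_Lagrangian[OF orb]
    let ?p = "\<lambda>n. ortho_proj (\<sigma> n)"
    have hs_cau: "\<exists>N. \<forall>m n. N \<le> m \<longrightarrow> N \<le> n \<longrightarrow> hs_norm (?p m - ?p n) \<le> \<epsilon>" if "\<epsilon> > 0" for \<epsilon>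
    proof -
      have "\<epsilon> / 2 > 0" using that by simp
      from cau[OF this] obtain N where N: "\<And>n m. N \<le> n \<Longrightarrow> N \<le> m \<Longrightarrow> geodesic_dist J L0 (\<sigma> n) (\<sigma> m) < \<epsilon> / 2" by blast
      have "hs_norm (?p m - ?p n) \<le> \<epsilon>" if "N \<le> m" "N \<le> n" for m n
        using geodesic_dist_ge[OF orb orb, of m n] N[OF that(2,1)] by linarith
      then show ?thesis by blast
    qed
    have "convergent (\<lambda>n. ?p n x)" for x
    proof (rule Cauchy_convergent, rule metric_CauchyI)
      fix \<epsilon> :: real assume \<epsilon>: "\<epsilon> > 0"
      \<comment> \<open>the summand \<open>1\<close> covers \<open>x = 0\<close>\<close>
      define \<delta> where "\<delta> = \<epsilon> / (norm x + 1)"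
      have pos: "norm x + 1 > 0" using norm_ge_zero[of x] by linarith
      then have \<delta>: "\<delta> > 0" using \<epsilon> by (simp add: \<delta>_def)
      from hs_cau[OF this] obtain N where N: "\<And>m n. N \<le> m \<Longrightarrow> N \<le> n \<Longrightarrow> hs_norm (?p m - ?p n) \<le> \<delta>" by blast
      have "dist (?p m x) (?p n x) < \<epsilon>" if "N \<le> m" "N \<le> n" for m n
      proof -
        have "dist (?p m x) (?p n x) \<le> norm (?p m - ?p n) * norm x"
          using norm_blinfun[of "?p m - ?p n" x] by (simp add: dist_norm blinfun.diff_left)
        also have "\<dots> \<le> \<delta> * norm x"
          using norm_le_hs_norm[OF orbit_proj_diff[OF orb orb], of m n] N[OF that] by (intro mult_right_mono) auto
        also have "\<dots> < \<delta> * (norm x + 1)" using \<delta> by simp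
        also have "\<dots> = \<epsilon>" using pos by (simp add: \<delta>_def)
        finally show ?thesis .
      qed
      then show "\<exists>M. \<forall>m\<ge>M. \<forall>n\<ge>M. dist (?p m x) (?p n x) < \<epsilon>" by blast
    qed
    then have P: "(\<lambda>n. ?p n x) \<longlonglongrightarrow> lim (\<lambda>n. ?p n x)" for x by (simp add: convergent_LIMSEQ_iff)
    obtain V where V: "V \<in> Lagrangian J" and Vlim: "\<And>x. ortho_proj V x = lim (\<lambda>n. ?p n x)"
      using Lagrangian_limit[OF lag P] by blast
    have lim: "(\<lambda>n. ?p n x) \<longlonglongrightarrow> ortho_proj V x" for x
      unfolding Vlim by (rule P)
    have close: "hilbert_schmidt (ortho_proj V - ?p n) \<and> hs_norm (ortho_proj V - ?p n) \<le> \<epsilon>"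
      if N: "\<forall>m n. N \<le> m \<longrightarrow> N \<le> n \<longrightarrow> hs_norm (?p m - ?p n) \<le> \<epsilon>" and \<epsilon>: "\<epsilon> > 0" and n: "N \<le> n" for N \<epsilon> n
    proof -
      have "\<forall>\<^sub>F m in sequentially. hilbert_schmidt (?p m - ?p n) \<and> hs_norm (?p m - ?p n) \<le> \<epsilon>"
        using eventually_ge_at_top[of N] by eventually_elim (use N n orbit_proj_diff[OF orb orb] in blast)
      moreover have "(\<lambda>m. (?p m - ?p n) x) \<longlonglongrightarrow> (ortho_proj V - ?p n) x" for x
        unfolding blinfun.diff_left by (intro tendsto_intros lim)
      ultimately show ?thesis using hs_closed[of "\<lambda>m. ?p m - ?p n" \<epsilon> sequentially "ortho_proj V - ?p n"] \<epsilon> by auto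
    qed
    have near: "V \<in> orbit \<and> geodesic_dist J L0 (\<sigma> n) V \<le> 2 * \<epsilon>"
      if N: "\<forall>m n. N \<le> m \<longrightarrow> N \<le> n \<longrightarrow> hs_norm (?p m - ?p n) \<le> \<epsilon>"
        and \<epsilon>: "\<epsilon> > 0" "\<epsilon> \<le> 1/2" and n: "N \<le> n" for N \<epsilon> n
    proof -
      let ?X = "ortho_proj V - ?p n"
      have X: "hilbert_schmidt ?X" "hs_norm ?X \<le> \<epsilon>" using close[OF N \<epsilon>(1) n] by auto
      then have X2: "norm ?X \<le> 1/2" using norm_le_hs_norm[OF X(1)] \<epsilon>(2) by linarith
      obtain T where T: "is_graph_op (\<sigma> n) V T" using proj_close_graph[OF lag V X2] by blast
      note est = graph_op_hs_estimate(1,2)[OF orbit_subspace[OF orb] orbit_closed[OF orb] T proj_mem_add[OF V lag] X(1)]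
      have hT: "hilbert_schmidt T" "hs_norm T \<le> 2 * \<epsilon>" using est X2 X(2) by fastforce+
      have "V \<in> orbit" by (rule orbit_graph[OF orb V T hT(1)])
      with geodesic_dist_le_graph[OF orb _ T hT(1)] hT(2) show ?thesis by fastforce
    qed
    have "\<exists>N. \<forall>n\<ge>N. V \<in> orbit \<and> geodesic_dist J L0 (\<sigma> n) V < \<epsilon>" if "\<epsilon> > 0" for \<epsilon>
    proof -
      \<comment> \<open>\<open>1/2\<close> is the radius in which graph operators exist; the distance is at most \<open>2 \<delta>\<close>\<close>
      define \<delta> where "\<delta> = min (\<epsilon> / 3) (1/2)"
      have \<delta>: "\<delta> > 0" "\<delta> \<le> 1/2" "2 * \<delta> < \<epsilon>" using that by (auto simp: \<delta>_def)
      obtain N where N: "\<forall>m n. N \<le> m \<longrightarrow> N \<le> n \<longrightarrow> hs_norm (?p m - ?p n) \<le> \<delta>" using hs_cau[OF \<delta>(1)] by blast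
      show ?thesis using near[OF N \<delta>(1,2)] \<delta>(3) by (intro exI[of _ N]) fastforce
    qed
    note conv = this
    have "V \<in> orbit" using conv[of 1] by auto
    then have "limitin M.mtopology \<sigma> V sequentially"
      unfolding M.limit_metric_sequentially using orb conv by blast
    then show "\<exists>V. limitin M.mtopology \<sigma> V sequentially" by blast
  qed
qed

end

theorem theorem4p9:
  fixes J :: "'a::{real_inner,complete_space} \<Rightarrow>\<^sub>L 'a" and L0 :: "'a set"
  assumes infinite_dim: "\<not> (\<exists>B::'a set. finite B \<and> span B = UNIV)"
    and J_isometry: "\<And>x. norm (blinfun_apply J x) = norm x"
    and J_square: "J o\<^sub>L J = - id_blinfun"
    and J_adjoint: "adjoint (blinfun_apply J) = (\<lambda>x. - blinfun_apply J x)"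
    and L0: "L0 \<in> Lagrangian J"
  shows "Metric_space (Sp2_orbit J L0) (geodesic_dist J L0) \<and>
         Metric_space.mcomplete (Sp2_orbit J L0) (geodesic_dist J L0)"
proof -
  interpret Lagrangian_orbit J L0
    by unfold_locales (fact J_isometry J_square J_adjoint L0)+
  show ?thesis using Metric_space_geodesic_dist mcomplete_geodesic_dist by blast
qed

end
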